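(* The type equivalence problem for context-free session types is decidable: there is an algorithm that, given session types $T$ and $U$ with $\Delta\vdash T:\mathsf{s}^m$ and $\Delta\vdash U:\mathsf{s}^m$, decides whether $T\simeq U$.
   Context: Session types: $T ::= \mathsf{Skip} \mid {!}B \mid {?}B \mid \oplus\{\ell:T_\ell\}_{\ell\in L} \mid \&\{\ell:T_\ell\}_{\ell\in L} \mid T;T \mid \mu a{:}\kappa.T \mid a$ ($B$ message types such as unit, $a$ type variables), with kinding: $\mathsf{Skip}:\mathsf{s}^{\mathsf{un}}$; ${!}B,{?}B:\mathsf{s}^{\mathsf{lin}}$; choices $:\mathsf{s}^{\mathsf{lin}}$ when all branches are; $T;U:\mathsf{s}^{\mathsf{lin}}$ when both are; $\mu a{:}\kappa.T:\kappa$ when $T$ is contractive on $a$ and $\Delta,a{:}\kappa\vdash T:\kappa$; variables by lookup; subsumption $\mathsf{un}\le\mathsf{lin}$. Terminated: $\mathsf{Skip}$; $T;U$ iff both terminated; $\mu a.T$ iff $T$ terminated. Contractive on $a$: $T\neq a$; for $T=U;V$, $U$ contractive on $a$ and if $U$ terminated then $V$ contractive on $a$; for $\mu b.T'$, $T'$ contractive on $a$. Session-type LTS: ${!}B\xrightarrow{!B}\mathsf{Skip}$, ${?}B\xrightarrow{?B}\mathsf{Skip}$, $\star\{\ell:T_\ell\}_{\ell\in L}\xrightarrow{\star k}T_k$ ($k\in L$, $\star\in\{\oplus,\&\}$), $b\xrightarrow{b}\mathsf{Skip}$ for free variables $b$; $\mu a.T\xrightarrow{\alpha}T'$ if $T[\mu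 a.T/a]\xrightarrow{\alpha}T'$; $T;U\xrightarrow{\alpha}T';U$ if $T\xrightarrow{\alpha}T'$; $T;U\xrightarrow{\alpha}U'$ if $T$ is terminated and $U\xrightarrow{\alpha}U'$. Type equivalence $T\simeq U$ is bisimilarity on this LTS. *)

theory Defs
  imports Main "HOL-Library.Nat_Bijection"
begin

text \<open>Multiplicities; the kinds of session types are s^un and s^lin,
  represented by their multiplicity.\<close>
datatype mult = UnM | LinM

text \<open>Message types B and labels are represented by natural numbers.
  Type variables use de Bruijn indices; Rec m T binds index 0 in T
  (it stands for mu a:s^m. T).  Choices are association lists from labels
  to continuations (labels are required to be distinct by the kinding).\<close>
datatype stype =
    Skip
  | Out nat
  | In nat
  | IntCh "(nat \<times> stype) list"
  | ExtCh "(nat \<times> stype) list"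
  | Seq stype stype
  | Rec mult stype
  | Var nat

fun lift :: "nat \<Rightarrow> stype \<Rightarrow> stype" where
  "lift k Skip = Skip"
| "lift k (Out b) = Out b"
| "lift k (In b) = In b"
| "lift k (IntCh bs) = IntCh (map (\<lambda>(l, T). (l, lift k T)) bs)"
| "lift k (ExtCh bs) = ExtCh (map (\<lambda>(l, T). (l, lift k T)) bs)"
| "lift k (Seq T U) = Seq (lift k T) (lift k U)"
| "lift k (Rec m T) = Rec m (lift (Suc k) T)"
| "lift k (Var i) = (if i < k then Var i else Var (Suc i))"

fun subst :: "nat \<Rightarrow> stype \<Rightarrow> stype \<Rightarrow> stype" where
  "subst k S Skip = Skip"
| "subst k S (Out b) = Out b"
| "subst k S (In b) = In b"
| "subst k S (IntCh bs) = IntCh (map (\<lambda>(l, T). (l, subst k S T)) bs)"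
| "subst k S (ExtCh bs) = ExtCh (map (\<lambda>(l, T). (l, subst k S T)) bs)"
| "subst k S (Seq T U) = Seq (subst k S T) (subst k S U)"
| "subst k S (Rec m T) = Rec m (subst (Suc k) (lift 0 S) T)"
| "subst k S (Var i) = (if i < k then Var i else if i = k then S else Var (i - 1))"

fun terminated :: "stype \<Rightarrow> bool" where
  "terminated Skip = True"
| "terminated (Seq T U) = (terminated T \<and> terminated U)"
| "terminated (Rec m T) = terminated T"
| "terminated _ = False"

fun contractive :: "stype \<Rightarrow> nat \<Rightarrow> bool" where
  "contractive (Var j) i = (j \<noteq> i)"
| "contractive (Seq U V) i = (contractive U i \<and> (terminated U \<longrightarrow> contractive V i))"
| "contractive (Rec m T) i = contractive T (Suc i)"
| "contractive _ i = True"

inductive kinding :: "mult list \<Rightarrow> stype \<Rightarrow> mult \<Rightarrow> bool" where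
  k_skip: "kinding \<Delta> Skip UnM"
| k_out: "kinding \<Delta> (Out b) LinM"
| k_in: "kinding \<Delta> (In b) LinM"
| k_int: "distinct (map fst bs) \<Longrightarrow> (\<forall>(l, T) \<in> set bs. kinding \<Delta> T LinM)
          \<Longrightarrow> kinding \<Delta> (IntCh bs) LinM"
| k_ext: "distinct (map fst bs) \<Longrightarrow> (\<forall>(l, T) \<in> set bs. kinding \<Delta> T LinM)
          \<Longrightarrow> kinding \<Delta> (ExtCh bs) LinM"
| k_seq: "kinding \<Delta> T LinM \<Longrightarrow> kinding \<Delta> U LinM \<Longrightarrow> kinding \<Delta> (Seq T U) LinM"
| k_rec: "contractive T 0 \<Longrightarrow> kinding (m # \<Delta>) T m \<Longrightarrow> kinding \<Delta> (Rec m T) m"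
| k_var: "i < length \<Delta> \<Longrightarrow> \<Delta> ! i = m \<Longrightarrow> kinding \<Delta> (Var i) m"
| k_sub: "kinding \<Delta> T UnM \<Longrightarrow> kinding \<Delta> T LinM"

datatype act = ASend nat | ARecv nat | AInt nat | AExt nat | AVar nat

inductive trans :: "stype \<Rightarrow> act \<Rightarrow> stype \<Rightarrow> bool" where
  t_out: "trans (Out b) (ASend b) Skip"
| t_in: "trans (In b) (ARecv b) Skip"
| t_int: "(k, T) \<in> set bs \<Longrightarrow> trans (IntCh bs) (AInt k) T"
| t_ext: "(k, T) \<in> set bs \<Longrightarrow> trans (ExtCh bs) (AExt k) T"
| t_var: "trans (Var b) (AVar b) Skip"
| t_rec: "trans (subst 0 (Rec m T) T) a T' \<Longrightarrow> trans (Rec m T) a T'"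
| t_seq1: "trans T a T' \<Longrightarrow> trans (Seq T U) a (Seq T' U)"
| t_seq2: "terminated T \<Longrightarrow> trans U a U' \<Longrightarrow> trans (Seq T U) a U'"

definition bisimulation :: "(stype \<Rightarrow> stype \<Rightarrow> bool) \<Rightarrow> bool" where
  "bisimulation R \<longleftrightarrow> (\<forall>T U. R T U \<longrightarrow>
      (\<forall>a T'. trans T a T' \<longrightarrow> (\<exists>U'. trans U a U' \<and> R T' U')) \<and>
      (\<forall>a U'. trans U a U' \<longrightarrow> (\<exists>T'. trans T a T' \<and> R T' U')))"

definition type_equiv :: "stype \<Rightarrow> stype \<Rightarrow> bool" where
  "type_equiv T U \<longleftrightarrow> (\<exists>R. bisimulation R \<and> R T U)"

datatype recf = Zero | Succ | Proj nat | Comp recf "recf list" | Prec recf recf | Mini recf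

inductive eval :: "recf \<Rightarrow> nat list \<Rightarrow> nat \<Rightarrow> bool" where
  e_zero: "eval Zero xs 0"
| e_succ: "eval Succ (x # xs) (Suc x)"
| e_proj: "i < length xs \<Longrightarrow> eval (Proj i) xs (xs ! i)"
| e_comp: "length ys = length gs \<Longrightarrow> (\<forall>i < length gs. eval (gs ! i) xs (ys ! i))
           \<Longrightarrow> eval f ys z \<Longrightarrow> eval (Comp f gs) xs z"
| e_prec0: "eval f xs y \<Longrightarrow> eval (Prec f g) (0 # xs) y"
| e_precS: "eval (Prec f g) (n # xs) y \<Longrightarrow> eval g (n # y # xs) z
           \<Longrightarrow> eval (Prec f g) (Suc n # xs) z"
| e_mini: "eval f (n # xs) 0 \<Longrightarrow> (\<forall>k < n. \<exists>y. 0 < y \<and> eval f (k # xs) y)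
           \<Longrightarrow> eval (Mini f) xs n"

fun enc :: "stype \<Rightarrow> nat" where
  "enc Skip = prod_encode (0, 0)"
| "enc (Out b) = prod_encode (1, b)"
| "enc (In b) = prod_encode (2, b)"
| "enc (IntCh bs) = prod_encode (3, foldr (\<lambda>(l, T) r. Suc (prod_encode (prod_encode (l, enc T), r))) bs 0)"
| "enc (ExtCh bs) = prod_encode (4, foldr (\<lambda>(l, T) r. Suc (prod_encode (prod_encode (l, enc T), r))) bs 0)"
| "enc (Seq T U) = prod_encode (5, prod_encode (enc T, enc U))"
| "enc (Rec m T) = prod_encode (6, prod_encode ((case m of UnM \<Rightarrow> 0 | LinM \<Rightarrow> 1), enc T))"
| "enc (Var i) = prod_encode (7, i)"

end

theory Submission
  imports Defs
begin


text \<open>A session type is run by a machine on words of closures that is deterministic.  In a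
  deterministic process algebra, if \<open>\<alpha>\<close> and \<open>\<beta>\<close> are not equivalent then \<open>\<alpha>\<gamma> \<approx> \<beta>\<gamma>\<close> determines \<open>\<gamma>\<close> up to
  \<open>\<approx>\<close>, because a distinguishing run of \<open>\<alpha>\<close> and \<open>\<beta>\<close> exhibits \<open>\<gamma>\<close> as the unique solution of a
  guarded equation.  By induction on norms it follows that \<open>\<approx>\<close> on the words over a finite alphabet is
  the congruence generated by finitely many pairs, and a finite set of pairs can be recognised as a
  set of equivalent pairs by comparing one step of each.  Hence equivalence has finite certificates,
  while a distinguishing run certifies inequivalence.  Both kinds of certificate are the derivations
  of one finite Horn program over the numbers, and unbounded search finds a derivation.\<close>

section \<open>Computable functions and Horn programs\<close>

text \<open>The bound \<open>N\<close> behind finite generation depends on words \<gamma> picked by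
  choice, so it is not computed from the two types. The algorithm never needs it: finite generation
  only guarantees that a search for certificates ends on equivalent types. The obstacle is infinite
  behaviour: an unnormed word has no norm to induct on, and a common suffix that runs forever cannot
  be cancelled. That two inequivalent prefixes determine such a suffix takes the place of
  cancellation. Determinism comes from the distinct labels within a choice. Closures stand for
  unfolded types, so that neither substitution nor index shifting has to be programmed, and the
  alphabet is finite by the structure of the type. Horn clauses confine the work with
  \<open>recf\<close> to one generic checker of derivations.\<close>

definition cf :: "nat \<Rightarrow> (nat list \<Rightarrow> nat) \<Rightarrow> bool" where
  "cf k F \<longleftrightarrow> (\<exists>r. \<forall>xs. length xs = k \<longrightarrow> eval r xs (F xs))"

lemma cf_cong: "cf k F \<Longrightarrow> (\<And>xs. length xs = k \<Longrightarrow> F xs = G xs) \<Longrightarrow> cf k G"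
  unfolding cf_def by simp

lemma cf_proj [intro]: "i < k \<Longrightarrow> cf k (\<lambda>xs. xs ! i)"
  unfolding cf_def by (rule exI[of _ "Proj i"]) (auto intro: e_proj)

lemma cf_comp:
  assumes "cf m G" "length Fs = m" "\<And>F. F \<in> set Fs \<Longrightarrow> cf k F"
  shows "cf k (\<lambda>xs. G (map (\<lambda>F. F xs) Fs))"
proof -
  obtain g where g: "\<And>xs. length xs = m \<Longrightarrow> eval g xs (G xs)"
    using assms(1) unfolding cf_def by blast
  have "\<forall>F\<in>set Fs. \<exists>r. \<forall>xs. length xs = k \<longrightarrow> eval r xs (F xs)"
    using assms(3) unfolding cf_def by blast
  then obtain r where r: "\<And>F xs. F \<in> set Fs \<Longrightarrow> length xs = k \<Longrightarrow> eval (r F) xs (F xs)"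
    by metis
  have "eval (Comp g (map r Fs)) xs (G (map (\<lambda>F. F xs) Fs))" if "length xs = k" for xs
    by (rule e_comp[of "map (\<lambda>F. F xs) Fs"]) (use assms(2) g r that in auto)
  then show ?thesis unfolding cf_def by blast
qed

lemma cf_comp1: "cf 1 (\<lambda>xs. g (xs!0)) \<Longrightarrow> cf k F \<Longrightarrow> cf k (\<lambda>xs. g (F xs))"
  using cf_comp[of 1 "\<lambda>xs. g (xs!0)" "[F]" k] by simp

lemma cf_comp2: "cf 2 (\<lambda>xs. g (xs!0) (xs!1)) \<Longrightarrow> cf k F \<Longrightarrow> cf k F' \<Longrightarrow> cf k (\<lambda>xs. g (F xs) (F' xs))"
  using cf_comp[of 2 "\<lambda>xs. g (xs!0) (xs!1)" "[F,F']" k] by auto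

lemma cf_prec:
  assumes "cf k F" "cf (Suc (Suc k)) G"
  shows "cf (Suc k) (\<lambda>xs. rec_nat (F (tl xs)) (\<lambda>n y. G (n # y # tl xs)) (hd xs))"
proof -
  obtain f where f: "\<And>xs. length xs = k \<Longrightarrow> eval f xs (F xs)"
    using assms(1) unfolding cf_def by blast
  obtain g where g: "\<And>xs. length xs = Suc (Suc k) \<Longrightarrow> eval g xs (G xs)"
    using assms(2) unfolding cf_def by blast
  have "eval (Prec f g) (n # xs) (rec_nat (F xs) (\<lambda>n y. G (n # y # xs)) n)"
    if "length xs = k" for n xs
    by (induction n) (use that f g in \<open>auto intro: e_prec0 e_precS\<close>)
  then show ?thesis unfolding cf_def
    by (intro exI[of _ "Prec f g"]) (auto simp: length_Suc_conv)
qed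

lemma cf_Suc: "cf k F \<Longrightarrow> cf k (\<lambda>xs. Suc (F xs))"
proof (rule cf_comp1[where g=Suc])
  show "cf 1 (\<lambda>xs. Suc (xs ! 0))"
    unfolding cf_def by (rule exI[of _ Succ]) (auto simp: length_Suc_conv intro: e_succ)
qed

lemma cf_const: "cf k (\<lambda>xs. c)"
proof (induction c)
  case 0
  then show ?case unfolding cf_def using e_zero by blast
next
  case (Suc c)
  then show ?case by (rule cf_Suc)
qed

text \<open>\<open>Prec\<close> recurses on its first argument. Composing with \<open>N\<close> and
  the projections lets the recursion run up to any computable value while all of \<open>xs\<close>
  remains available as parameters.\<close>

lemma cf_rec:
  assumes N: "cf k N" and F: "cf k F" and G: "cf (Suc (Suc k)) (\<lambda>ys. G (ys!0) (ys!1) (drop 2 ys))"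
  shows "cf k (\<lambda>xs. rec_nat (F xs) (\<lambda>n y. G n y xs) (N xs))"
proof -
  let ?H = "\<lambda>xs. rec_nat (F (tl xs)) (\<lambda>n y. G n y (tl xs)) (hd xs)"
  have H: "cf (Suc k) ?H"
    using cf_prec[OF F G] by simp
  have "cf k (\<lambda>xs. ?H (map (\<lambda>F. F xs) (N # map (\<lambda>i xs. xs ! i) [0..<k])))"
    by (rule cf_comp[OF H]) (use N in auto)
  then show ?thesis
    by (rule cf_cong) (auto simp: comp_def map_nth)
qed

lemma cf_add: "cf k F \<Longrightarrow> cf k G \<Longrightarrow> cf k (\<lambda>xs. F xs + G xs)"
proof (rule cf_comp2[where g="(+)"])
  have *: "a + b = rec_nat b (\<lambda>n. Suc) a" for a b :: nat
    by (induction a) auto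
  show "cf 2 (\<lambda>xs. xs!0 + xs!1)"
    unfolding *
    by (rule cf_rec[where G="\<lambda>n y xs. Suc y"]) (auto intro!: cf_Suc)
qed

lemma cf_tl: "cf k F \<Longrightarrow> cf (Suc k) (\<lambda>ys. F (tl ys))"
proof -
  assume F: "cf k F"
  have "cf (Suc k) (\<lambda>ys. F (map (\<lambda>F. F ys) (map (\<lambda>i ys. ys ! Suc i) [0..<k])))"
    by (rule cf_comp[OF F]) auto
  then show ?thesis
  proof (rule cf_cong)
    fix ys :: "nat list" assume "length ys = Suc k"
    then have "map (\<lambda>F. F ys) (map (\<lambda>i ys. ys ! Suc i) [0..<k]) = tl ys"
      by (intro nth_equalityI) (auto simp: nth_tl)
    then show "F (map (\<lambda>F. F ys) (map (\<lambda>i ys. ys ! Suc i) [0..<k])) = F (tl ys)" by simp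
  qed
qed

lemma cf_drop2: "cf k F \<Longrightarrow> cf (Suc (Suc k)) (\<lambda>ys. F (drop 2 ys))"
  using cf_tl[OF cf_tl[of k F]] by (simp add: drop_Suc numeral_2_eq_2)

text \<open>Skips position 1, where the step function of \<open>cf_rec\<close> receives the previous
  value. The body of a bounded quantifier sees only the counter and the parameters.\<close>

lemma cf_insert2:
  assumes "cf (Suc k) (\<lambda>ys. F (ys!0) (tl ys))"
  shows "cf (Suc (Suc k)) (\<lambda>ys. F (ys!0) (drop 2 ys))"
proof -
  let ?Fs = "(\<lambda>ys. ys ! 0) # map (\<lambda>i ys. ys ! (i + 2)) [0..<k]"
  have "cf (Suc (Suc k)) (\<lambda>ys. (\<lambda>ys. F (ys!0) (tl ys)) (map (\<lambda>F. F ys) ?Fs))"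
    by (rule cf_comp[OF assms]) auto
  then show ?thesis
  proof (rule cf_cong)
    fix ys :: "nat list" assume "length ys = Suc (Suc k)"
    then have "map (\<lambda>F. F ys) (map (\<lambda>i ys. ys ! (i + 2)) [0..<k]) = drop 2 ys"
      by (intro nth_equalityI) auto
    then show "F (map (\<lambda>F. F ys) ?Fs ! 0) (tl (map (\<lambda>F. F ys) ?Fs)) = F (ys ! 0) (drop 2 ys)"
      by simp
  qed
qed

lemma cf_pred: "cf k F \<Longrightarrow> cf k (\<lambda>xs. F xs - 1)"
proof (rule cf_comp1[where g="\<lambda>n. n - 1"])
  have *: "a - 1 = rec_nat 0 (\<lambda>n y. n) a" for a :: nat
    by (induction a) auto
  show "cf 1 (\<lambda>xs. xs!0 - 1)"
    unfolding * by (rule cf_rec[where G="\<lambda>n y xs. n"]) (auto intro: cf_const)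
qed

lemma cf_diff: "cf k F \<Longrightarrow> cf k G \<Longrightarrow> cf k (\<lambda>xs. F xs - G xs)"
proof (rule cf_comp2[where g="(-)"])
  have *: "a - b = rec_nat a (\<lambda>n y. y - 1) b" for a b :: nat
    by (induction b) auto
  have "cf 2 (\<lambda>xs. rec_nat (xs!0) (\<lambda>n y. y - 1) (xs!1))"
    by (rule cf_rec[where G="\<lambda>n y xs. y - 1"]) (intro cf_pred cf_proj; simp)+
  then show "cf 2 (\<lambda>xs. xs!0 - xs!1)"
    by (simp only: *[symmetric])
qed

lemma cf_mult: "cf k F \<Longrightarrow> cf k G \<Longrightarrow> cf k (\<lambda>xs. F xs * G xs)"
proof (rule cf_comp2[where g="(*)"])
  have *: "a * b = rec_nat 0 (\<lambda>n y. y + b) a" for a b :: nat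
    by (induction a) auto
  have "cf 2 (\<lambda>xs. rec_nat 0 (\<lambda>n y. y + xs!1) (xs!0))"
    by (rule cf_rec[where G="\<lambda>n y xs. y + xs!1"])
      (intro cf_const cf_add cf_proj cf_drop2[where F="\<lambda>xs. xs!1"]; simp)+
  then show "cf 2 (\<lambda>xs. xs!0 * xs!1)"
    by (simp only: *[symmetric])
qed

section \<open>Decidable predicates and bounded quantifiers\<close>

definition dec :: "nat \<Rightarrow> (nat list \<Rightarrow> bool) \<Rightarrow> bool" where
  "dec k P \<longleftrightarrow> cf k (\<lambda>xs. if P xs then 1 else 0)"

lemma dec_eq: "cf k F \<Longrightarrow> cf k G \<Longrightarrow> dec k (\<lambda>xs. F xs = G xs)"
  unfolding dec_def
  by (rule cf_cong[of k "\<lambda>xs. 1 - ((F xs - G xs) + (G xs - F xs))"])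
    (auto intro!: cf_diff cf_add cf_const)

lemma dec_not: "dec k P \<Longrightarrow> dec k (\<lambda>xs. \<not> P xs)"
  unfolding dec_def
  by (rule cf_cong[of k "\<lambda>xs. 1 - (if P xs then 1 else 0)"]) (auto intro!: cf_diff cf_const)

lemma dec_conj: "dec k P \<Longrightarrow> dec k Q \<Longrightarrow> dec k (\<lambda>xs. P xs \<and> Q xs)"
  unfolding dec_def
  by (rule cf_cong[of k "\<lambda>xs. (if P xs then 1 else 0) * (if Q xs then 1 else 0)"])
    (auto intro!: cf_mult)

lemma dec_disj: "dec k P \<Longrightarrow> dec k Q \<Longrightarrow> dec k (\<lambda>xs. P xs \<or> Q xs)"
  using dec_not[OF dec_conj[OF dec_not dec_not, of k P Q]] by simp

lemma dec_imp: "dec k P \<Longrightarrow> dec k Q \<Longrightarrow> dec k (\<lambda>xs. P xs \<longrightarrow> Q xs)"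
  unfolding imp_conv_disj by (rule dec_disj[OF dec_not])

lemma cf_if: "dec k P \<Longrightarrow> cf k F \<Longrightarrow> cf k G \<Longrightarrow> cf k (\<lambda>xs. if P xs then F xs else G xs)"
  unfolding dec_def
  by (rule cf_cong[of k "\<lambda>xs. (if P xs then 1 else 0) * F xs + (1 - (if P xs then 1 else 0)) * G xs"])
    (auto intro!: cf_mult cf_add cf_diff cf_const)

lemma dec_const: "dec k (\<lambda>xs. b)"
  unfolding dec_def by (rule cf_const)

lemma dec_Bex_list:
  "(\<And>x. x \<in> set L \<Longrightarrow> dec k (P x)) \<Longrightarrow> dec k (\<lambda>xs. \<exists>x\<in>set L. P x xs)"
  by (induction L) (auto intro: dec_const dec_disj)

lemma dec_Ball_list:
  "(\<And>x. x \<in> set L \<Longrightarrow> dec k (P x)) \<Longrightarrow> dec k (\<lambda>xs. \<forall>x\<in>set L. P x xs)"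
  by (induction L) (auto intro: dec_const dec_conj)

lemma dec_ex_less:
  assumes N: "cf k N" and P: "dec (Suc k) (\<lambda>ys. P (ys!0) (tl ys))"
  shows "dec k (\<lambda>xs. \<exists>i < N xs. P i xs)"
proof -
  have *: "(if \<exists>i < n. P i xs then 1 else 0 :: nat) = rec_nat 0 (\<lambda>n y. if P n xs then 1 else y) n" for n xs
  proof (induction n)
    case (Suc n)
    have "(\<exists>i < Suc n. P i xs) \<longleftrightarrow> P n xs \<or> (\<exists>i < n. P i xs)" by (auto simp: less_Suc_eq)
    with Suc show ?case by (simp del: One_nat_def)
  qed simp
  have P': "dec (Suc (Suc k)) (\<lambda>ys. P (ys!0) (drop 2 ys))"
    using cf_insert2[OF P[unfolded dec_def]] unfolding dec_def .
  show ?thesis unfolding dec_def *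
    by (rule cf_rec[where G="\<lambda>n y xs. if P n xs then 1 else y", OF N cf_const])
      (intro cf_if[OF P'] cf_const cf_proj, simp)
qed

lemma dec_all_less:
  assumes N: "cf k N" and P: "dec (Suc k) (\<lambda>ys. P (ys!0) (tl ys))"
  shows "dec k (\<lambda>xs. \<forall>i < N xs. P i xs)"
  using dec_not[OF dec_ex_less[where P="\<lambda>i xs. \<not> P i xs", OF N dec_not[OF P]]] by simp

section \<open>Inverting Cantor's pairing and reading coded lists\<close>

lemma cf_triangle: "cf k F \<Longrightarrow> cf k (\<lambda>xs. triangle (F xs))"
proof (rule cf_comp1[where g=triangle])
  have *: "triangle a = rec_nat 0 (\<lambda>n y. y + Suc n) a" for a :: nat
    by (induction a) auto
  have "cf 1 (\<lambda>xs. rec_nat 0 (\<lambda>n y. y + Suc n) (xs!0))"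
    by (rule cf_rec[where G="\<lambda>n y xs. y + Suc n"])
      (intro cf_const cf_add cf_Suc cf_proj; simp)+
  then show "cf 1 (\<lambda>xs. triangle (xs!0))"
    by (simp only: *[symmetric])
qed

lemma cf_prod_encode: "cf k F \<Longrightarrow> cf k G \<Longrightarrow> cf k (\<lambda>xs. prod_encode (F xs, G xs))"
  unfolding prod_encode_def by (simp add: cf_add cf_triangle)

text \<open>The index of the diagonal of Cantor's pairing on which a number lies.\<close>
definition diag :: "nat \<Rightarrow> nat" where
  "diag n = rec_nat 0 (\<lambda>n y. if triangle (Suc y) = Suc n then Suc y else y) n"

lemma diag_bounds: "triangle (diag n) \<le> n \<and> n < triangle (Suc (diag n))"
  unfolding diag_def by (induction n) auto

lemma triangle_mono: "m \<le> n \<Longrightarrow> triangle m \<le> triangle n"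
  by (induction rule: dec_induct) auto

lemma diag_prod_encode: "diag (prod_encode (a, b)) = a + b"
proof -
  let ?n = "prod_encode (a, b)"
  have n: "?n = triangle (a + b) + a" by (simp add: prod_encode_def)
  then have "triangle (a + b) \<le> ?n" "?n < triangle (Suc (a + b))" by auto
  with diag_bounds[of ?n] show ?thesis
    using triangle_mono[of "Suc (a + b)" "diag ?n"] triangle_mono[of "Suc (diag ?n)" "a + b"]
    by (meson leD le_trans not_less_eq_eq order_antisym_conv)
qed

text \<open>The code of (a, b) is a plus the triangular number of a + b, so subtractions recover
  both components. This replaces the recursion inside \<open>prod_decode\<close> by operations under
  which \<open>cf\<close> is closed.\<close>

lemma prod_decode_diag:
  "fst (prod_decode n) = n - triangle (diag n)" "snd (prod_decode n) = diag n - fst (prod_decode n)"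
proof -
  obtain a b where n: "n = prod_encode (a, b)" by (metis prod_decode_inverse surj_pair)
  show "fst (prod_decode n) = n - triangle (diag n)" "snd (prod_decode n) = diag n - fst (prod_decode n)"
    unfolding n diag_prod_encode prod_encode_inverse by (auto simp: prod_encode_def)
qed

lemma cf_diag: "cf k F \<Longrightarrow> cf k (\<lambda>xs. diag (F xs))"
proof (rule cf_comp1[where g=diag])
  show "cf 1 (\<lambda>xs. diag (xs!0))"
    unfolding diag_def
    by (rule cf_rec[where G="\<lambda>n y xs. if triangle (Suc y) = Suc n then Suc y else y"])
      (intro cf_const cf_if dec_eq cf_triangle cf_Suc cf_proj; simp)+
qed

lemma cf_fst: "cf k F \<Longrightarrow> cf k (\<lambda>xs. fst (prod_decode (F xs)))"
  unfolding prod_decode_diag by (intro cf_diff cf_triangle cf_diag)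

lemma cf_snd: "cf k F \<Longrightarrow> cf k (\<lambda>xs. snd (prod_decode (F xs)))"
  unfolding prod_decode_diag(2) by (intro cf_diff cf_fst cf_diag)

definition hdc :: "nat \<Rightarrow> nat" where "hdc d = fst (prod_decode (d - 1))"
text \<open>The empty list has code 0, and \<open>0 - 1 = 0\<close> decodes to (0, 0). Hence
  \<open>tlc\<close> stays at 0, and \<open>dropc\<close> past the end still yields the empty
  list.\<close>

definition tlc :: "nat \<Rightarrow> nat" where "tlc d = snd (prod_decode (d - 1))"
definition dropc :: "nat \<Rightarrow> nat \<Rightarrow> nat" where "dropc i d = rec_nat d (\<lambda>_ y. tlc y) i"

lemma hdc_Suc [simp]: "hdc (Suc (prod_encode (x, y))) = x"
  by (simp add: hdc_def)

lemma tlc_list_encode: "tlc (list_encode xs) = list_encode (tl xs)"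
proof (cases xs)
  case Nil
  then show ?thesis
    using prod_encode_inverse[of "(0, 0)"] by (simp add: tlc_def prod_encode_def)
qed (simp add: tlc_def)

lemma dropc_list_encode: "dropc i (list_encode xs) = list_encode (drop i xs)"
  by (induction i arbitrary: xs) (auto simp: dropc_def tlc_list_encode drop_Suc tl_drop)

lemma list_encode_eq_0: "list_encode xs = 0 \<longleftrightarrow> xs = []"
  by (cases xs) auto

lemma length_le_list_encode: "length xs \<le> list_encode xs"
proof (induction xs)
  case (Cons x xs)
  then show ?case using le_prod_encode_2[of "list_encode xs" x] by simp
qed simp

lemma cf_hdc: "cf k F \<Longrightarrow> cf k (\<lambda>xs. hdc (F xs))"
  unfolding hdc_def by (intro cf_fst cf_pred)

lemma cf_tlc: "cf k F \<Longrightarrow> cf k (\<lambda>xs. tlc (F xs))"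
  unfolding tlc_def by (intro cf_snd cf_pred)

lemma cf_dropc: "cf k F \<Longrightarrow> cf k G \<Longrightarrow> cf k (\<lambda>xs. dropc (F xs) (G xs))"
proof (rule cf_comp2[where g=dropc])
  show "cf 2 (\<lambda>xs. dropc (xs!0) (xs!1))"
    unfolding dropc_def
    by (rule cf_rec[where G="\<lambda>n y xs. tlc y"]) (intro cf_tlc cf_proj; simp)+
qed

section \<open>Horn programs over coded terms and their derivations\<close>

datatype pat = PV nat | PC nat | PP pat pat | PS pat

primrec pval :: "(nat \<Rightarrow> nat) \<Rightarrow> pat \<Rightarrow> nat" where
  "pval \<sigma> (PV i) = \<sigma> i"
| "pval \<sigma> (PC c) = c"
| "pval \<sigma> (PP p q) = prod_encode (pval \<sigma> p, pval \<sigma> q)"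
| "pval \<sigma> (PS p) = Suc (pval \<sigma> p)"

primrec pbound :: "pat \<Rightarrow> nat" where
  "pbound (PV i) = Suc i"
| "pbound (PC c) = 0"
| "pbound (PP p q) = max (pbound p) (pbound q)"
| "pbound (PS p) = pbound p"

lemma pval_cong: "(\<And>i. i < pbound p \<Longrightarrow> \<sigma> i = \<tau> i) \<Longrightarrow> pval \<sigma> p = pval \<tau> p"
  by (induction p) auto

text \<open>The assignment \<sigma> is free in the rule, so a variable that occurs only in the
  premises is existentially quantified.\<close>

inductive horn :: "(pat \<times> pat list) list \<Rightarrow> nat \<Rightarrow> bool" for P where
  "(c, ps) \<in> set P \<Longrightarrow> \<forall>p\<in>set ps. horn P (pval \<sigma> p) \<Longrightarrow> horn P (pval \<sigma> c)"

definition lk :: "nat \<Rightarrow> nat \<Rightarrow> nat" where "lk s j = hdc (dropc j s)"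

lemma lk_list_encode: "j < length xs \<Longrightarrow> lk (list_encode xs) j = xs ! j"
  by (simp add: lk_def dropc_list_encode flip: Cons_nth_drop_Suc)

text \<open>A derivation is coded as the list of its facts, conclusion first; each entry pairs a fact with
  the assignment of the clause instance that justifies it.\<close>
definition facts :: "nat list \<Rightarrow> nat set" where
  "facts L = set (map (\<lambda>e. fst (prod_decode e)) L)"

text \<open>The membership test \<open>M\<close> is a parameter so that one definition serves both
  lists of entries and their codes.\<close>

definition justified :: "(pat \<times> pat list) list \<Rightarrow> nat \<Rightarrow> (nat \<Rightarrow> bool) \<Rightarrow> bool" where
  "justified P e M \<longleftrightarrow> (\<exists>cl\<in>set P. fst (prod_decode e) = pval (lk (snd (prod_decode e))) (fst cl) \<and>
     (\<forall>p\<in>set (snd cl). M (pval (lk (snd (prod_decode e))) p)))"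

fun derivation :: "(pat \<times> pat list) list \<Rightarrow> nat list \<Rightarrow> bool" where
  "derivation P [] = True"
| "derivation P (e # L) \<longleftrightarrow> derivation P L \<and> justified P e (\<lambda>n. n \<in> facts L)"

lemma facts_simps [simp]:
  "facts [] = {}" "facts (e # L) = insert (fst (prod_decode e)) (facts L)"
  "facts (L @ L') = facts L \<union> facts L'"
  by (auto simp: facts_def)

lemma justified_mono: "justified P e M \<Longrightarrow> (\<And>n. M n \<Longrightarrow> M' n) \<Longrightarrow> justified P e M'"
  unfolding justified_def by blast

lemma derivation_append: "derivation P L \<Longrightarrow> derivation P L' \<Longrightarrow> derivation P (L @ L')"
  by (induction L) (auto elim: justified_mono)

lemma derivation_horn: "derivation P L \<Longrightarrow> n \<in> facts L \<Longrightarrow> horn P n"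
proof (induction L arbitrary: n)
  case (Cons e L)
  obtain c ps where cl: "(c, ps) \<in> set P" "fst (prod_decode e) = pval (lk (snd (prod_decode e))) c"
    "\<forall>p\<in>set ps. pval (lk (snd (prod_decode e))) p \<in> facts L"
    using Cons.prems(1) by (auto simp: justified_def)
  have "horn P (fst (prod_decode e))"
    unfolding cl(2) by (rule horn.intros[OF cl(1)]) (use cl(3) Cons in auto)
  with Cons show ?case by auto
qed simp

lemma derivation_merge:
  assumes "\<forall>n\<in>set ns. \<exists>L. derivation P L \<and> n \<in> facts L"
  shows "\<exists>L. derivation P L \<and> set ns \<subseteq> facts L"
  using assms
proof (induction ns)
  case Nil
  then show ?case by (intro exI[of _ "[]"]) simp
next
  case (Cons n ns)
  then obtain L L' where "derivation P L" "n \<in> facts L" "derivation P L'" "set ns \<subseteq> facts L'" by auto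
  then show ?case by (intro exI[of _ "L @ L'"]) (auto intro: derivation_append)
qed

lemma horn_derivation: "horn P n \<Longrightarrow> \<exists>L. derivation P L \<and> n \<in> facts L"
proof (induction rule: horn.induct)
  case (1 c ps \<sigma>)
  have "\<exists>L. derivation P L \<and> set (map (pval \<sigma>) ps) \<subseteq> facts L"
    by (rule derivation_merge) (use 1 in auto)
  then obtain L where L: "derivation P L" "\<And>p. p \<in> set ps \<Longrightarrow> pval \<sigma> p \<in> facts L" by auto
  \<comment> \<open>Only the variables below \<open>b\<close> occur in the clause, so the list
    \<open>s\<close> of the first \<open>b\<close> values records all of \<sigma> that
    matters.\<close>
  define b where "b = Max (insert (pbound c) (pbound ` set ps))"
  define s where "s = list_encode (map \<sigma> [0..<b])"
  have "pval (lk s) p = pval \<sigma> p" if "p = c \<or> p \<in> set ps" for p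
  proof (rule pval_cong)
    have "pbound p \<le> b" unfolding b_def by (rule Max_ge) (use that in auto)
    then show "lk s i = \<sigma> i" if "i < pbound p" for i
      using that by (simp add: s_def lk_list_encode)
  qed
  then have "justified P (prod_encode (pval \<sigma> c, s)) (\<lambda>n. n \<in> facts L)"
    unfolding justified_def using 1(1) L(2) by (intro bexI[of _ "(c, ps)"]) auto
  with L(1) show ?case
    by (intro exI[of _ "prod_encode (pval \<sigma> c, s) # L"]) simp
qed

lemma derivation_iff_drop:
  "derivation P L \<longleftrightarrow> (\<forall>i < length L. justified P (L ! i) (\<lambda>n. n \<in> facts (drop (Suc i) L)))"
  by (induction L) (auto simp: All_less_Suc2)

text \<open>A list is no longer than its code (\<open>length_le_list_encode\<close>), so the code
  itself can bound the quantifier over positions. The test for 0 discards positions past the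
  end.\<close>

definition memf :: "nat \<Rightarrow> nat \<Rightarrow> bool" where
  "memf n d \<longleftrightarrow> (\<exists>j<d. dropc j d \<noteq> 0 \<and> fst (prod_decode (hdc (dropc j d))) = n)"

definition derivc :: "(pat \<times> pat list) list \<Rightarrow> nat \<Rightarrow> bool" where
  "derivc P w \<longleftrightarrow> (\<forall>i<w. dropc i w \<noteq> 0 \<longrightarrow>
     justified P (hdc (dropc i w)) (\<lambda>n. memf n (tlc (dropc i w))))"

lemma hdc_drop: "j < length L \<Longrightarrow> hdc (list_encode (drop j L)) = L ! j"
  by (simp flip: Cons_nth_drop_Suc)

lemma memf_list_encode: "memf n (list_encode L) \<longleftrightarrow> n \<in> facts L"
proof -
  have "memf n (list_encode L) \<longleftrightarrow> (\<exists>j < length L. fst (prod_decode (L ! j)) = n)"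
    unfolding memf_def dropc_list_encode list_encode_eq_0
    using length_le_list_encode[of L] by (auto simp: hdc_drop not_le intro: less_le_trans)
  then show ?thesis unfolding facts_def in_set_conv_nth by (simp cong: conj_cong)
qed

lemma derivc_list_encode: "derivc P (list_encode L) \<longleftrightarrow> derivation P L"
proof -
  have "derivc P (list_encode L) \<longleftrightarrow>
    (\<forall>i < length L. justified P (hdc (list_encode (drop i L))) (\<lambda>n. memf n (tlc (list_encode (drop i L)))))"
    unfolding derivc_def dropc_list_encode list_encode_eq_0 using length_le_list_encode[of L]
    by auto
  also have "\<dots> \<longleftrightarrow> derivation P L"
    unfolding derivation_iff_drop tlc_list_encode memf_list_encode
    by (intro all_cong1 imp_cong refl) (simp flip: Cons_nth_drop_Suc)
  finally show ?thesis .
qed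

lemma horn_iff: "horn P n \<longleftrightarrow> (\<exists>w. derivc P w \<and> memf n w)"
proof -
  have "horn P n \<longleftrightarrow> (\<exists>L. derivation P L \<and> n \<in> facts L)"
    using horn_derivation derivation_horn by blast
  also have "\<dots> \<longleftrightarrow> (\<exists>w. derivc P w \<and> memf n w)"
  proof
    assume "\<exists>L. derivation P L \<and> n \<in> facts L"
    then show "\<exists>w. derivc P w \<and> memf n w" using derivc_list_encode memf_list_encode by blast
  next
    assume "\<exists>w. derivc P w \<and> memf n w"
    then obtain w where "derivc P w" "memf n w" by blast
    then have "derivation P (list_decode w) \<and> n \<in> facts (list_decode w)"
      using derivc_list_encode[of P "list_decode w"] memf_list_encode[of n "list_decode w"] by simp
    then show "\<exists>L. derivation P L \<and> n \<in> facts L" by blast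
  qed
  finally show ?thesis .
qed

lemma cf_lk: "cf k F \<Longrightarrow> cf k (\<lambda>xs. lk (F xs) j)"
  unfolding lk_def by (intro cf_hdc cf_dropc cf_const)

lemma cf_pval: "cf k F \<Longrightarrow> cf k (\<lambda>xs. pval (lk (F xs)) p)"
  by (induction p) (auto intro: cf_lk cf_const cf_prod_encode cf_Suc)

lemma dec_memf:
  assumes F: "cf k F" and G: "cf k G"
  shows "dec k (\<lambda>xs. memf (F xs) (G xs))"
proof -
  have *: "cf (Suc k) (\<lambda>ys. dropc (ys ! 0) (G (tl ys)))"
    by (rule cf_dropc[OF cf_proj cf_tl[OF G]]) simp
  show ?thesis unfolding memf_def
    by (rule dec_ex_less[OF G, where P="\<lambda>j xs. dropc j (G xs) \<noteq> 0 \<and>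
          fst (prod_decode (hdc (dropc j (G xs)))) = F xs"])
      (rule dec_conj[OF dec_not[OF dec_eq[OF * cf_const]]
          dec_eq[OF cf_fst[OF cf_hdc[OF *]] cf_tl[OF F]]])
qed

lemma dec_justified:
  assumes F: "cf k F" and G: "cf k G"
  shows "dec k (\<lambda>xs. justified P (F xs) (\<lambda>n. memf n (G xs)))"
proof -
  have v: "cf k (\<lambda>xs. pval (lk (snd (prod_decode (F xs)))) p)" for p
    by (rule cf_pval[OF cf_snd[OF F]])
  show ?thesis unfolding justified_def
    by (rule dec_Bex_list, rule dec_conj, rule dec_eq[OF cf_fst[OF F] v])
      (rule dec_Ball_list, rule dec_memf[OF v G])
qed

lemma dec_derivc:
  assumes F: "cf k F"
  shows "dec k (\<lambda>xs. derivc P (F xs))"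
proof -
  have *: "cf (Suc k) (\<lambda>ys. dropc (ys ! 0) (F (tl ys)))"
    by (rule cf_dropc[OF cf_proj cf_tl[OF F]]) simp
  show ?thesis unfolding derivc_def
    by (rule dec_all_less[OF F, where P="\<lambda>i xs. dropc i (F xs) \<noteq> 0 \<longrightarrow>
          justified P (hdc (dropc i (F xs))) (\<lambda>n. memf n (tlc (dropc i (F xs))))"])
      (rule dec_imp[OF dec_not[OF dec_eq[OF * cf_const]]
          dec_justified[OF cf_hdc[OF *] cf_tlc[OF *]]])
qed


text \<open>Minimisation finds the least code of a candidate answer paired with a derivation of it.
  This need not be the derivation known to exist, but uniqueness of the derivable answer forces the
  same answer.\<close>

theorem horn_decision:
  "\<exists>f. \<forall>x y b. horn P (prod_encode (a, prod_encode (x, prod_encode (y, b)))) \<longrightarrow>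
    (\<forall>b'. horn P (prod_encode (a, prod_encode (x, prod_encode (y, b')))) \<longrightarrow> b' = b) \<longrightarrow>
    eval f [x, y] b"
proof -
  define G where "G w x y \<longleftrightarrow> derivc P (snd (prod_decode w)) \<and>
    memf (prod_encode (a, prod_encode (x, prod_encode (y, fst (prod_decode w))))) (snd (prod_decode w))"
    for w x y
  have "dec 3 (\<lambda>xs. G (xs!0) (xs!1) (xs!2))"
    unfolding G_def
    by (intro dec_conj[OF dec_derivc dec_memf] cf_prod_encode cf_fst cf_snd cf_const cf_proj) simp_all
  \<comment> \<open>\<open>Mini\<close> searches for a zero, so the truth value is inverted.\<close>
  then have "cf 3 (\<lambda>xs. 1 - (if G (xs!0) (xs!1) (xs!2) then 1 else 0))"
    unfolding dec_def by (rule cf_diff[OF cf_const])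
  then obtain g where g: "\<And>xs. length xs = 3 \<Longrightarrow>
      eval g xs (1 - (if G (xs!0) (xs!1) (xs!2) then 1 else 0))"
    unfolding cf_def by blast
  have "cf 1 (\<lambda>xs. fst (prod_decode (xs!0)))"
    by (intro cf_fst cf_proj) simp
  then obtain p where p: "\<And>xs. length xs = 1 \<Longrightarrow> eval p xs (fst (prod_decode (xs!0)))"
    unfolding cf_def by blast
  have "eval (Comp p [Mini g]) [x, y] b"
    if h: "horn P (prod_encode (a, prod_encode (x, prod_encode (y, b))))"
      and u: "\<And>b'. horn P (prod_encode (a, prod_encode (x, prod_encode (y, b')))) \<Longrightarrow> b' = b"
    for x y b
  proof -
    obtain w where "derivc P w" "memf (prod_encode (a, prod_encode (x, prod_encode (y, b)))) w"
      using h horn_iff by blast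
    then have "G (prod_encode (b, w)) x y" by (simp add: G_def)
    then have "G (LEAST w. G w x y) x y" by (rule LeastI)
    moreover define w' where "w' = (LEAST w. G w x y)"
    ultimately have L: "G w' x y" by simp
    have "eval (Mini g) [x, y] w'"
    proof (rule e_mini)
      show "eval g (w' # [x, y]) 0"
        using g[of "[w', x, y]"] L by (simp add: numeral_2_eq_2)
      have "eval g (k # [x, y]) 1" if "k < w'" for k
        using g[of "[k, x, y]"] not_less_Least[OF that[unfolded w'_def]] by (simp add: numeral_2_eq_2)
      then show "\<forall>k<w'. \<exists>z>0. eval g (k # [x, y]) z" by (meson zero_less_one)
    qed
    moreover have "fst (prod_decode w') = b"
    proof (rule u)
      show "horn P (prod_encode (a, prod_encode (x, prod_encode (y, fst (prod_decode w')))))"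
        unfolding horn_iff using L[unfolded G_def] by (rule exI)
    qed
    ultimately show ?thesis
      using p[of "[w']"] by (intro e_comp[of "[w']"]) auto
  qed
  then show ?thesis by blast
qed


section \<open>Deterministic process algebras\<close>

text \<open>Right contexts are built into \<open>cong_base\<close>, left contexts come from
  \<open>cong_Cons\<close>. A step of two congruent words is then analysed either at a generating
  pair or behind a common first letter.\<close>

inductive cong :: "('x list \<times> 'x list) set \<Rightarrow> 'x list \<Rightarrow> 'x list \<Rightarrow> bool" for B where
  cong_Nil: "cong B [] []"
| cong_sym: "cong B w v \<Longrightarrow> cong B v w"
| cong_trans: "cong B u w \<Longrightarrow> cong B w v \<Longrightarrow> cong B u v"
| cong_Cons: "cong B w v \<Longrightarrow> cong B (X # w) (X # v)"
| cong_base: "(u, v) \<in> B \<Longrightarrow> cong B (u @ w) (v @ w)"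

lemma cong_refl: "cong B w w"
  by (induction w) (auto intro: cong.intros)

lemma cong_append: "cong B w v \<Longrightarrow> cong B (u @ w) (u @ v)"
  by (induction u) (auto intro: cong.intros)

text \<open>A deterministic process algebra: a word over letters runs its first letter that is not
  null, and \<open>dl X a\<close> is the word that the letter \<open>X\<close> becomes after the action \<open>a\<close>.\<close>
locale bpa =
  fixes null :: "'x \<Rightarrow> bool" and dl :: "'x \<Rightarrow> 'a \<Rightarrow> 'x list option"
begin

fun st :: "'x list \<Rightarrow> 'a \<Rightarrow> 'x list option" where
  "st [] a = None"
| "st (X # w) a = (if null X then st w a else map_option (\<lambda>v. v @ w) (dl X a))"

fun run :: "'x list \<Rightarrow> 'a list \<Rightarrow> 'x list option" where
  "run w [] = Some w"
| "run w (a # xs) = Option.bind (st w a) (\<lambda>w'. run w' xs)"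

definition nullw :: "'x list \<Rightarrow> bool" where "nullw w \<longleftrightarrow> list_all null w"

text \<open>Besides the possibility of a run it records whether the remaining word is null, which
  tells termination from deadlock.\<close>

definition obs :: "'x list \<Rightarrow> 'a list \<Rightarrow> bool option" where
  "obs w xs = map_option nullw (run w xs)"

text \<open>Since \<open>st\<close> is a function, agreement on all runs coincides with
  bisimilarity; \<open>eqv_coinduct\<close> and \<open>eqv_st\<close> are the two halves of
  this.\<close>

definition eqv :: "'x list \<Rightarrow> 'x list \<Rightarrow> bool" (infix "\<approx>" 50) where
  "w \<approx> v \<longleftrightarrow> (\<forall>xs. obs w xs = obs v xs)"

definition normed :: "'x list \<Rightarrow> bool" where "normed w \<longleftrightarrow> (\<exists>xs. obs w xs = Some True)"

definition norm :: "'x list \<Rightarrow> nat" where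
  "norm w = (LEAST n. \<exists>xs. length xs = n \<and> obs w xs = Some True)"

lemma nullw_simps [simp]: "nullw []" "nullw (X # w) \<longleftrightarrow> null X \<and> nullw w"
  "nullw (u @ w) \<longleftrightarrow> nullw u \<and> nullw w"
  by (auto simp: nullw_def)

lemma st_nullw: "nullw u \<Longrightarrow> st u a = None"
  by (induction u) auto

lemma st_append: "st (u @ w) a = (if nullw u then st w a else map_option (\<lambda>v. v @ w) (st u a))"
  by (induction u) (auto simp: option.map_comp comp_def)

lemma eqv_refl [simp]: "w \<approx> w" by (simp add: eqv_def)
lemma eqv_sym: "w \<approx> v \<Longrightarrow> v \<approx> w" by (simp add: eqv_def)
lemma eqv_trans [trans]: "u \<approx> w \<Longrightarrow> w \<approx> v \<Longrightarrow> u \<approx> v" by (simp add: eqv_def)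

lemma eqv_nullw: "w \<approx> v \<Longrightarrow> nullw w = nullw v"
  unfolding eqv_def obs_def by (drule spec[of _ "[]"]) simp

lemma eqv_st: assumes "w \<approx> v" shows "rel_option (\<approx>) (st w a) (st v a)"
proof -
  have o: "obs w (a # xs) = obs v (a # xs)" for xs using assms by (simp add: eqv_def)
  show ?thesis
  proof (cases "st w a")
    case None
    then show ?thesis using o[of "[]"] by (cases "st v a") (auto simp: obs_def)
  next
    case (Some w')
    then obtain v' where v': "st v a = Some v'"
      using o[of "[]"] by (cases "st v a") (auto simp: obs_def)
    have "w' \<approx> v'" unfolding eqv_def using o Some v' by (simp add: obs_def)
    with Some v' show ?thesis by simp
  qed
qed

lemma eqv_coinduct:
  assumes "R w v" and R: "\<And>w v. R w v \<Longrightarrow> nullw w = nullw v \<and> (\<forall>a. rel_option R (st w a) (st v a))"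
  shows "w \<approx> v"
proof -
  have "obs w xs = obs v xs" if "R w v" for xs w v
    using that
  proof (induction xs arbitrary: w v)
    case Nil
    then show ?case using R by (simp add: obs_def)
  next
    case (Cons a xs)
    from R[OF Cons.prems] have "rel_option R (st w a) (st v a)" by blast
    then show ?case
      by (cases "st w a"; cases "st v a") (use Cons.IH in \<open>auto simp: obs_def\<close>)
  qed
  with assms(1) show ?thesis by (simp add: eqv_def)
qed

lemma eqv_run: "w \<approx> v \<Longrightarrow> rel_option (\<approx>) (run w xs) (run v xs)"
proof (induction xs arbitrary: w v)
  case (Cons a xs)
  from eqv_st[OF Cons.prems, of a] show ?case
    by (cases "st w a"; cases "st v a") (use Cons.IH in auto)
qed simp

lemma eqv_append_left: assumes "w \<approx> v" shows "u @ w \<approx> u @ v"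
proof (rule eqv_coinduct[where R="\<lambda>x y. \<exists>u w v. x = u @ w \<and> y = u @ v \<and> w \<approx> v"])
  show "\<exists>u' w' v'. u @ w = u' @ w' \<and> u @ v = u' @ v' \<and> w' \<approx> v'" using assms by blast
next
  fix x y assume "\<exists>u w v. x = u @ w \<and> y = u @ v \<and> w \<approx> v"
  then obtain u w v where *: "x = u @ w" "y = u @ v" "w \<approx> v" by blast
  have "rel_option (\<lambda>x y. \<exists>u w v. x = u @ w \<and> y = u @ v \<and> w \<approx> v) (st x a) (st y a)" for a
  proof (cases "nullw u")
    case True
    have "rel_option (\<lambda>x y. \<exists>u w v. x = u @ w \<and> y = u @ v \<and> w \<approx> v) (st w a) (st v a)"
      by (rule option.rel_mono_strong[OF eqv_st[OF *(3)]]) (metis append_Nil)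
    with True * show ?thesis by (simp add: st_append)
  next
    case False
    then show ?thesis using *
      by (cases "st u a") (auto simp: st_append)
  qed
  then show "nullw x = nullw y \<and>
    (\<forall>a. rel_option (\<lambda>x y. \<exists>u w v. x = u @ w \<and> y = u @ v \<and> w \<approx> v) (st x a) (st y a))"
    using * eqv_nullw by auto
qed

lemma eqv_append_right: assumes "w \<approx> v" shows "w @ u \<approx> v @ u"
proof (rule eqv_coinduct[where R="\<lambda>x y. \<exists>w v. x = w @ u \<and> y = v @ u \<and> w \<approx> v \<or> x = y"])
  show "\<exists>w' v'. w @ u = w' @ u \<and> v @ u = v' @ u \<and> w' \<approx> v' \<or> w @ u = v @ u" using assms by blast
next
  fix x y assume "\<exists>w v. x = w @ u \<and> y = v @ u \<and> w \<approx> v \<or> x = y"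
  then consider w v where "x = w @ u" "y = v @ u" "w \<approx> v" | "x = y" by blast
  then show "nullw x = nullw y \<and>
    (\<forall>a. rel_option (\<lambda>x y. \<exists>w v. x = w @ u \<and> y = v @ u \<and> w \<approx> v \<or> x = y) (st x a) (st y a))"
  proof cases
    case 1
    have "rel_option (\<lambda>x y. \<exists>w v. x = w @ u \<and> y = v @ u \<and> w \<approx> v \<or> x = y) (st x a) (st y a)" for a
    proof (cases "nullw w")
      case True
      with 1 eqv_nullw show ?thesis by (auto simp: st_append option.rel_refl)
    next
      case False
      then show ?thesis using 1 eqv_nullw[OF 1(3)] eqv_st[OF 1(3), of a]
        by (cases "st w a"; cases "st v a") (auto simp: st_append)
    qed
    then show ?thesis using 1 eqv_nullw by auto
  qed (auto intro: option.rel_refl)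
qed

lemma nullw_eqv_Nil: "nullw u \<Longrightarrow> u \<approx> []"
  by (rule eqv_coinduct[where R="\<lambda>x y. nullw x \<and> nullw y"]) (auto simp: st_nullw)

lemma nullw_eqv: "nullw u \<Longrightarrow> u @ w \<approx> w"
  using eqv_append_right[OF nullw_eqv_Nil, of u w] by simp

section \<open>Runs and norms of concatenations\<close>

lemma run_append: "run u xs = Some u' \<Longrightarrow> run (u @ w) xs = Some (u' @ w)"
proof (induction xs arbitrary: u)
  case (Cons a xs)
  then obtain u1 where u1: "st u a = Some u1" "run u1 xs = Some u'"
    by (auto simp: bind_eq_Some_conv)
  then have "\<not> nullw u" using st_nullw by fastforce
  with u1 Cons.IH show ?case by (simp add: st_append)
qed simp

lemma run_append_split:
  "run (u @ w) xs = Some z \<Longrightarrow> (\<exists>u'. run u xs = Some u' \<and> z = u' @ w) \<or>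
    (\<exists>ys zs u'. xs = ys @ zs \<and> run u ys = Some u' \<and> nullw u' \<and> run w zs = Some z)"
proof (induction xs arbitrary: u)
  case (Cons a xs)
  show ?case
  proof (cases "nullw u")
    case True
    then have "run w (a # xs) = Some z" using Cons.prems by (simp add: st_append)
    with True show ?thesis
      by (intro disjI2 exI[of _ "[]"] exI[of _ "a # xs"] exI[of _ u]) simp
  next
    case False
    with Cons.prems obtain u1 where u1: "st u a = Some u1" "run (u1 @ w) xs = Some z"
      by (auto simp: st_append bind_eq_Some_conv)
    from Cons.IH[OF u1(2)] show ?thesis
    proof
      assume "\<exists>u'. run u1 xs = Some u' \<and> z = u' @ w"
      then show ?thesis using u1(1) by auto
    next
      assume "\<exists>ys zs u'. xs = ys @ zs \<and> run u1 ys = Some u' \<and> nullw u' \<and> run w zs = Some z"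
      then obtain ys zs u' where "xs = ys @ zs" "run u1 ys = Some u'" "nullw u'" "run w zs = Some z"
        by blast
      then show ?thesis using u1(1)
        by (intro disjI2 exI[of _ "a # ys"] exI[of _ zs] exI[of _ u']) simp
    qed
  qed
qed simp

lemma run_concat: "run w (xs @ ys) = Option.bind (run w xs) (\<lambda>v. run v ys)"
  by (induction xs arbitrary: w) (auto simp: bind_assoc)

lemma obs_True: "obs w xs = Some True \<longleftrightarrow> (\<exists>w'. run w xs = Some w' \<and> nullw w')"
  by (auto simp: obs_def)

lemma normed_run: "normed w \<longleftrightarrow> (\<exists>xs w'. run w xs = Some w' \<and> nullw w')"
  unfolding normed_def obs_True ..

lemma norm_run: "normed w \<Longrightarrow> \<exists>xs w'. length xs = norm w \<and> run w xs = Some w' \<and> nullw w'"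
proof -
  assume "normed w"
  then have "\<exists>n xs. length xs = n \<and> obs w xs = Some True" by (auto simp: normed_def)
  then have "\<exists>xs. length xs = norm w \<and> obs w xs = Some True"
    unfolding norm_def by (rule LeastI_ex)
  then show ?thesis by (auto simp: obs_True)
qed

lemma norm_le: "run w xs = Some w' \<Longrightarrow> nullw w' \<Longrightarrow> norm w \<le> length xs"
  unfolding norm_def by (rule Least_le) (auto simp: obs_True)

lemma eqv_normed: "w \<approx> v \<Longrightarrow> normed w = normed v"
  by (simp add: normed_def eqv_def)

lemma eqv_norm: "w \<approx> v \<Longrightarrow> norm w = norm v"
  by (simp add: norm_def eqv_def)

lemma nullw_normed: "nullw w \<Longrightarrow> normed w"
  unfolding normed_run by (rule exI[of _ "[]"]) simp

lemma norm_pos: "normed w \<Longrightarrow> \<not> nullw w \<Longrightarrow> 0 < norm w"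
  using norm_run[of w] by (cases "norm w") auto

lemma normed_append: "normed (u @ w) \<longleftrightarrow> normed u \<and> normed w"
proof
  assume "normed (u @ w)"
  then obtain xs z where "run (u @ w) xs = Some z" "nullw z" by (auto simp: normed_run)
  then show "normed u \<and> normed w"
    using run_append_split[of u w xs z] nullw_normed by (auto simp: normed_run[of u] normed_run[of w])
      (metis normed_run nullw_normed)+
next
  assume "normed u \<and> normed w"
  then obtain xs u' ys w' where *: "run u xs = Some u'" "nullw u'" "run w ys = Some w'" "nullw w'"
    by (auto simp: normed_run)
  have "obs (u' @ w) ys = obs w ys" using nullw_eqv[OF *(2)] by (simp add: eqv_def)
  then have "obs (u @ w) (xs @ ys) = Some True"
    using * run_append[OF *(1), of w] by (simp add: obs_def run_concat)
  then show "normed (u @ w)" by (auto simp: normed_def)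
qed

lemma norm_append: assumes "normed u" "normed w" shows "norm (u @ w) = norm u + norm w"
proof (rule antisym)
  obtain xs u' where "length xs = norm u" "run u xs = Some u'" "nullw u'"
    using norm_run[OF assms(1)] by blast
  moreover obtain ys w' where "length ys = norm w" "run w ys = Some w'" "nullw w'"
    using norm_run[OF assms(2)] by blast
  ultimately have *: "run u xs = Some u'" "nullw u'" "length xs = norm u"
    "run w ys = Some w'" "nullw w'" "length ys = norm w" by blast+
  have "obs (u' @ w) ys = obs w ys" using nullw_eqv[OF *(2)] by (simp add: eqv_def)
  then have "obs (u @ w) (xs @ ys) = Some True"
    using * run_append[OF *(1), of w] by (simp add: obs_def run_concat)
  then show "norm (u @ w) \<le> norm u + norm w"
    using *(3,6) norm_le[of "u @ w" "xs @ ys"] by (auto simp: obs_True)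
next
  have "normed (u @ w)" using assms by (simp add: normed_append)
  then obtain xs z where xs: "run (u @ w) xs = Some z" "nullw z" "length xs = norm (u @ w)"
    using norm_run by blast
  from run_append_split[OF xs(1)] show "norm u + norm w \<le> norm (u @ w)"
  proof (elim disjE exE conjE)
    fix u' assume u': "run u xs = Some u'" "z = u' @ w"
    then have "norm u \<le> length xs" "norm w \<le> 0"
      using norm_le[of u xs u'] norm_le[of w "[]" w] xs(2) by auto
    then show ?thesis using xs(3) by simp
  next
    fix ys zs u' assume "xs = ys @ zs" "run u ys = Some u'" "nullw u'" "run w zs = Some z"
    then show ?thesis using norm_le[of u ys u'] norm_le[of w zs z] xs by auto
  qed
qed

lemma normed_st: "st u a = Some u' \<Longrightarrow> normed u' \<Longrightarrow> normed u"
  unfolding normed_run by (metis bind.bind_lunit run.simps(2))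

text \<open>Every word that an unnormed word runs to is again unnormed and hence not null, so what
  stands behind it never gets its turn.\<close>

lemma unnormed_absorb: assumes "\<not> normed u" shows "u @ w \<approx> u @ v"
proof (rule eqv_coinduct[where R="\<lambda>x y. \<exists>u. \<not> normed u \<and> x = u @ w \<and> y = u @ v"])
  show "\<exists>u'. \<not> normed u' \<and> u @ w = u' @ w \<and> u @ v = u' @ v" using assms by blast
next
  fix x y assume "\<exists>u. \<not> normed u \<and> x = u @ w \<and> y = u @ v"
  then obtain u where u: "\<not> normed u" "x = u @ w" "y = u @ v" by blast
  then have "\<not> nullw u" using nullw_normed by blast
  moreover have "rel_option (\<lambda>x y. \<exists>u. \<not> normed u \<and> x = u @ w \<and> y = u @ v) (st x a) (st y a)" for a
    using u calculation normed_st by (cases "st u a") (auto simp: st_append)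
  ultimately show "nullw x = nullw y \<and>
      (\<forall>a. rel_option (\<lambda>x y. \<exists>u. \<not> normed u \<and> x = u @ w \<and> y = u @ v) (st x a) (st y a))"
    using u by simp
qed

text \<open>Both words are \<open>\<beta>\<close> repeated forever.\<close>
lemma guarded_equation_unique:
  assumes b: "\<not> nullw \<beta>" and g: "\<gamma> \<approx> \<beta> @ \<gamma>" and g': "\<gamma>' \<approx> \<beta> @ \<gamma>'"
  shows "\<gamma> \<approx> \<gamma>'"
proof (rule eqv_coinduct[where R="\<lambda>x y. \<exists>\<eta>. x \<approx> \<eta> @ \<gamma> \<and> y \<approx> \<eta> @ \<gamma>'"])
  show "\<exists>\<eta>. \<gamma> \<approx> \<eta> @ \<gamma> \<and> \<gamma>' \<approx> \<eta> @ \<gamma>'" using g g' by blast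
next
  fix x y assume "\<exists>\<eta>. x \<approx> \<eta> @ \<gamma> \<and> y \<approx> \<eta> @ \<gamma>'"
  then obtain \<eta> where \<eta>: "x \<approx> \<eta> @ \<gamma>" "y \<approx> \<eta> @ \<gamma>'" by blast
  \<comment> \<open>When the common prefix is used up, both equations unfold one more copy of
    \<beta>. As \<beta> is not null, the next step takes place inside the prefix.\<close>
  have "\<exists>\<eta>. \<not> nullw \<eta> \<and> x \<approx> \<eta> @ \<gamma> \<and> y \<approx> \<eta> @ \<gamma>'"
  proof (cases "nullw \<eta>")
    case True
    have "x \<approx> \<beta> @ \<gamma>" "y \<approx> \<beta> @ \<gamma>'"
      using \<eta> nullw_eqv[OF True] g g' eqv_trans by blast+
    with b show ?thesis by blast
  qed (use \<eta> in blast)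
  then obtain \<eta> where \<eta>: "\<not> nullw \<eta>" "x \<approx> \<eta> @ \<gamma>" "y \<approx> \<eta> @ \<gamma>'" by blast
  have "rel_option (\<lambda>x y. \<exists>\<eta>. x \<approx> \<eta> @ \<gamma> \<and> y \<approx> \<eta> @ \<gamma>') (st x a) (st y a)" for a
    using eqv_st[OF \<eta>(2), of a] eqv_st[OF \<eta>(3), of a] \<eta>(1)
    by (cases "st \<eta> a"; cases "st x a"; cases "st y a") (auto simp: st_append)
  then show "nullw x = nullw y \<and>
      (\<forall>a. rel_option (\<lambda>x y. \<exists>\<eta>. x \<approx> \<eta> @ \<gamma> \<and> y \<approx> \<eta> @ \<gamma>') (st x a) (st y a))"
    using eqv_nullw[OF \<eta>(2)] eqv_nullw[OF \<eta>(3)] \<eta>(1) by simp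
qed

text \<open>Along a simultaneous run of \<alpha> and \<beta> both suffix equations persist. If
  nullness never differed on \<open>R\<close>, then \<open>R\<close> would be a bisimulation
  relating \<alpha> and \<beta>. So some related \<open>a\<close> is null while its partner
  \<open>b\<close> is not (or conversely), and there the equations become guarded:
  \<open>\<gamma> \<approx> b @ \<gamma>\<close> and
  \<open>\<gamma>' \<approx> b @ \<gamma>'\<close>.\<close>

lemma common_suffix_unique:
  assumes ne: "\<not> \<alpha> \<approx> \<beta>" and g: "\<alpha> @ \<gamma> \<approx> \<beta> @ \<gamma>" and g': "\<alpha> @ \<gamma>' \<approx> \<beta> @ \<gamma>'"
  shows "\<gamma> \<approx> \<gamma>'"
proof -
  define R where "R = (\<lambda>a b. a @ \<gamma> \<approx> b @ \<gamma> \<and> a @ \<gamma>' \<approx> b @ \<gamma>')"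
  have "\<exists>a b. R a b \<and> nullw a \<noteq> nullw b"
  proof (rule ccontr)
    assume "\<not> (\<exists>a b. R a b \<and> nullw a \<noteq> nullw b)"
    then have n: "R a b \<Longrightarrow> nullw a = nullw b" for a b by blast
    have "\<alpha> \<approx> \<beta>"
    proof (rule eqv_coinduct[where R=R])
      show "R \<alpha> \<beta>" using g g' by (simp add: R_def)
    next
      fix a b assume ab: "R a b"
      have "rel_option R (st a x) (st b x)" for x
      proof (cases "nullw a")
        case True
        then show ?thesis using n[OF ab] by (simp add: st_nullw)
      next
        case False
        then have "\<not> nullw b" using n[OF ab] by simp
        with False show ?thesis
          using ab eqv_st[of "a @ \<gamma>" "b @ \<gamma>" x] eqv_st[of "a @ \<gamma>'" "b @ \<gamma>'" x]
          by (cases "st a x"; cases "st b x") (auto simp: R_def st_append)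
      qed
      with n[OF ab] show "nullw a = nullw b \<and> (\<forall>x. rel_option R (st a x) (st b x))" by blast
    qed
    with ne show False by blast
  qed
  then obtain a b where ab: "R a b" "nullw a \<noteq> nullw b" by blast
  have "\<gamma> \<approx> \<gamma>'" if "nullw a" "\<not> nullw b" "R a b" for a b
  proof (rule guarded_equation_unique[OF that(2)])
    show "\<gamma> \<approx> b @ \<gamma>" "\<gamma>' \<approx> b @ \<gamma>'"
      using that(3) nullw_eqv[OF that(1)] eqv_trans eqv_sym unfolding R_def by blast+
  qed
  moreover have "R b a" using ab(1) eqv_sym by (simp add: R_def)
  ultimately show ?thesis using ab by blast
qed

section \<open>Reduced words and the size that drives the induction\<close>

fun red :: "'x list \<Rightarrow> 'x list" where
  "red [] = []"
| "red (X # w) = (if null X then red w else if normed [X] then X # red w else [X])"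

text \<open>Extends the norm to unnormed words, where \<open>norm\<close> has no meaning: it agrees
  with \<open>norm\<close> on normed words and counts only the part before the first unnormed letter
  on the others.\<close>

fun sz :: "'x list \<Rightarrow> nat" where
  "sz [] = 0"
| "sz (X # w) = (if null X then sz w else if normed [X] then norm [X] + sz w else 0)"

text \<open>Each letter that is kept has norm at least 1, except possibly a final unnormed one,
  which accounts for the 1.\<close>

lemma length_red: "length (red w) \<le> sz w + 1"
proof (induction w)
  case (Cons X w)
  then show ?case using norm_pos[of "[X]"] by auto
qed simp

lemma set_red: "set (red w) \<subseteq> set w"
  by (induction w) auto

lemma sz_red: "sz (red w) = sz w"
  by (induction w) auto

lemma red_head: "red w = X # w' \<Longrightarrow> \<not> null X"
  by (induction w) (auto split: if_splits)

lemma red_Nil: "red w = [] \<longleftrightarrow> nullw w"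
  by (induction w) auto

lemma normed_Cons: "normed (X # w) \<longleftrightarrow> normed [X] \<and> normed w"
  using normed_append[of "[X]" w] by simp

lemma norm_null: "nullw w \<Longrightarrow> norm w = 0"
  using norm_le[of w "[]" w] by simp

lemma sz_normed: "normed w \<Longrightarrow> sz (w @ v) = norm w + sz v"
proof (induction w)
  case Nil
  then show ?case by (simp add: norm_null)
next
  case (Cons X w)
  then have n: "normed [X]" "normed w" using normed_Cons by blast+
  show ?case using norm_append[OF n] Cons.IH[OF n(2)] n(1) by (auto simp: norm_null)
qed

lemma sz_unnormed: "\<not> normed w \<Longrightarrow> sz (w @ v) = sz w"
proof (induction w)
  case Nil
  then show ?case using nullw_normed[of "[]"] by simp
next
  case (Cons X w)
  show ?case
  proof (cases "null X \<or> normed [X]")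
    case True
    then have "normed [X]" using nullw_normed[of "[X]"] by auto
    then have "\<not> normed w" using Cons.prems normed_Cons by blast
    with Cons.IH show ?thesis by simp
  qed simp
qed

lemma red_eqv: "red w \<approx> w"
proof (induction w)
  case (Cons X w)
  show ?case
  proof (cases "null X")
    case True
    then have "[X] @ w \<approx> w" by (intro nullw_eqv) simp
    from eqv_trans[OF Cons eqv_sym[OF this]] True show ?thesis by simp
  next
    case False
    show ?thesis
    proof (cases "normed [X]")
      case True
      with False Cons eqv_append_left[of "red w" w "[X]"] show ?thesis by simp
    next
      case unn: False
      with False unnormed_absorb[of "[X]" "[]" w] show ?thesis by simp
    qed
  qed
qed simp

section \<open>Finite generation of the equivalence\<close>

definition closed :: "'x set \<Rightarrow> bool" where
  "closed \<Gamma> \<longleftrightarrow> (\<forall>X\<in>\<Gamma>. \<forall>a v. dl X a = Some v \<longrightarrow> set v \<subseteq> \<Gamma>)"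

lemma closed_st: "closed \<Gamma> \<Longrightarrow> set w \<subseteq> \<Gamma> \<Longrightarrow> st w a = Some v \<Longrightarrow> set v \<subseteq> \<Gamma>"
proof (induction w arbitrary: v)
  case (Cons X w)
  show ?case
  proof (cases "null X")
    case False
    with Cons.prems obtain u where "dl X a = Some u" "v = u @ w" by auto
    with Cons.prems show ?thesis unfolding closed_def by auto
  qed (use Cons in simp)
qed simp

lemma closed_run: "closed \<Gamma> \<Longrightarrow> set w \<subseteq> \<Gamma> \<Longrightarrow> run w xs = Some v \<Longrightarrow> set v \<subseteq> \<Gamma>"
proof (induction xs arbitrary: w)
  case (Cons a xs)
  then obtain u where u: "st w a = Some u" "run u xs = Some v"
    by (auto simp: bind_eq_Some_conv)
  show ?case by (rule Cons.IH[OF Cons.prems(1) closed_st[OF Cons.prems(1,2) u(1)] u(2)])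
qed simp

text \<open>The definition refers to \<approx> itself and is not effective. It serves as an
  existence witness only, and what matters is that it is finite for finite \<Gamma>.\<close>

definition base :: "'x set \<Rightarrow> nat \<Rightarrow> ('x list \<times> 'x list) set" where
  "base \<Gamma> N = {(u, v). u \<approx> v \<and> set u \<subseteq> \<Gamma> \<and> set v \<subseteq> \<Gamma> \<and> length u \<le> N \<and> length v \<le> N}"

lemma finite_base: assumes "finite \<Gamma>" shows "finite (base \<Gamma> N)"
proof (rule finite_subset)
  let ?L = "{u. set u \<subseteq> \<Gamma> \<and> length u \<le> N}"
  show "base \<Gamma> N \<subseteq> ?L \<times> ?L" by (auto simp: base_def)
  show "finite (?L \<times> ?L)" using finite_lists_length_le[OF assms] by simp
qed

text \<open>Deleting a null \<open>X\<close> uses the pair of \<open>[X]\<close> and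
  \<open>[]\<close>. Cutting off what follows an unnormed \<open>X\<close> uses the pair of
  \<open>[X, Y]\<close> and \<open>[X]\<close> once for each letter \<open>Y\<close>, whence the
  bound 2.\<close>

lemma cong_red:
  assumes N: "2 \<le> N" and w: "set w \<subseteq> \<Gamma>"
  shows "cong (base \<Gamma> N) w (red w)"
  using w
proof (induction w)
  case Nil
  show ?case by (simp add: cong_Nil)
next
  case (Cons X w)
  then have IH: "cong (base \<Gamma> N) w (red w)" and X: "X \<in> \<Gamma>" "set w \<subseteq> \<Gamma>" by auto
  show ?case
  proof (cases "null X")
    case True
    then have "([X], []) \<in> base \<Gamma> N" using N X nullw_eqv_Nil[of "[X]"] by (simp add: base_def)
    from cong_base[OF this, of w] True IH show ?thesis by (auto intro: cong_trans)
  next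
    case nn: False
    show ?thesis
    proof (cases "normed [X]")
      case True
      with nn IH show ?thesis by (auto intro: cong_Cons)
    next
      case False
      have "cong (base \<Gamma> N) (X # v) [X]" if "set v \<subseteq> \<Gamma>" for v
        using that
      proof (induction v)
        case (Cons Y v)
        have "([X, Y], [X]) \<in> base \<Gamma> N"
          using N X Cons.prems unnormed_absorb[OF False, of "[Y]" "[]"] by (simp add: base_def)
        from cong_base[OF this, of v] Cons show ?case by (auto intro: cong_trans)
      qed (simp add: cong_refl)
      with X nn False show ?thesis by simp
    qed
  qed
qed

text \<open>Dividing the two words by a shortest run \<open>t\<close> of \<open>X\<close> leaves \<open>w' \<approx> \<beta> @ v'\<close>.  Either \<open>Y\<close> is
  itself equivalent to \<open>X # \<beta>\<close>, or else \<open>v'\<close> is determined by \<open>X\<close> and \<open>Y\<close> alone.\<close>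
lemma cong_base_step:
  assumes cl: "closed \<Gamma>"
    and X: "normed [X]" "\<not> null X" and Y: "\<not> null Y" and XY: "normed [Y] \<Longrightarrow> norm [X] \<le> norm [Y]"
    and t: "length t = norm [X]" "run [X] t = Some x" "nullw x"
    and \<gamma>: "\<And>v. set v \<subseteq> \<Gamma> \<Longrightarrow> X # the (run [Y] t) @ v \<approx> Y # v \<Longrightarrow>
              set \<gamma> \<subseteq> \<Gamma> \<and> X # the (run [Y] t) @ \<gamma> \<approx> Y # \<gamma>"
    and K: "sz (the (run [Y] t)) \<le> K" "sz (the (run [Y] t) @ \<gamma>) \<le> K" "sz \<gamma> \<le> K" "K < m"
    and N: "length (the (run [Y] t)) + length \<gamma> + 1 \<le> N"
    and G: "set (X # w) \<subseteq> \<Gamma>" "set (Y # v) \<subseteq> \<Gamma>"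
    and e: "X # w \<approx> Y # v" and m: "sz (X # w) \<le> m" "sz (Y # v) \<le> m"
    and IH: "\<And>w v. set w \<subseteq> \<Gamma> \<Longrightarrow> set v \<subseteq> \<Gamma> \<Longrightarrow> w \<approx> v \<Longrightarrow> sz w < m \<Longrightarrow> sz v < m \<Longrightarrow>
              cong (base \<Gamma> N) w v"
  shows "cong (base \<Gamma> N) (X # w) (Y # v)"
proof -
  have "run (X # w) t = Some (x @ w)" using run_append[OF t(2), of w] by simp
  with eqv_run[OF e, of t] obtain z where z: "run ([Y] @ v) t = Some z" "x @ w \<approx> z"
    by (cases "run (Y # v) t") auto
  \<comment> \<open>Were \<open>Y\<close> used up by a prefix of \<open>t\<close>, then
    \<open>Y\<close> would be normed and the prefix at least as long as \<open>norm [Y]\<close>,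
    hence as long as \<open>t\<close>. So all of \<open>t\<close> runs inside
    \<open>Y\<close>.\<close>
  have "\<exists>\<beta>. run [Y] t = Some \<beta>"
    using run_append_split[OF z(1)]
  proof (elim disjE exE conjE)
    fix ys zs u assume u: "t = ys @ zs" "run [Y] ys = Some u" "nullw u"
    then have "normed [Y]" by (auto simp: normed_run)
    from XY[OF this] norm_le[OF u(2,3)] have "length t \<le> length ys" using t(1) by linarith
    with u(1) have "zs = []" by simp
    with u show ?thesis by auto
  qed auto
  then obtain \<beta> where \<beta>: "run [Y] t = Some \<beta>" by blast
  have the: "the (run [Y] t) = \<beta>" using \<beta> by simp
  note \<gamma> = \<gamma>[unfolded the] and K = K[unfolded the] and N = N[unfolded the]
  have "z = \<beta> @ v" using run_append[OF \<beta>, of v] z(1) by simp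
  then have w: "w \<approx> \<beta> @ v" using z(2) nullw_eqv[OF t(3), of w] eqv_sym eqv_trans by blast
  have \<beta>G: "set \<beta> \<subseteq> \<Gamma>" using closed_run[OF cl _ \<beta>] G(2) by simp
  have "0 < norm [X]" using norm_pos[OF X(1)] X(2) by simp
  then have szw: "sz w < m" using m(1) X by simp
  have e': "X # \<beta> @ v \<approx> Y # v"
    using eqv_append_left[OF eqv_sym[OF w], of "[X]"] e eqv_trans by auto
  show ?thesis
  proof (cases "X # \<beta> \<approx> [Y]")
    case True
    \<comment> \<open>If \<beta> is normed, \<open>norm [Y] = norm [X] + norm \<beta>\<close>, so
      replacing \<open>Y\<close> by \<beta> lowers the size. If not, \<open>v\<close> does not count
      and \<open>K\<close> bounds the size.\<close>
    have "sz (\<beta> @ v) < m"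
    proof (cases "normed \<beta>")
      case nb: True
      have "norm [Y] = norm [X] + norm \<beta>" "normed [Y]"
        using norm_append[OF X(1) nb] eqv_norm[OF True] eqv_normed[OF True] nb X(1)
          normed_append[of "[X]" \<beta>] by auto
      with m(2) Y \<open>0 < norm [X]\<close> sz_normed[OF nb, of v] show ?thesis by simp
    next
      case False
      with K sz_unnormed[OF False, of v] show ?thesis by simp
    qed
    then have "cong (base \<Gamma> N) w (\<beta> @ v)" using IH[OF _ _ w szw] G \<beta>G by simp
    then have "cong (base \<Gamma> N) (X # w) (X # \<beta> @ v)" by (rule cong_Cons)
    moreover have "(X # \<beta>, [Y]) \<in> base \<Gamma> N" using True G \<beta>G N by (simp add: base_def)
    from cong_base[OF this, of v] have "cong (base \<Gamma> N) (X # \<beta> @ v) (Y # v)" by simp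
    ultimately show ?thesis by (rule cong_trans)
  next
    case False
    have g: "set \<gamma> \<subseteq> \<Gamma>" "X # \<beta> @ \<gamma> \<approx> Y # \<gamma>" using \<gamma>[of v] e' G(2) by auto
    have v\<gamma>: "v \<approx> \<gamma>"
      using common_suffix_unique[OF False, of v \<gamma>] e' g(2) by simp
    \<comment> \<open>If \<open>Y\<close> were unnormed, so would be \<beta>, its residual. Both
      sides would then absorb \<open>v\<close>, leaving \<open>X # \<beta> \<approx> [Y]\<close>,
      which this case excludes.\<close>
    have nY: "normed [Y]"
    proof (rule ccontr)
      assume n: "\<not> normed [Y]"
      have "\<not> normed (X # \<beta> @ v)"
        using n eqv_normed[OF e'] normed_append[of "[Y]" v] by auto
      have "\<not> normed \<beta>"
      proof
        assume "normed \<beta>"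
        then obtain ys b where "run \<beta> ys = Some b" "nullw b" by (auto simp: normed_run)
        then have "run [Y] (t @ ys) = Some b" using \<beta> by (simp add: run_concat)
        with n \<open>nullw b\<close> show False by (auto simp: normed_run)
      qed
      then have u: "\<not> normed (X # \<beta>)" using normed_append[of "[X]" \<beta>] by simp
      have "X # \<beta> \<approx> X # \<beta> @ v" using unnormed_absorb[OF u, of "[]" v] by simp
      also have "\<dots> \<approx> Y # v" by (rule e')
      also have "Y # v \<approx> [Y]" using unnormed_absorb[OF n, of v "[]"] by simp
      finally show False using False by blast
    qed
    then have "0 < norm [Y]" using norm_pos[of "[Y]"] Y by simp
    then have szv: "sz v < m" using m(2) Y nY by simp
    have "cong (base \<Gamma> N) v \<gamma>" using IH[OF _ g(1) v\<gamma> szv] G K by simp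
    then have c1: "cong (base \<Gamma> N) (Y # v) (Y # \<gamma>)" by (rule cong_Cons)
    have w': "w \<approx> \<beta> @ \<gamma>" using w eqv_append_left[OF v\<gamma>, of \<beta>] eqv_trans by blast
    have "cong (base \<Gamma> N) w (\<beta> @ \<gamma>)" using IH[OF _ _ w' szw] G g(1) \<beta>G K by simp
    then have c2: "cong (base \<Gamma> N) (X # w) (X # \<beta> @ \<gamma>)" by (rule cong_Cons)
    \<comment> \<open>The tails of unknown length have been exchanged for \<gamma>, which depends on
      the two letters only, so the remaining pair is short enough to be a generator.\<close>
    have "(X # \<beta> @ \<gamma>, Y # \<gamma>) \<in> base \<Gamma> N" using g G \<beta>G N by (simp add: base_def)
    from cong_base[OF this, of "[]"] have "cong (base \<Gamma> N) (X # \<beta> @ \<gamma>) (Y # \<gamma>)" by simp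
    with c1 c2 show ?thesis using cong_sym cong_trans by metis
  qed
qed

text \<open>The run \<open>t\<close>, its residual \<beta> and the solution \<gamma> are fixed once
  for each letter or pair of letters. As \<Gamma> is finite, one \<open>K\<close> bounds all their
  sizes. Reduced words of size at most \<open>K\<close> are generators themselves; larger ones are
  split by \<open>cong_base_step\<close> into words of smaller size.\<close>

theorem eqv_finitely_generated:
  assumes fin: "finite \<Gamma>" and cl: "closed \<Gamma>"
  shows "\<exists>N. 2 \<le> N \<and> (\<forall>w v. set w \<subseteq> \<Gamma> \<longrightarrow> set v \<subseteq> \<Gamma> \<longrightarrow> w \<approx> v \<longrightarrow> cong (base \<Gamma> N) w v)"
proof -
  define t where "t X = (SOME xs. length xs = norm [X] \<and> (\<exists>x. run [X] xs = Some x \<and> nullw x))" for X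
  define \<beta> where "\<beta> X Y = the (run [Y] (t X))" for X Y
  \<comment> \<open>If no word over \<Gamma> solves the equation, the value is arbitrary. It still
    counts in \<open>K\<close>, but its defining property is invoked only where a solution is at
    hand.\<close>
  define \<gamma> where "\<gamma> X Y = (SOME v. set v \<subseteq> \<Gamma> \<and> X # \<beta> X Y @ v \<approx> Y # v)" for X Y
  have t: "length (t X) = norm [X] \<and> (\<exists>x. run [X] (t X) = Some x \<and> nullw x)" if "normed [X]" for X
    unfolding t_def by (rule someI_ex) (use norm_run[OF that] in blast)
  have \<gamma>: "set (\<gamma> X Y) \<subseteq> \<Gamma> \<and> X # \<beta> X Y @ \<gamma> X Y \<approx> Y # \<gamma> X Y"
    if "set v \<subseteq> \<Gamma>" "X # \<beta> X Y @ v \<approx> Y # v" for X Y v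
    unfolding \<gamma>_def by (rule someI[of _ v]) (use that in blast)
  define f where "f = (\<lambda>(X, Y). sz (\<beta> X Y) + sz (\<beta> X Y @ \<gamma> X Y) + sz (\<gamma> X Y) +
    length (\<beta> X Y) + length (\<gamma> X Y))"
  define K where "K = Max (insert 0 (f ` (\<Gamma> \<times> \<Gamma>)))"
  \<comment> \<open>The 2 meets the bound of \<open>cong_red\<close>. It also leaves room for the
    extra 1 of \<open>length_red\<close> and for the letter \<open>X\<close> in front of \<beta> and
    \<gamma>.\<close>
  define N where "N = K + 2"
  have f: "f (X, Y) \<le> K" if "X \<in> \<Gamma>" "Y \<in> \<Gamma>" for X Y
    unfolding K_def by (rule Max_ge) (use fin that in auto)
  have "cong (base \<Gamma> N) w v" if "set w \<subseteq> \<Gamma>" "set v \<subseteq> \<Gamma>" "w \<approx> v" for w v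
    using that
  proof (induction "max (sz w) (sz v)" arbitrary: w v rule: less_induct)
    case less
    define m where "m = max (sz w) (sz v)"
    have IH: "cong (base \<Gamma> N) w v"
      if "set w \<subseteq> \<Gamma>" "set v \<subseteq> \<Gamma>" "w \<approx> v" "sz w < m" "sz v < m" for w v
      using less.hyps[of w v] that by (simp add: m_def)
    have G: "set (red w) \<subseteq> \<Gamma>" "set (red v) \<subseteq> \<Gamma>" using less.prems set_red by blast+
    have e: "red w \<approx> red v" using less.prems(3) red_eqv eqv_trans eqv_sym by metis
    have step: "cong (base \<Gamma> N) (X # w) (Y # v)"
      if "normed [X]" "\<not> null X" "\<not> null Y" "normed [Y] \<Longrightarrow> norm [X] \<le> norm [Y]"
        "set (X # w) \<subseteq> \<Gamma>" "set (Y # v) \<subseteq> \<Gamma>" "X # w \<approx> Y # v"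
        "sz (X # w) \<le> m" "sz (Y # v) \<le> m" "K < m" for X Y w v
    proof -
      obtain x where x: "length (t X) = norm [X]" "run [X] (t X) = Some x" "nullw x"
        using t[OF \<open>normed [X]\<close>] by blast
      have "f (X, Y) \<le> K" by (rule f) (use that in auto)
      then show ?thesis
        by (intro cong_base_step[OF cl that(1-4) x, where \<gamma>="\<gamma> X Y" and K=K and m=m])
          (use that IH \<gamma>[of _ X Y] in \<open>auto simp: f_def N_def \<beta>_def\<close>)
    qed
    have "cong (base \<Gamma> N) (red w) (red v)"
    proof (cases "m \<le> K")
      case True
      then have "length (red w) \<le> N" "length (red v) \<le> N"
        using length_red[of w] length_red[of v] by (auto simp: m_def N_def)
      then have "(red w, red v) \<in> base \<Gamma> N" using G e by (simp add: base_def)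
      from cong_base[OF this, of "[]"] show ?thesis by simp
    next
      case False
      have m: "m = max (sz (red w)) (sz (red v))" by (simp add: m_def sz_red)
      show ?thesis
      proof (cases "red w = [] \<or> red v = []")
        case True
        then have "nullw w" "nullw v" using red_Nil eqv_nullw[OF less.prems(3)] by auto
        then have "red w = []" "red v = []" by (simp_all add: red_Nil)
        then show ?thesis by (simp add: cong_Nil)
      next
        case ne: False
        then obtain X w' Y v' where r: "red w = X # w'" "red v = Y # v'"
          by (meson neq_Nil_conv)
        have nn: "\<not> null X" "\<not> null Y" using r red_head by blast+
        \<comment> \<open>Two unnormed heads would make both sizes 0, contrary to \<open>m\<close>
          exceeding \<open>K\<close>. By symmetry the letter to divide by can be the one of smaller
          norm.\<close>
        have "normed [X] \<or> normed [Y]" using m False nn by (auto simp: r split: if_splits)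
        then consider "normed [X]" "normed [Y] \<longrightarrow> norm [X] \<le> norm [Y]"
          | "normed [Y]" "normed [X] \<longrightarrow> norm [Y] \<le> norm [X]" by linarith
        then show ?thesis
        proof cases
          case 1
          then show ?thesis
            unfolding r by (intro step) (use G e m nn False in \<open>auto simp: r simp del: sz.simps\<close>)
        next
          case 2
          have "cong (base \<Gamma> N) (Y # v') (X # w')"
            by (intro step) (use 2 G eqv_sym[OF e] m nn False in \<open>auto simp: r simp del: sz.simps\<close>)
          then show ?thesis unfolding r by (rule cong_sym)
        qed
      qed
    qed
    moreover have "cong (base \<Gamma> N) w (red w)" "cong (base \<Gamma> N) v (red v)"
      using cong_red less.prems by (simp_all add: N_def)
    ultimately show ?case using cong_sym cong_trans by metis
  qed
  moreover have "2 \<le> N" by (simp add: N_def)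
  ultimately show ?thesis by blast
qed

end


section \<open>Types, unfoldings and closures\<close>

lemma stype_induct [case_names Skip Out In IntCh ExtCh Seq Rec Var]:
  assumes "P Skip" "\<And>b. P (Out b)" "\<And>b. P (In b)"
    "\<And>bs. (\<And>l T. (l, T) \<in> set bs \<Longrightarrow> P T) \<Longrightarrow> P (IntCh bs)"
    "\<And>bs. (\<And>l T. (l, T) \<in> set bs \<Longrightarrow> P T) \<Longrightarrow> P (ExtCh bs)"
    "\<And>T U. P T \<Longrightarrow> P U \<Longrightarrow> P (Seq T U)" "\<And>m T. P T \<Longrightarrow> P (Rec m T)" "\<And>i. P (Var i)"
  shows "P T"
  by (induction T) (use assms in \<open>auto simp: snds.simps\<close>)

section \<open>Substitution, termination and contractivity\<close>

lemma lift_lift: "i \<le> k \<Longrightarrow> lift i (lift k T) = lift (Suc k) (lift i T)"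
  by (induction T arbitrary: i k rule: stype_induct) (auto simp: comp_def)

lemma lift_subst: "i \<le> j \<Longrightarrow> lift i (subst j R S) = subst (Suc j) (lift i R) (lift i S)"
  by (induction S arbitrary: i j R rule: stype_induct) (auto simp: comp_def lift_lift)

lemma subst_lift: "subst k S (lift k T) = T"
  by (induction T arbitrary: k S rule: stype_induct) (auto simp: comp_def intro: map_idI)

lemma subst_subst:
  "i \<le> j \<Longrightarrow> subst j R (subst i S T) = subst i (subst j R S) (subst (Suc j) (lift i R) T)"
  by (induction T arbitrary: i j R S rule: stype_induct)
    (auto simp: comp_def lift_lift lift_subst subst_lift)

lemma terminated_lift: "terminated (lift k T) = terminated T"
  by (induction T arbitrary: k rule: stype_induct) auto

lemma terminated_subst_iff: "\<not> terminated S \<Longrightarrow> terminated (subst k S T) = terminated T"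
  by (induction T arbitrary: k S rule: stype_induct) (auto simp: terminated_lift)

text \<open>A terminated type contains no variable at all, since \<open>terminated\<close> fails on
  \<open>Var\<close>.\<close>

lemma terminated_subst: "terminated T \<Longrightarrow> subst k S T = T"
  by (induction T arbitrary: k S rule: stype_induct) auto

lemma terminated_unfold: "terminated (subst 0 (Rec m T) T) = terminated T"
  using terminated_subst_iff[of "Rec m T" 0 T] terminated_subst[of T 0 "Rec m T"]
  by (cases "terminated T") auto

lemma contractive_lift_same: "contractive (lift i T) i"
  by (induction T arbitrary: i rule: stype_induct) auto

lemma contractive_lift_less: "i < k \<Longrightarrow> contractive (lift k T) i = contractive T i"
  by (induction T arbitrary: i k rule: stype_induct) (auto simp: terminated_lift)

lemma contractive_lift_Suc: "k \<le> i \<Longrightarrow> contractive (lift k T) (Suc i) = contractive T i"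
  by (induction T arbitrary: i k rule: stype_induct) (auto simp: terminated_lift)

text \<open>A terminated \<open>S\<close> could turn the first component of a sequence into a
  terminated one and so expose the second to the test. For other \<open>S\<close> termination is
  invariant under the substitution.\<close>

lemma contractive_subst:
  "i < k \<Longrightarrow> contractive T i \<Longrightarrow> contractive S i \<Longrightarrow> \<not> terminated S \<Longrightarrow> contractive (subst k S T) i"
  by (induction T arbitrary: i k S rule: stype_induct)
    (auto simp: terminated_lift terminated_subst_iff contractive_lift_Suc)

text \<open>The part of kinding that survives unfolding without a context.\<close>
fun okt :: "stype \<Rightarrow> bool" where
  "okt (IntCh bs) = (distinct (map fst bs) \<and> (\<forall>(l, T)\<in>set bs. okt T))"
| "okt (ExtCh bs) = (distinct (map fst bs) \<and> (\<forall>(l, T)\<in>set bs. okt T))"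
| "okt (Seq T U) = (okt T \<and> okt U)"
| "okt (Rec m T) = (contractive T 0 \<and> okt T)"
| "okt _ = True"

lemma kinding_okt: "kinding \<Delta> T m \<Longrightarrow> okt T"
  by (induction rule: kinding.induct) auto

lemma okt_lift: "okt T \<Longrightarrow> okt (lift k T)"
  by (induction T arbitrary: k rule: stype_induct)
    (auto simp: comp_def contractive_lift_less case_prod_beta')

lemma okt_subst: "okt T \<Longrightarrow> okt S \<Longrightarrow> \<not> terminated S \<Longrightarrow> okt (subst k S T)"
  by (induction T arbitrary: k S rule: stype_induct)
    (auto simp: comp_def case_prod_beta' okt_lift terminated_lift contractive_lift_same
      intro: contractive_subst)

lemma okt_unfold: "okt (Rec m T) \<Longrightarrow> okt (subst 0 (Rec m T) T)"
  using okt_subst[of T "Rec m T" 0] terminated_subst[of T 0 "Rec m T"] by (cases "terminated T") auto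

text \<open>The number of silent steps at the head of a type before its first action.\<close>
fun hm :: "stype \<Rightarrow> nat" where
  "hm (Seq T U) = Suc (hm T + (if terminated T then hm U else 0))"
| "hm (Rec m T) = Suc (hm T)"
| "hm _ = 1"

text \<open>Contractivity keeps the variable \<open>k\<close> out of head position, the only part of
  the type that \<open>hm\<close> inspects.\<close>

lemma hm_subst: "contractive T k \<Longrightarrow> \<not> terminated S \<Longrightarrow> hm (subst k S T) = hm T"
  by (induction T arbitrary: k S rule: stype_induct)
    (auto simp: terminated_subst_iff terminated_lift)

text \<open>As \<open>hm (Rec m T) = Suc (hm T)\<close>, every unfolding lowers \<open>hm\<close>.
  This is how contractivity yields the existence of head normal forms.\<close>

lemma hm_unfold: "okt (Rec m T) \<Longrightarrow> hm (subst 0 (Rec m T) T) = hm T"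
  using hm_subst[of T 0 "Rec m T"] terminated_subst[of T 0 "Rec m T"] by (cases "terminated T") auto

text \<open>A closure \<open>(T, \<rho>)\<close> is a subterm \<open>T\<close> with the list \<open>\<rho>\<close> of the recursive types around it,
  innermost first; each entry of \<open>\<rho>\<close> lives under the entries that follow it.\<close>
type_synonym clo = "stype \<times> stype list"

definition val :: "stype \<Rightarrow> stype list \<Rightarrow> stype" where
  "val T \<rho> = foldl (\<lambda>T R. subst 0 R T) T \<rho>"

lemma val_Nil [simp]: "val T [] = T"
  and val_Cons: "val T (R # \<rho>) = val (subst 0 R T) \<rho>"
  by (simp_all add: val_def)

lemma val_simps [simp]:
  "val Skip \<rho> = Skip" "val (Out b) \<rho> = Out b" "val (In b) \<rho> = In b"
  "val (Seq T U) \<rho> = Seq (val T \<rho>) (val U \<rho>)"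
  "val (IntCh bs) \<rho> = IntCh (map (\<lambda>(l, T). (l, val T \<rho>)) bs)"
  "val (ExtCh bs) \<rho> = ExtCh (map (\<lambda>(l, T). (l, val T \<rho>)) bs)"
  by (induction \<rho> arbitrary: T U bs) (auto simp: val_Cons comp_def case_prod_beta')

lemma val_Var_bound: "i < length \<rho> \<Longrightarrow> val (Var i) \<rho> = val (\<rho> ! i) (drop (Suc i) \<rho>)"
proof (induction \<rho> arbitrary: i)
  case (Cons R \<rho>)
  then show ?case by (cases i) (auto simp: val_Cons)
qed simp

lemma val_Var_free: "length \<rho> \<le> i \<Longrightarrow> val (Var i) \<rho> = Var (i - length \<rho>)"
proof (induction \<rho> arbitrary: i)
  case (Cons R \<rho>)
  then show ?case by (cases i) (auto simp: val_Cons)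
qed simp

text \<open>Pushing the recursive type onto the environment amounts to unfolding it: by
  \<open>subst_subst\<close> the substitutions of \<rho> commute with the unfolding.\<close>

lemma val_Rec: "\<exists>T'. val (Rec m T) \<rho> = Rec m T' \<and> val T (Rec m T # \<rho>) = subst 0 (Rec m T') T'"
proof -
  have "\<exists>T'. val (Rec m T) \<rho> = Rec m T' \<and> val (subst 0 (Rec m T) T) \<rho> = subst 0 (Rec m T') T'"
  proof (induction \<rho> arbitrary: T)
    case (Cons R \<rho>)
    show ?case
      using Cons[of "subst (Suc 0) (lift 0 R) T"] subst_subst[of 0 0 R "Rec m T" T]
      by (simp add: val_Cons)
  qed simp
  then show ?thesis by (simp add: val_Cons)
qed

text \<open>Sequential composition is associative only up to bisimilarity; flattening makes it so on the
  nose.\<close>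
fun fl :: "stype \<Rightarrow> stype list" where
  "fl Skip = []"
| "fl (Seq T U) = fl T @ fl U"
| "fl T = [T]"

inductive ftrans :: "stype list \<Rightarrow> act \<Rightarrow> stype list \<Rightarrow> bool" where
  ftrans_head: "trans X a X' \<Longrightarrow> ftrans (X # s) a (fl X' @ s)"
| ftrans_skip: "terminated X \<Longrightarrow> ftrans s a s' \<Longrightarrow> ftrans (X # s) a s'"

lemma terminated_fl: "terminated T \<longleftrightarrow> (\<forall>X\<in>set (fl T). terminated X)"
  by (induction T rule: stype_induct) auto

lemma ftrans_terminated: "\<forall>X\<in>set u. terminated X \<Longrightarrow> ftrans s a s' \<Longrightarrow> ftrans (u @ s) a s'"
  by (induction u) (auto intro: ftrans_skip)

lemma trans_ftrans: "trans T a T' \<Longrightarrow> ftrans (fl T @ s) a (fl T' @ s)"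
proof (induction arbitrary: s rule: trans.induct)
  case (t_seq1 T a T' U)
  then show ?case using t_seq1.IH[of "fl U @ s"] by simp
next
  case (t_seq2 T U a U')
  then show ?case using ftrans_terminated[of "fl T"] terminated_fl[of T] by simp
next
  case (t_rec m T a T')
  from ftrans_head[OF trans.t_rec[OF t_rec.hyps]] show ?case by simp
next
  case (t_int k T bs)
  from ftrans_head[OF trans.t_int[OF t_int.hyps]] show ?case by simp
next
  case (t_ext k T bs)
  from ftrans_head[OF trans.t_ext[OF t_ext.hyps]] show ?case by simp
next
  case (t_out b)
  from ftrans_head[OF trans.t_out] show ?case by simp
next
  case (t_in b)
  from ftrans_head[OF trans.t_in] show ?case by simp
next
  case (t_var b)
  from ftrans_head[OF trans.t_var] show ?case by simp
qed

inductive_cases ftrans_ConsE: "ftrans (X # s) a s'"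
inductive_cases ftrans_NilE: "ftrans [] a s'"

lemma ftrans_trans:
  "ftrans (fl T @ s) a s' \<Longrightarrow> (\<exists>T'. trans T a T' \<and> s' = fl T' @ s) \<or> (terminated T \<and> ftrans s a s')"
proof (induction T arbitrary: s rule: stype_induct)
  case (Seq T U)
  from Seq.prems have "ftrans (fl T @ (fl U @ s)) a s'" by simp
  from Seq.IH(1)[OF this] show ?case
  proof
    assume "\<exists>T'. trans T a T' \<and> s' = fl T' @ fl U @ s"
    then show ?thesis using t_seq1 by fastforce
  next
    assume *: "terminated T \<and> ftrans (fl U @ s) a s'"
    with Seq.IH(2)[of s] t_seq2 show ?thesis by fastforce
  qed
qed (auto elim: ftrans_ConsE)

text \<open>After a dead choice nothing happens, so that the end of a type is no longer distinguished from
  a deadlock.\<close>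
lemma ftrans_bot: "ftrans (fl T @ [IntCh []]) a s' \<longleftrightarrow> (\<exists>T'. trans T a T' \<and> s' = fl T' @ [IntCh []])"
proof -
  have "\<not> trans (IntCh []) a X" for X by (auto elim: trans.cases)
  then have "\<not> ftrans [IntCh []] a s'" by (auto elim!: ftrans_ConsE ftrans_NilE)
  then show ?thesis using ftrans_trans trans_ftrans by blast
qed

definition F :: "clo list \<Rightarrow> stype list" where
  "F cs = concat (map (\<lambda>(T, \<rho>). fl (val T \<rho>)) cs)"

lemma F_simps [simp]: "F [] = []" "F ((T, \<rho>) # cs) = fl (val T \<rho>) @ F cs"
  by (simp_all add: F_def)

text \<open>Stronger than bisimilarity: the targets are literally the same. Silent moves of the
  machine preserve it, so no bisimulation up to an equivalence is needed later.\<close>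

definition fsame :: "stype list \<Rightarrow> stype list \<Rightarrow> bool" where
  "fsame s s' \<longleftrightarrow> (\<forall>a t. ftrans s a t \<longleftrightarrow> ftrans s' a t) \<and>
    ((\<forall>X\<in>set s. terminated X) \<longleftrightarrow> (\<forall>X\<in>set s'. terminated X))"

lemma fsame_unfold: "fsame (Rec m T # s) (fl (subst 0 (Rec m T) T) @ s)"
proof -
  let ?U = "subst 0 (Rec m T) T"
  have t: "trans (Rec m T) a X \<longleftrightarrow> trans ?U a X" for a X
    by (auto intro: t_rec elim: trans.cases)
  have "ftrans (Rec m T # s) a s' \<longleftrightarrow> ftrans (fl ?U @ s) a s'" for a s'
  proof
    assume "ftrans (Rec m T # s) a s'"
    then consider X' where "trans (Rec m T) a X'" "s' = fl X' @ s"
      | "terminated (Rec m T)" "ftrans s a s'" by (auto elim: ftrans_ConsE)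
    then show "ftrans (fl ?U @ s) a s'"
    proof cases
      case 1
      then show ?thesis using t[of a X'] trans_ftrans[of ?U a X' s] by simp
    next
      case 2
      then show ?thesis
        using ftrans_terminated[of "fl ?U"] terminated_fl[of ?U] terminated_unfold[of m T] by simp
    qed
  next
    assume "ftrans (fl ?U @ s) a s'"
    then show "ftrans (Rec m T # s) a s'"
      using ftrans_trans[of ?U s a s'] t terminated_unfold[of m T]
      by (auto intro: ftrans_head ftrans_skip)
  qed
  then show ?thesis
    using terminated_unfold[of m T] terminated_fl[of ?U] by (auto simp: fsame_def)
qed

text \<open>The closures that a machine move on the given one can put on the word. A free variable
  is renumbered to its index outside the environment, which becomes empty.\<close>

fun children :: "clo \<Rightarrow> clo set" where
  "children (Seq T U, \<rho>) = {(T, \<rho>), (U, \<rho>)}"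
| "children (Rec m T, \<rho>) = {(T, Rec m T # \<rho>)}"
| "children (IntCh bs, \<rho>) = (\<lambda>(l, T). (T, \<rho>)) ` set bs"
| "children (ExtCh bs, \<rho>) = (\<lambda>(l, T). (T, \<rho>)) ` set bs"
| "children (Var i, \<rho>) =
    {if i < length \<rho> then (\<rho> ! i, drop (Suc i) \<rho>) else (Var (i - length \<rho>), [])}"
| "children (_, \<rho>) = {}"

definition cclosed :: "clo set \<Rightarrow> bool" where
  "cclosed C \<longleftrightarrow> (\<forall>c\<in>C. children c \<subseteq> C)"

lemma cclosedD: "cclosed C \<Longrightarrow> c \<in> C \<Longrightarrow> d \<in> children c \<Longrightarrow> d \<in> C"
  by (auto simp: cclosed_def)

text \<open>Since entries of environments are recursive types, looking up a variable leads to an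
  unfolding; the measure \<open>msize\<close> relies on this.\<close>

definition valid :: "clo set" where
  "valid = {(T, \<rho>). okt (val T \<rho>) \<and> (\<forall>R\<in>set \<rho>. \<exists>m T. R = Rec m T)}"

lemma cclosed_valid: "cclosed valid"
  unfolding cclosed_def
proof
  fix c assume c: "c \<in> valid"
  obtain T \<rho> where [simp]: "c = (T, \<rho>)" by force
  show "children c \<subseteq> valid"
  proof (cases T)
    case (Rec m A)
    then show ?thesis using c val_Rec[of m A \<rho>] okt_unfold by (auto simp: valid_def)
  next
    case (Var i)
    then show ?thesis
      using c by (auto simp: valid_def val_Var_bound val_Var_free dest: in_set_dropD)
  qed (use c in \<open>auto simp: valid_def\<close>)
qed

text \<open>A bound variable contributes no target: its \<open>Rec\<close> was collected on the way
  down or belongs to the initial environment. This keeps the recursion structural and the set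
  finite.\<close>

fun cl :: "stype \<Rightarrow> stype list \<Rightarrow> clo set" where
  "cl (Seq T U) \<rho> = insert (Seq T U, \<rho>) (cl T \<rho> \<union> cl U \<rho>)"
| "cl (Rec m T) \<rho> = insert (Rec m T, \<rho>) (cl T (Rec m T # \<rho>))"
| "cl (IntCh bs) \<rho> = insert (IntCh bs, \<rho>) (\<Union>(l, T)\<in>set bs. cl T \<rho>)"
| "cl (ExtCh bs) \<rho> = insert (ExtCh bs, \<rho>) (\<Union>(l, T)\<in>set bs. cl T \<rho>)"
| "cl (Var i) \<rho> = insert (Var i, \<rho>) (if i < length \<rho> then {} else {(Var (i - length \<rho>), [])})"
| "cl T \<rho> = {(T, \<rho>)}"

lemma finite_cl: "finite (cl T \<rho>)"
  by (induction T arbitrary: \<rho> rule: stype_induct) auto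

lemma cl_refl: "(T, \<rho>) \<in> cl T \<rho>"
  by (cases T) auto

lemma cl_subset: "cclosed C \<Longrightarrow> (T, \<rho>) \<in> C \<Longrightarrow> cl T \<rho> \<subseteq> C"
proof (induction T arbitrary: \<rho> rule: stype_induct)
  case (IntCh bs)
  have "cl T \<rho> \<subseteq> C" if "(l, T) \<in> set bs" for l T
    by (rule IntCh.IH[OF that IntCh.prems(1) cclosedD[OF IntCh.prems]]) (use that in force)
  then show ?case using IntCh.prems by auto
next
  case (ExtCh bs)
  have "cl T \<rho> \<subseteq> C" if "(l, T) \<in> set bs" for l T
    by (rule ExtCh.IH[OF that ExtCh.prems(1) cclosedD[OF ExtCh.prems]]) (use that in force)
  then show ?case using ExtCh.prems by auto
next
  case (Seq T U)
  then show ?case using cclosedD[OF Seq.prems] by simp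
next
  case (Rec m T)
  then show ?case using cclosedD[OF Rec.prems] by simp
next
  case (Var i)
  then show ?case using cclosedD[OF Var.prems] by (auto split: if_splits)
qed auto

primrec lookups :: "stype list \<Rightarrow> clo set" where
  "lookups [] = {}"
| "lookups (R # \<rho>) = insert (R, \<rho>) (lookups \<rho>)"

lemma lookups_nth: "i < length \<rho> \<Longrightarrow> (\<rho> ! i, drop (Suc i) \<rho>) \<in> lookups \<rho>"
proof (induction \<rho> arbitrary: i)
  case (Cons R \<rho>)
  then show ?case by (cases i) auto
qed simp

text \<open>Only a variable bound in the initial environment \<rho> can lead outside; for the empty
  environment the set is therefore closed.\<close>

lemma children_cl: "c \<in> cl T \<rho> \<Longrightarrow> children c \<subseteq> cl T \<rho> \<union> lookups \<rho>"
proof (induction T arbitrary: \<rho> rule: stype_induct)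
  case (IntCh bs)
  show ?case
  proof (cases "c = (IntCh bs, \<rho>)")
    case True
    then show ?thesis using cl_refl by fastforce
  next
    case False
    with IntCh.prems obtain l A where A: "(l, A) \<in> set bs" "c \<in> cl A \<rho>" by auto
    then have "cl A \<rho> \<subseteq> cl (IntCh bs) \<rho>" by auto
    with IntCh.IH[OF A] show ?thesis by blast
  qed
next
  case (ExtCh bs)
  show ?case
  proof (cases "c = (ExtCh bs, \<rho>)")
    case True
    then show ?thesis using cl_refl by fastforce
  next
    case False
    with ExtCh.prems obtain l A where A: "(l, A) \<in> set bs" "c \<in> cl A \<rho>" by auto
    then have "cl A \<rho> \<subseteq> cl (ExtCh bs) \<rho>" by auto
    with ExtCh.IH[OF A] show ?thesis by blast
  qed
next
  case (Seq T U)
  then consider "c = (Seq T U, \<rho>)" | "c \<in> cl T \<rho>" | "c \<in> cl U \<rho>" by auto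
  then show ?case
    by cases (use Seq.IH[of \<rho>] cl_refl[of T \<rho>] cl_refl[of U \<rho>] in auto)
next
  case (Rec m T)
  then consider "c = (Rec m T, \<rho>)" | "c \<in> cl T (Rec m T # \<rho>)" by auto
  then show ?case
    by cases (use Rec.IH[of "Rec m T # \<rho>"] cl_refl[of T "Rec m T # \<rho>"] in auto)
next
  case (Var i)
  then show ?case using lookups_nth[of i \<rho>] by (auto split: if_splits)
qed auto

lemma cclosed_cl: "cclosed (cl T [])"
  using children_cl[of _ T "[]"] by (auto simp: cclosed_def)

lemma cclosed_Un: "cclosed C \<Longrightarrow> cclosed D \<Longrightarrow> cclosed (C \<union> D)"
  by (auto simp: cclosed_def)


section \<open>The machine on codes\<close>

abbreviation pair_code :: "nat \<Rightarrow> nat \<Rightarrow> nat" ("\<langle>_,/ _\<rangle>") where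
  "\<langle>a, b\<rangle> \<equiv> prod_encode (a, b)"

text \<open>The letters of a word are codes \<open>\<langle>t, \<rho>\<rangle>\<close> of closures; every number is a letter, but those that
  code no closure have no head normal form.  The numbers 0 to 7 are the tags of \<open>enc\<close>.\<close>
inductive hnf :: "nat list \<Rightarrow> nat list \<Rightarrow> bool" where
  hnf_Nil: "hnf [] []"
| hnf_skip: "hnf s h \<Longrightarrow> hnf (\<langle>\<langle>0, 0\<rangle>, \<rho>\<rangle> # s) h"
| hnf_head: "c \<in> {1, 2, 3, 4} \<Longrightarrow> hnf (\<langle>\<langle>c, p\<rangle>, \<rho>\<rangle> # s) (\<langle>\<langle>c, p\<rangle>, \<rho>\<rangle> # s)"
| hnf_seq: "hnf (\<langle>t, \<rho>\<rangle> # \<langle>u, \<rho>\<rangle> # s) h \<Longrightarrow> hnf (\<langle>\<langle>5, \<langle>t, u\<rangle>\<rangle>, \<rho>\<rangle> # s) h"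
| hnf_rec: "hnf (\<langle>t, Suc \<langle>\<langle>6, \<langle>m, t\<rangle>\<rangle>, \<rho>\<rangle>\<rangle> # s) h \<Longrightarrow> hnf (\<langle>\<langle>6, \<langle>m, t\<rangle>\<rangle>, \<rho>\<rangle> # s) h"
| hnf_bound: "i < length rs \<Longrightarrow> hnf (\<langle>rs ! i, list_encode (drop (Suc i) rs)\<rangle> # s) h \<Longrightarrow>
    hnf (\<langle>\<langle>7, i\<rangle>, list_encode rs\<rangle> # s) h"
| hnf_free: "length rs \<le> i \<Longrightarrow>
    hnf (\<langle>\<langle>7, i\<rangle>, list_encode rs\<rangle> # s) (\<langle>\<langle>7, i - length rs\<rangle>, 0\<rangle> # s)"

inductive hstep :: "nat list \<Rightarrow> nat \<Rightarrow> nat list \<Rightarrow> bool" where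
  hstep_single: "c \<in> {1, 2, 7} \<Longrightarrow> hstep (\<langle>\<langle>c, b\<rangle>, \<rho>\<rangle> # s) \<langle>c, b\<rangle> s"
| hstep_choice: "c \<in> {3, 4} \<Longrightarrow> \<langle>l, t\<rangle> \<in> set bs \<Longrightarrow>
    hstep (\<langle>\<langle>c, list_encode bs\<rangle>, \<rho>\<rangle> # s) \<langle>c, l\<rangle> (\<langle>t, \<rho>\<rangle> # s)"

definition mstep :: "nat list \<Rightarrow> nat \<Rightarrow> nat list \<Rightarrow> bool" where
  "mstep w a w' \<longleftrightarrow> (\<exists>h. hnf w h \<and> hstep h a w')"

inductive_cases hnf_NilE: "hnf [] h"
inductive_cases hnf_ConsE: "hnf (x # s) h"

lemma hnf_det: "hnf w h \<Longrightarrow> hnf w h' \<Longrightarrow> h = h'"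
proof (induction arbitrary: h' rule: hnf.induct)
  case hnf_Nil
  then show ?case by (auto elim: hnf_NilE)
next
  case (hnf_skip s h \<rho>)
  from hnf_skip.prems show ?case
    by (rule hnf_ConsE) (use hnf_skip.hyps in \<open>auto simp: list_encode_eq dest: hnf_skip.IH\<close>)
next
  case (hnf_head c p \<rho> s)
  from hnf_head.prems show ?case
    by (rule hnf_ConsE) (use hnf_head.hyps in \<open>auto simp: list_encode_eq\<close>)
next
  case (hnf_seq t \<rho> u s h)
  from hnf_seq.prems show ?case
    by (rule hnf_ConsE) (use hnf_seq.hyps in \<open>auto simp: list_encode_eq dest: hnf_seq.IH\<close>)
next
  case (hnf_rec t m \<rho> s h)
  from hnf_rec.prems show ?case
    by (rule hnf_ConsE) (use hnf_rec.hyps in \<open>auto simp: list_encode_eq dest: hnf_rec.IH\<close>)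
next
  case (hnf_bound i rs s h)
  from hnf_bound.prems show ?case
    by (rule hnf_ConsE) (use hnf_bound.hyps in \<open>auto simp: list_encode_eq dest: hnf_bound.IH\<close>)
next
  case (hnf_free rs i s)
  from hnf_free.prems show ?case
    by (rule hnf_ConsE) (use hnf_free.hyps in \<open>auto simp: list_encode_eq\<close>)
qed

lemma hnf_append1: "hnf u h \<Longrightarrow> h = x # r \<Longrightarrow> hnf (u @ w) (h @ w)"
  by (induction rule: hnf.induct) (auto intro: hnf.intros)

lemma hnf_append2: "hnf u h \<Longrightarrow> h = [] \<Longrightarrow> hnf w h' \<Longrightarrow> hnf (u @ w) h'"
  by (induction rule: hnf.induct) (auto intro: hnf.intros)

lemma hnf_split:
  "hnf v h \<Longrightarrow> v = u @ w \<Longrightarrow> (hnf u [] \<and> hnf w h) \<or> (\<exists>x r. hnf u (x # r) \<and> h = x # r @ w)"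
proof (induction arbitrary: u rule: hnf.induct)
  case hnf_Nil
  then show ?case by (auto intro: hnf.intros)
next
  case (hnf_skip s h \<rho>)
  show ?case
  proof (cases u)
    case Nil
    with hnf_skip show ?thesis by (auto intro: hnf.intros)
  next
    case (Cons x u')
    with hnf_skip show ?thesis using hnf_skip.IH[of u'] by (auto intro: hnf.intros)
  qed
next
  case (hnf_head c p \<rho> s)
  show ?case
  proof (cases u)
    case Nil
    with hnf_head(2) have "w = \<langle>\<langle>c, p\<rangle>, \<rho>\<rangle> # s" by simp
    with Nil show ?thesis using hnf.hnf_head[OF hnf_head(1)] hnf.hnf_Nil by blast
  next
    case (Cons x u')
    with hnf_head show ?thesis using hnf.hnf_head[OF hnf_head(1), of p \<rho> u'] by auto
  qed
next
  case (hnf_seq t \<rho> t' s h)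
  show ?case
  proof (cases u)
    case Nil
    with hnf_seq show ?thesis by (auto intro: hnf.intros)
  next
    case (Cons x u')
    with hnf_seq show ?thesis using hnf_seq.IH[of "\<langle>t, \<rho>\<rangle> # \<langle>t', \<rho>\<rangle> # u'"]
      by (auto intro: hnf.hnf_seq)
  qed
next
  case (hnf_rec t m \<rho> s h)
  show ?case
  proof (cases u)
    case Nil
    with hnf_rec show ?thesis by (auto intro: hnf.intros)
  next
    case (Cons x u')
    with hnf_rec show ?thesis using hnf_rec.IH[of "\<langle>t, Suc \<langle>\<langle>6, \<langle>m, t\<rangle>\<rangle>, \<rho>\<rangle>\<rangle> # u'"]
      by (auto intro: hnf.hnf_rec)
  qed
next
  case (hnf_bound i rs s h)
  show ?case
  proof (cases u)
    case Nil
    with hnf_bound show ?thesis by (auto intro: hnf.intros)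
  next
    case (Cons x u')
    with hnf_bound show ?thesis
      using hnf_bound.IH[of "\<langle>rs ! i, list_encode (drop (Suc i) rs)\<rangle> # u'"]
      by (auto intro: hnf.hnf_bound)
  qed
next
  case (hnf_free rs i s)
  show ?case
  proof (cases u)
    case Nil
    with hnf_free(2) have "w = \<langle>\<langle>7, i\<rangle>, list_encode rs\<rangle> # s" by simp
    with Nil show ?thesis using hnf.hnf_free[OF hnf_free(1)] hnf.hnf_Nil by blast
  next
    case (Cons x u')
    with hnf_free show ?thesis using hnf.hnf_free[OF hnf_free(1), of u'] by auto
  qed
qed

lemma hnf_append_Nil: "hnf (u @ w) [] \<longleftrightarrow> hnf u [] \<and> hnf w []"
proof
  assume "hnf (u @ w) []"
  from hnf_split[OF this refl] show "hnf u [] \<and> hnf w []" by simp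
qed (use hnf_append2[OF _ refl] in blast)

inductive_cases hstep_NilE: "hstep [] a v"
inductive_cases hstep_ConsE: "hstep (x # s) a v"

lemma hstep_append: "hstep (x # r @ w) a v \<longleftrightarrow> (\<exists>u. v = u @ w \<and> hstep (x # r) a u)"
proof
  assume "hstep (x # r @ w) a v"
  then show "\<exists>u. v = u @ w \<and> hstep (x # r) a u"
  proof cases
    case (hstep_single c b \<rho>)
    then show ?thesis using hstep.hstep_single[of c b \<rho> r] by auto
  next
    case (hstep_choice c l t bs \<rho>)
    then show ?thesis
      using hstep.hstep_choice[of c l t bs \<rho> r] by (intro exI[of _ "\<langle>t, \<rho>\<rangle> # r"]) simp
  qed
next
  assume "\<exists>u. v = u @ w \<and> hstep (x # r) a u"
  then obtain u where "v = u @ w" "hstep (x # r) a u" by blast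
  from this(2,1) show "hstep (x # r @ w) a v"
    by (cases rule: hstep_ConsE) (auto intro: hstep.intros)
qed

lemma mstep_append_null: "hnf u [] \<Longrightarrow> mstep (u @ w) a v \<longleftrightarrow> mstep w a v"
  unfolding mstep_def using hnf_append2[of u "[]" w] hnf_split[of "u @ w" _ u w] hnf_det[of u "[]"]
  by blast

lemma mstep_append_head:
  assumes "hnf u (x # r)"
  shows "mstep (u @ w) a v \<longleftrightarrow> (\<exists>u'. v = u' @ w \<and> mstep u a u')"
proof -
  have h: "hnf (u @ w) h \<longleftrightarrow> h = x # r @ w" for h
    using hnf_append1[OF assms refl, of w] hnf_det by auto
  have h': "hnf u h \<longleftrightarrow> h = x # r" for h
    using assms hnf_det by auto
  show ?thesis unfolding mstep_def h h' by (simp add: hstep_append)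
qed

lemma mstep_append_stuck: "\<nexists>h. hnf u h \<Longrightarrow> \<not> mstep (u @ w) a v"
  unfolding mstep_def using hnf_split[of "u @ w" _ u w] by blast

definition cd :: "clo \<Rightarrow> nat" where
  "cd c = \<langle>enc (fst c), list_encode (map enc (snd c))\<rangle>"

text \<open>Branches are coded exactly as \<open>list_encode\<close> codes lists, so the machine can
  treat them as ordinary list codes.\<close>

lemma enc_choice:
  "foldr (\<lambda>(l, T) r. Suc (prod_encode (prod_encode (l, enc T), r))) bs 0 =
    list_encode (map (\<lambda>(l, T). \<langle>l, enc T\<rangle>) bs)"
  by (induction bs) auto

lemmas enc_choice_simps [simp] = enc.simps(4,5)[unfolded enc_choice]
declare enc.simps(4,5) [simp del]

fun is_head :: "clo list \<Rightarrow> bool" where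
  "is_head [] = True"
| "is_head ((Skip, \<rho>) # cs) = False"
| "is_head ((Seq T U, \<rho>) # cs) = False"
| "is_head ((Rec m T, \<rho>) # cs) = False"
| "is_head ((Var i, \<rho>) # cs) = (\<rho> = [])"
| "is_head ((T, \<rho>) # cs) = True"

lemma fsame_refl: "fsame s s"
  by (simp add: fsame_def)

lemma fsame_trans: "fsame s t \<Longrightarrow> fsame t u \<Longrightarrow> fsame s u"
  by (simp add: fsame_def)

text \<open>The quantification over all closed \<open>C\<close> serves twice: it transports
  validity, and it keeps runs within the finite set of closures of the given types.\<close>

lemma hnf_closures:
  "hnf w h \<Longrightarrow> w = map cd cs \<Longrightarrow> \<exists>ds. h = map cd ds \<and> is_head ds \<and> fsame (F cs) (F ds) \<and>
    (\<forall>C. cclosed C \<longrightarrow> set cs \<subseteq> C \<longrightarrow> set ds \<subseteq> C)"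
proof (induction arbitrary: cs rule: hnf.induct)
  case hnf_Nil
  then show ?case by (intro exI[of _ "[]"]) (simp add: fsame_refl)
next
  case (hnf_skip s h \<rho>)
  from hnf_skip.prems obtain T \<sigma> cs' where cs: "cs = (T, \<sigma>) # cs'" "s = map cd cs'" "enc T = \<langle>0, 0\<rangle>"
    by (auto simp: Cons_eq_map_conv cd_def list_encode_eq)
  then have "T = Skip" by (cases T) auto
  with hnf_skip.IH[OF cs(2)] show ?case unfolding cs(1) by auto
next
  case (hnf_head c p \<rho> s)
  from hnf_head.prems obtain T \<sigma> cs' where cs: "cs = (T, \<sigma>) # cs'" "enc T = \<langle>c, p\<rangle>"
    by (auto simp: Cons_eq_map_conv cd_def list_encode_eq)
  then have "is_head cs" using hnf_head(1) by (cases T) auto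
  then show ?case using hnf_head(2) fsame_refl by (intro exI[of _ cs]) simp
next
  case (hnf_seq t \<rho> u s h)
  from hnf_seq.prems obtain T \<sigma> cs' where cs: "cs = (T, \<sigma>) # cs'" "s = map cd cs'" "enc T = \<langle>5, \<langle>t, u\<rangle>\<rangle>"
    "\<rho> = list_encode (map enc \<sigma>)"
    by (auto simp: Cons_eq_map_conv cd_def list_encode_eq)
  then obtain A B where T: "T = Seq A B" "t = enc A" "u = enc B" by (cases T) auto
  have "\<langle>t, \<rho>\<rangle> # \<langle>u, \<rho>\<rangle> # s = map cd ((A, \<sigma>) # (B, \<sigma>) # cs')"
    using cs T by (simp add: cd_def)
  from hnf_seq.IH[OF this] obtain ds where ds: "h = map cd ds" "is_head ds"
    "fsame (F ((A, \<sigma>) # (B, \<sigma>) # cs')) (F ds)"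
    "\<forall>C. cclosed C \<longrightarrow> set ((A, \<sigma>) # (B, \<sigma>) # cs') \<subseteq> C \<longrightarrow> set ds \<subseteq> C" by blast
  have "set ds \<subseteq> C" if "cclosed C" "set cs \<subseteq> C" for C
    using ds(4) that cclosedD[OF that(1), of "(Seq A B, \<sigma>)"] unfolding cs(1) T(1) by simp
  with ds show ?case unfolding cs(1) T(1) by (intro exI[of _ ds]) simp
next
  case (hnf_rec t m \<rho> s h)
  from hnf_rec.prems obtain T \<sigma> cs' where cs: "cs = (T, \<sigma>) # cs'" "s = map cd cs'" "enc T = \<langle>6, \<langle>m, t\<rangle>\<rangle>"
    "\<rho> = list_encode (map enc \<sigma>)"
    by (auto simp: Cons_eq_map_conv cd_def list_encode_eq)
  then obtain k A where T: "T = Rec k A" "t = enc A" by (cases T) auto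
  have "\<langle>t, Suc \<langle>\<langle>6, \<langle>m, t\<rangle>\<rangle>, \<rho>\<rangle>\<rangle> # s = map cd ((A, Rec k A # \<sigma>) # cs')"
    using cs T by (simp add: cd_def)
  from hnf_rec.IH[OF this] obtain ds where ds: "h = map cd ds" "is_head ds"
    "fsame (F ((A, Rec k A # \<sigma>) # cs')) (F ds)"
    "\<forall>C. cclosed C \<longrightarrow> set ((A, Rec k A # \<sigma>) # cs') \<subseteq> C \<longrightarrow> set ds \<subseteq> C" by blast
  have "set ds \<subseteq> C" if "cclosed C" "set cs \<subseteq> C" for C
    using ds(4) that cclosedD[OF that(1), of "(Rec k A, \<sigma>)"] unfolding cs(1) T(1) by simp
  moreover have "fsame (F cs) (F ((A, Rec k A # \<sigma>) # cs'))"
    unfolding cs(1) T(1) using val_Rec[of k A \<sigma>] fsame_unfold by auto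
  ultimately show ?case using ds(1,2) fsame_trans[OF _ ds(3), of "F cs"] by (intro exI[of _ ds]) simp
next
  case (hnf_bound i rs s h)
  from hnf_bound.prems obtain T \<sigma> cs' where cs: "cs = (T, \<sigma>) # cs'" "s = map cd cs'" "enc T = \<langle>7, i\<rangle>"
    "rs = map enc \<sigma>"
    by (auto simp: Cons_eq_map_conv cd_def list_encode_eq)
  then have T: "T = Var i" by (cases T) auto
  have "\<langle>rs ! i, list_encode (drop (Suc i) rs)\<rangle> # s = map cd ((\<sigma> ! i, drop (Suc i) \<sigma>) # cs')"
    using cs hnf_bound.hyps(1) by (simp add: cd_def drop_map)
  from hnf_bound.IH[OF this] obtain ds where ds: "h = map cd ds" "is_head ds"
    "fsame (F ((\<sigma> ! i, drop (Suc i) \<sigma>) # cs')) (F ds)"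
    "\<forall>C. cclosed C \<longrightarrow> set ((\<sigma> ! i, drop (Suc i) \<sigma>) # cs') \<subseteq> C \<longrightarrow> set ds \<subseteq> C" by blast
  have i: "i < length \<sigma>" using hnf_bound.hyps(1) cs by simp
  have "set ds \<subseteq> C" if "cclosed C" "set cs \<subseteq> C" for C
    using ds(4) that cclosedD[OF that(1), of "(Var i, \<sigma>)"] i unfolding cs(1) T by simp
  with ds show ?case unfolding cs(1) T by (intro exI[of _ ds]) (simp add: val_Var_bound[OF i])
next
  case (hnf_free rs i s)
  from hnf_free.prems obtain T \<sigma> cs' where cs: "cs = (T, \<sigma>) # cs'" "s = map cd cs'" "enc T = \<langle>7, i\<rangle>"
    "rs = map enc \<sigma>"
    by (auto simp: Cons_eq_map_conv cd_def list_encode_eq)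
  then have T: "T = Var i" by (cases T) auto
  let ?ds = "(Var (i - length \<sigma>), []) # cs'"
  have i: "length \<sigma> \<le> i" using hnf_free cs by simp
  have "set ?ds \<subseteq> C" if "cclosed C" "set cs \<subseteq> C" for C
    using that cclosedD[OF that(1), of "(Var i, \<sigma>)"] i unfolding cs(1) T by simp
  then show ?case unfolding cs(1) T using cs
    by (intro exI[of _ ?ds]) (simp add: val_Var_free[OF i] fsame_refl cd_def)
qed

fun acode :: "act \<Rightarrow> nat" where
  "acode (ASend b) = \<langle>1, b\<rangle>"
| "acode (ARecv b) = \<langle>2, b\<rangle>"
| "acode (AInt l) = \<langle>3, l\<rangle>"
| "acode (AExt l) = \<langle>4, l\<rangle>"
| "acode (AVar i) = \<langle>7, i\<rangle>"

inductive_cases trans_headE: "trans (Out b) a X" "trans (In b) a X" "trans (IntCh bs) a X"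
  "trans (ExtCh bs) a X" "trans (Var i) a X"

lemma hstep_closures:
  assumes "is_head ds" "hstep (map cd ds) \<alpha> w"
  shows "\<exists>a cs. \<alpha> = acode a \<and> w = map cd cs \<and> ftrans (F ds) a (F cs) \<and>
    (\<forall>C. cclosed C \<longrightarrow> set ds \<subseteq> C \<longrightarrow> set cs \<subseteq> C)"
proof -
  obtain T \<rho> ds' where ds: "ds = (T, \<rho>) # ds'"
    using assms(2) by (cases ds) (auto elim: hstep_NilE)
  have h: "hstep (\<langle>enc T, list_encode (map enc \<rho>)\<rangle> # map cd ds') \<alpha> w"
    using assms(2) by (simp add: ds cd_def[of "(T, \<rho>)"])
  have single: ?thesis if "\<alpha> = acode a" "w = map cd ds'" "val T \<rho> = T" "trans T a Skip" "fl T = [T]" for a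
    by (rule exI[of _ a], rule exI[of _ ds'])
      (use that ds ftrans_head[OF that(4), of "F ds'"] in auto)
  have choice: ?thesis
    if "(l, A) \<in> set bs" "\<alpha> = acode a" "w = \<langle>enc A, list_encode (map enc \<rho>)\<rangle> # map cd ds'"
      "trans (val T \<rho>) a (val A \<rho>)" "fl (val T \<rho>) = [val T \<rho>]" "(A, \<rho>) \<in> children (T, \<rho>)"
    for l A bs a
    by (rule exI[of _ a], rule exI[of _ "(A, \<rho>) # ds'"])
      (use that ds ftrans_head[OF that(4), of "F ds'"] in \<open>auto simp: cd_def dest: cclosedD\<close>)
  show ?thesis
  proof (cases T)
    case (Out b)
    with h show ?thesis by (intro single[of "ASend b"]) (auto simp: list_encode_eq elim!: hstep_ConsE intro: t_out)
  next
    case (In b)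
    with h show ?thesis by (intro single[of "ARecv b"]) (auto simp: list_encode_eq elim!: hstep_ConsE intro: t_in)
  next
    case (Var i)
    with h assms(1) show ?thesis
      by (intro single[of "AVar i"]) (auto simp: ds simp: list_encode_eq elim!: hstep_ConsE intro: t_var)
  next
    case (IntCh bs)
    with h obtain l A where "(l, A) \<in> set bs" "\<alpha> = \<langle>3, l\<rangle>"
      "w = \<langle>enc A, list_encode (map enc \<rho>)\<rangle> # map cd ds'"
      by (auto simp: list_encode_eq elim!: hstep_ConsE)
    with IntCh show ?thesis by (intro choice[of l A bs "AInt l"]) (auto intro!: t_int)
  next
    case (ExtCh bs)
    with h obtain l A where "(l, A) \<in> set bs" "\<alpha> = \<langle>4, l\<rangle>"
      "w = \<langle>enc A, list_encode (map enc \<rho>)\<rangle> # map cd ds'"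
      by (auto simp: list_encode_eq elim!: hstep_ConsE)
    with ExtCh show ?thesis by (intro choice[of l A bs "AExt l"]) (auto intro!: t_ext)
  qed (use assms(1) ds in auto)
qed

lemma closures_hstep:
  assumes "is_head ds" "ftrans (F ds) a s"
  shows "\<exists>cs. hstep (map cd ds) (acode a) (map cd cs) \<and> s = F cs \<and>
    (\<forall>C. cclosed C \<longrightarrow> set ds \<subseteq> C \<longrightarrow> set cs \<subseteq> C)"
proof -
  obtain T \<rho> ds' where ds: "ds = (T, \<rho>) # ds'"
    using assms(2) by (cases ds) (auto elim: ftrans_NilE)
  note f = assms(2)[unfolded ds F_simps]
  show ?thesis
  proof (cases T)
    case (Out b)
    with f have "a = ASend b" "s = F ds'" by (auto elim!: ftrans_ConsE trans_headE)
    then show ?thesis unfolding ds Out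
      by (intro exI[of _ ds']) (simp add: cd_def hstep_single del: One_nat_def)
  next
    case (In b)
    with f have "a = ARecv b" "s = F ds'" by (auto elim!: ftrans_ConsE trans_headE)
    then show ?thesis unfolding ds In
      by (intro exI[of _ ds']) (simp add: cd_def hstep_single del: One_nat_def)
  next
    case (Var i)
    with f assms(1) have "a = AVar i" "s = F ds'"
      by (auto simp: ds elim!: ftrans_ConsE trans_headE)
    then show ?thesis unfolding ds Var
      by (intro exI[of _ ds']) (simp add: cd_def hstep_single del: One_nat_def)
  next
    case (IntCh bs)
    with f obtain l A where A: "(l, A) \<in> set bs" "a = AInt l" "s = F ((A, \<rho>) # ds')"
      by (auto elim!: ftrans_ConsE trans_headE)
    then have "\<langle>l, enc A\<rangle> \<in> set (map (\<lambda>(l, T). \<langle>l, enc T\<rangle>) bs)" by force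
    with A show ?thesis unfolding ds IntCh
      using cclosedD[of _ "(T, \<rho>)" "(A, \<rho>)"]
      by (intro exI[of _ "(A, \<rho>) # ds'"]) (force simp: cd_def hstep_choice IntCh)
  next
    case (ExtCh bs)
    with f obtain l A where A: "(l, A) \<in> set bs" "a = AExt l" "s = F ((A, \<rho>) # ds')"
      by (auto elim!: ftrans_ConsE trans_headE)
    then have "\<langle>l, enc A\<rangle> \<in> set (map (\<lambda>(l, T). \<langle>l, enc T\<rangle>) bs)" by force
    with A show ?thesis unfolding ds ExtCh
      using cclosedD[of _ "(T, \<rho>)" "(A, \<rho>)"]
      by (intro exI[of _ "(A, \<rho>) # ds'"]) (force simp: cd_def hstep_choice ExtCh)
  qed (use assms(1) ds in auto)
qed

text \<open>Only choices could have two steps with the same action, and validity makes their labels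
  distinct.\<close>

lemma hstep_det:
  assumes "is_head ds" "set ds \<subseteq> valid" "hstep (map cd ds) \<alpha> w" "hstep (map cd ds) \<alpha> w'"
  shows "w = w'"
proof -
  obtain T \<rho> ds' where ds: "ds = (T, \<rho>) # ds'"
    using assms(3) by (cases ds) (auto elim: hstep_NilE)
  have v: "okt (val T \<rho>)" using assms(2) by (auto simp: ds valid_def)
  have d: "A = B" if "distinct (map fst bs)" "(l, A) \<in> set bs" "(l, B) \<in> set bs"
    for bs :: "(nat \<times> stype) list" and l A B
    using that eq_key_imp_eq_value by fast
  have c: "map (fst \<circ> (\<lambda>(l, T). (l, val T \<rho>))) bs = map fst bs" for bs :: "(nat \<times> stype) list"
    by auto
  show ?thesis
    using assms(1,3,4) v unfolding ds
    by (cases T) (auto simp: cd_def c list_encode_eq elim!: hstep_ConsE intro!: arg_cong[where f=enc],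
        (blast intro: d)+)
qed

text \<open>A lookup leaves the value unchanged, so a variable weighs 1 more than the recursive type
  it refers to. The factor 3 exceeds the weight of the two variables that splitting a sequence may
  expose. Closures behind a head that is not terminated are left out because normalisation does not
  reach them.\<close>

fun msize :: "clo list \<Rightarrow> nat" where
  "msize [] = 0"
| "msize ((T, \<rho>) # cs) = 3 * hm (val T \<rho>) + (case T of Var _ \<Rightarrow> 1 | _ \<Rightarrow> 0) +
     (if terminated (val T \<rho>) then msize cs else 0)"

lemma hnf_exists: "set cs \<subseteq> valid \<Longrightarrow> \<exists>h. hnf (map cd cs) h"
proof (induction "msize cs" arbitrary: cs rule: less_induct)
  case less
  show ?case
  proof (cases cs)
    case Nil
    then show ?thesis using hnf_Nil by auto
  next
    case (Cons c cs')
    obtain T \<rho> where c: "c = (T, \<rho>)" by force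
    have C: "cs = (T, \<rho>) # cs'" using Cons c by simp
    have v: "(T, \<rho>) \<in> valid" "set cs' \<subseteq> valid" using less.prems C by auto
    note ch = cclosedD[OF cclosed_valid v(1)]
    have IH: "\<exists>h. hnf (map cd es) h" if "msize es < msize cs" "set es \<subseteq> valid" for es
      using less.hyps that by blast
    show ?thesis
    proof (cases T)
      case Skip
      have "\<exists>h. hnf (map cd cs') h" by (rule IH) (use v C Skip in auto)
      then show ?thesis unfolding C Skip by (auto simp: cd_def intro: hnf_skip)
    next
      case (Out b)
      then show ?thesis unfolding C by (auto simp: cd_def simp del: One_nat_def intro!: exI hnf_head)
    next
      case (In b)
      then show ?thesis unfolding C by (auto simp: cd_def simp del: One_nat_def intro!: exI hnf_head)
    next
      case (IntCh b)
      then show ?thesis unfolding C by (auto simp: cd_def simp del: One_nat_def intro!: exI hnf_head)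
    next
      case (ExtCh b)
      then show ?thesis unfolding C by (auto simp: cd_def simp del: One_nat_def intro!: exI hnf_head)
    next
      case (Seq A B)
      have "\<exists>h. hnf (map cd ((A, \<rho>) # (B, \<rho>) # cs')) h"
        by (rule IH) (use v ch C Seq in \<open>auto split: stype.splits\<close>)
      then show ?thesis unfolding C Seq by (auto simp: cd_def intro: hnf_seq)
    next
      case (Rec m A)
      obtain A' where A': "val (Rec m A) \<rho> = Rec m A'" "val A (Rec m A # \<rho>) = subst 0 (Rec m A') A'"
        using val_Rec by blast
      have "okt (Rec m A')" using v(1) A'(1) Rec by (auto simp: valid_def)
      then have "msize ((A, Rec m A # \<rho>) # cs') < msize cs"
        using A' hm_unfold terminated_unfold unfolding C Rec by (auto split: stype.splits)
      then have "\<exists>h. hnf (map cd ((A, Rec m A # \<rho>) # cs')) h"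
        by (rule IH) (use v ch Rec in auto)
      then show ?thesis unfolding C Rec by (auto simp: cd_def intro: hnf_rec)
    next
      case (Var i)
      show ?thesis
      proof (cases "i < length \<rho>")
        case True
        have "\<exists>m A. \<rho> ! i = Rec m A" using v(1) True by (auto simp: valid_def)
        then have "msize ((\<rho> ! i, drop (Suc i) \<rho>) # cs') < msize cs"
          using val_Var_bound[OF True] unfolding C Var by auto
        then have "\<exists>h. hnf (map cd ((\<rho> ! i, drop (Suc i) \<rho>) # cs')) h"
          by (rule IH) (use v ch Var True in auto)
        then obtain h where "hnf (map cd ((\<rho> ! i, drop (Suc i) \<rho>) # cs')) h" by blast
        then have "hnf (\<langle>map enc \<rho> ! i, list_encode (drop (Suc i) (map enc \<rho>))\<rangle> # map cd cs') h"
          using True by (simp add: cd_def drop_map)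
        from hnf_bound[OF _ this] True show ?thesis unfolding C Var by (auto simp: cd_def)
      next
        case False
        then have "length (map enc \<rho>) \<le> i" by simp
        from hnf_free[OF this, of "map cd cs'"] show ?thesis unfolding C Var by (auto simp: cd_def)
      qed
    qed
  qed
qed

lemma mstep_closures:
  assumes "mstep (map cd cs) \<alpha> w"
  shows "\<exists>a cs'. \<alpha> = acode a \<and> w = map cd cs' \<and> ftrans (F cs) a (F cs') \<and>
    (\<forall>C. cclosed C \<longrightarrow> set cs \<subseteq> C \<longrightarrow> set cs' \<subseteq> C)"
proof -
  obtain h where h: "hnf (map cd cs) h" "hstep h \<alpha> w" using assms by (auto simp: mstep_def)
  obtain ds where ds: "h = map cd ds" "is_head ds" "fsame (F cs) (F ds)"
    "\<forall>C. cclosed C \<longrightarrow> set cs \<subseteq> C \<longrightarrow> set ds \<subseteq> C" using hnf_closures[OF h(1) refl] by blast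
  obtain a cs' where c: "\<alpha> = acode a" "w = map cd cs'" "ftrans (F ds) a (F cs')"
    "\<forall>C. cclosed C \<longrightarrow> set ds \<subseteq> C \<longrightarrow> set cs' \<subseteq> C"
    using hstep_closures[OF ds(2)] h(2) ds(1) by blast
  have "ftrans (F cs) a (F cs')" using c(3) ds(3) by (simp add: fsame_def)
  with c(1,2,4) ds(4) show ?thesis by (intro exI[of _ a] exI[of _ cs']) simp
qed

lemma closures_mstep:
  assumes "set cs \<subseteq> valid" "ftrans (F cs) a s"
  shows "\<exists>cs'. mstep (map cd cs) (acode a) (map cd cs') \<and> s = F cs' \<and> set cs' \<subseteq> valid"
proof -
  obtain h where h: "hnf (map cd cs) h" using hnf_exists[OF assms(1)] by blast
  obtain ds where ds: "h = map cd ds" "is_head ds" "fsame (F cs) (F ds)" "set ds \<subseteq> valid"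
    using hnf_closures[OF h refl] cclosed_valid assms(1) by blast
  have "ftrans (F ds) a s" using assms(2) ds(3) by (simp add: fsame_def)
  from closures_hstep[OF ds(2) this] obtain cs' where
    c: "hstep (map cd ds) (acode a) (map cd cs')" "s = F cs'"
    "\<forall>C. cclosed C \<longrightarrow> set ds \<subseteq> C \<longrightarrow> set cs' \<subseteq> C" by blast
  have "mstep (map cd cs) (acode a) (map cd cs')" unfolding mstep_def using h c(1) ds(1) by blast
  with c(2,3) cclosed_valid ds(4) show ?thesis by (intro exI[of _ cs']) simp
qed

lemma mstep_det:
  assumes "set cs \<subseteq> valid" "mstep (map cd cs) \<alpha> w" "mstep (map cd cs) \<alpha> w'"
  shows "w = w'"
proof -
  obtain h where h: "hnf (map cd cs) h" "hstep h \<alpha> w" using assms(2) by (auto simp: mstep_def)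
  then have h': "hstep h \<alpha> w'" using assms(3) hnf_det by (auto simp: mstep_def)
  obtain ds where ds: "h = map cd ds" "is_head ds" "set ds \<subseteq> valid"
    using hnf_closures[OF h(1) refl] cclosed_valid assms(1) by blast
  show ?thesis using hstep_det[OF ds(2,3)] h(2) h' ds(1) by blast
qed

definition mnull :: "nat \<Rightarrow> bool" where "mnull X \<longleftrightarrow> hnf [X] []"

text \<open>On codes of no valid closure the choice may be arbitrary; on valid closures the step is
  unique and \<open>mdl_iff\<close> identifies it.\<close>

definition mdl :: "nat \<Rightarrow> nat \<Rightarrow> nat list option" where
  "mdl X a = (if \<exists>v. mstep [X] a v then Some (SOME v. mstep [X] a v) else None)"

interpretation M: bpa mnull mdl .

lemma mdl_iff: "c \<in> valid \<Longrightarrow> mdl (cd c) a = Some v \<longleftrightarrow> mstep [cd c] a v"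
  using mstep_det[of "[c]" a] someI_ex[of "mstep [cd c] a"] by (auto simp: mdl_def)

lemma st_iff: "set cs \<subseteq> valid \<Longrightarrow> M.st (map cd cs) a = Some v \<longleftrightarrow> mstep (map cd cs) a v"
proof (induction cs arbitrary: v)
  case Nil
  then show ?case by (auto simp: mstep_def elim: hnf_NilE hstep_NilE)
next
  case (Cons c cs)
  have c: "c \<in> valid" "set cs \<subseteq> valid" using Cons.prems by auto
  obtain h where h: "hnf [cd c] h" using hnf_exists[of "[c]"] c by auto
  show ?case
  proof (cases h)
    case Nil
    with h have "mnull (cd c)" by (simp add: mnull_def)
    with Nil h mstep_append_null[of "[cd c]" "map cd cs"] Cons.IH[OF c(2)] show ?thesis by simp
  next
    case (Cons x r)
    then have "\<not> mnull (cd c)" using h hnf_det by (auto simp: mnull_def)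
    then show ?thesis
      using mstep_append_head[of "[cd c]" x r "map cd cs"] h Cons mdl_iff[OF c(1)] by auto
  qed
qed

lemma nullw_iff: "M.nullw w \<longleftrightarrow> hnf w []"
proof (induction w)
  case Nil
  then show ?case by (simp add: hnf_Nil)
next
  case (Cons X w)
  have "hnf (X # w) [] \<longleftrightarrow> hnf [X] [] \<and> hnf w []"
    using hnf_append_Nil[of "[X]" w] by simp
  also have "\<dots> \<longleftrightarrow> mnull X \<and> M.nullw w" by (simp only: mnull_def[of X] Cons)
  finally show ?case by simp
qed

text \<open>Bisimilarity of types sees transitions only and identifies \<open>Skip\<close> with the
  empty choice, whereas \<approx> also observes nullness. With \<open>dead\<close> at the end no
  word is ever null, and the difference disappears.\<close>

definition dead :: nat where "dead = cd (IntCh [], [])"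

lemma dead_valid: "(IntCh [], []) \<in> valid"
  by (simp add: valid_def)

section \<open>Type equivalence as equivalence of machine words\<close>

lemma type_equiv_step:
  assumes "type_equiv T U" "trans T a T'"
  shows "\<exists>U'. trans U a U' \<and> type_equiv T' U'"
  using assms unfolding type_equiv_def bisimulation_def by metis

lemma type_equiv_sym: "type_equiv T U \<Longrightarrow> type_equiv U T"
proof -
  assume "type_equiv T U"
  then obtain R where "bisimulation R" "R T U" by (auto simp: type_equiv_def)
  then have "bisimulation (\<lambda>x y. R y x)" "(\<lambda>x y. R y x) U T" by (auto simp: bisimulation_def)
  then show ?thesis unfolding type_equiv_def by (intro exI[of _ "\<lambda>x y. R y x"]) blast
qed

theorem type_equiv_iff:
  assumes "okt T" "okt U"
  shows "type_equiv T U \<longleftrightarrow> M.eqv [cd (T, []), dead] [cd (U, []), dead]"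
proof -
  \<comment> \<open>Representation goes through the flattening, because residuals of a type and of a
    word agree only up to the bracketing of sequences and neutral occurrences of
    \<open>Skip\<close>.\<close>
  define rep where "rep w T \<longleftrightarrow>
    (\<exists>cs. w = map cd cs \<and> set cs \<subseteq> valid \<and> F cs = fl T @ [IntCh []])" for w T
  have rep_T: "rep [cd (T, []), dead] T" if "okt T" for T
    unfolding rep_def by (rule exI[of _ "[(T, []), (IntCh [], [])]"])
      (use that dead_valid in \<open>auto simp: dead_def valid_def\<close>)
  have rep_st: "\<exists>a T'. \<alpha> = acode a \<and> trans T a T' \<and> rep w' T'"
    if "rep w T" "M.st w \<alpha> = Some w'" for w T \<alpha> w'
  proof -
    obtain cs where cs: "w = map cd cs" "set cs \<subseteq> valid" "F cs = fl T @ [IntCh []]"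
      using \<open>rep w T\<close> by (auto simp: rep_def)
    then have "mstep (map cd cs) \<alpha> w'" using that st_iff by blast
    from mstep_closures[OF this] obtain a cs' where a: "\<alpha> = acode a" "w' = map cd cs'"
      "ftrans (F cs) a (F cs')" "set cs' \<subseteq> valid" using cclosed_valid cs(2) by blast
    then obtain T' where "trans T a T'" "F cs' = fl T' @ [IntCh []]"
      using cs(3) ftrans_bot by auto
    with a show ?thesis by (auto simp: rep_def)
  qed
  have rep_trans: "\<exists>w'. M.st w (acode a) = Some w' \<and> rep w' T'"
    if "rep w T" "trans T a T'" for w T a T'
  proof -
    obtain cs where cs: "w = map cd cs" "set cs \<subseteq> valid" "F cs = fl T @ [IntCh []]"
      using \<open>rep w T\<close> by (auto simp: rep_def)
    then have "ftrans (F cs) a (fl T' @ [IntCh []])" using that ftrans_bot by auto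
    from closures_mstep[OF cs(2) this] obtain cs' where
      m: "mstep (map cd cs) (acode a) (map cd cs')" "fl T' @ [IntCh []] = F cs'" "set cs' \<subseteq> valid"
      by blast
    have "M.st w (acode a) = Some (map cd cs')" using m(1) st_iff cs by blast
    moreover have "rep (map cd cs') T'" unfolding rep_def using m(2,3) by metis
    ultimately show ?thesis by blast
  qed
  have rep_nullw: "\<not> M.nullw w" if "rep w T" for w T
  proof
    assume "M.nullw w"
    then have n: "hnf w []" by (simp add: nullw_iff)
    obtain cs where cs: "w = map cd cs" "F cs = fl T @ [IntCh []]"
      using \<open>rep w T\<close> by (auto simp: rep_def)
    from hnf_closures[OF n cs(1)] have "fsame (F cs) []" by auto
    then show False by (simp add: fsame_def cs(2))
  qed
  have acode_inj: "acode a = acode b \<Longrightarrow> a = b" for a b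
    by (cases a; cases b) auto
  show ?thesis
  proof
    assume e: "M.eqv [cd (T, []), dead] [cd (U, []), dead]"
    define R where "R T U \<longleftrightarrow> (\<exists>w v. rep w T \<and> rep v U \<and> M.eqv w v)" for T U
    have sim: "\<exists>U'. trans U a U' \<and> R T' U'" if "R T U" "trans T a T'" for T U a T'
    proof -
      obtain w v where wv: "rep w T" "rep v U" "M.eqv w v" using \<open>R T U\<close> by (auto simp: R_def)
      obtain w' where w': "M.st w (acode a) = Some w'" "rep w' T'"
        using rep_trans[OF wv(1) \<open>trans T a T'\<close>] by blast
      with M.eqv_st[OF wv(3), of "acode a"] obtain v' where
        v': "M.st v (acode a) = Some v'" "M.eqv w' v'" by (cases "M.st v (acode a)") auto
      from rep_st[OF wv(2) v'(1)] obtain b U' where "acode a = acode b" "trans U b U'" "rep v' U'"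
        by blast
      then show ?thesis using w'(2) v'(2) acode_inj unfolding R_def by blast
    qed
    have "R U T" if "R T U" for T U using that M.eqv_sym unfolding R_def by blast
    then have "bisimulation R" unfolding bisimulation_def using sim by blast
    moreover have "R T U" unfolding R_def using rep_T assms e by blast
    ultimately show "type_equiv T U" unfolding type_equiv_def by blast
  next
    assume e: "type_equiv T U"
    define R where "R w v \<longleftrightarrow> (\<exists>T U. rep w T \<and> rep v U \<and> type_equiv T U)" for w v
    have sim: "\<exists>v'. M.st v \<alpha> = Some v' \<and> R w' v'" if "R w v" "M.st w \<alpha> = Some w'" for w v \<alpha> w'
    proof -
      obtain T U where TU: "rep w T" "rep v U" "type_equiv T U" using \<open>R w v\<close> by (auto simp: R_def)
      obtain a T' where a: "\<alpha> = acode a" "trans T a T'" "rep w' T'"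
        using rep_st[OF TU(1) \<open>M.st w \<alpha> = Some w'\<close>] by blast
      obtain U' where "trans U a U'" "type_equiv T' U'" using type_equiv_step[OF TU(3) a(2)] by blast
      with rep_trans[OF TU(2)] a show ?thesis unfolding R_def by blast
    qed
    have sym: "R v w" if "R w v" for w v using that type_equiv_sym unfolding R_def by blast
    show "M.eqv [cd (T, []), dead] [cd (U, []), dead]"
    proof (rule M.eqv_coinduct[where R=R])
      show "R [cd (T, []), dead] [cd (U, []), dead]" unfolding R_def using rep_T assms e by blast
    next
      fix w v assume R: "R w v"
      have "rel_option R (M.st w a) (M.st v a)" for a
      proof (cases "M.st w a")
        case None
        have "M.st v a = None"
        proof (rule ccontr)
          assume "M.st v a \<noteq> None"
          then obtain v' where "M.st v a = Some v'" by blast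
          from sim[OF sym[OF R] this] None show False by simp
        qed
        with None show ?thesis by simp
      next
        case (Some w')
        from sim[OF R this] Some show ?thesis by auto
      qed
      moreover have "\<not> M.nullw w" "\<not> M.nullw v" using R rep_nullw by (auto simp: R_def)
      ultimately show "M.nullw w = M.nullw v \<and> (\<forall>a. rel_option R (M.st w a) (M.st v a))" by blast
    qed
  qed
qed


section \<open>Certificates of equivalence\<close>

definition simulated :: "(nat list \<times> nat list) set \<Rightarrow> nat list \<Rightarrow> nat list \<Rightarrow> bool" where
  "simulated B h h' \<longleftrightarrow> (\<forall>a w. hstep h a w \<longrightarrow> (\<exists>w'. hstep h' a w' \<and> cong B w w'))"

text \<open>One step of expansion as in Caucal's self-bisimulations: the residuals need only be
  congruent modulo \<open>B\<close>, not themselves in \<open>B\<close>, which is what lets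
  \<open>B\<close> be finite.\<close>

definition checked :: "(nat list \<times> nat list) set \<Rightarrow> nat list \<Rightarrow> nat list \<Rightarrow> bool" where
  "checked B u v \<longleftrightarrow> (\<exists>h h'. hnf u h \<and> hnf v h' \<and> (h = [] \<longleftrightarrow> h' = []) \<and>
     simulated B h h' \<and> simulated B h' h)"

lemma checked_sym: "checked B u v \<Longrightarrow> checked B v u"
  unfolding checked_def by metis

lemma cong_append_right: "cong B w v \<Longrightarrow> cong B (w @ u) (v @ u)"
proof (induction rule: cong.induct)
  case (cong_base a b w)
  from cong.cong_base[OF this, of "w @ u"] show ?case by simp
qed (auto intro: cong.intros cong_refl)

lemma mstep_mono_checked:
  assumes "checked B u v" "mstep (u @ w) a u'"
  shows "\<exists>v'. mstep (v @ w) a v' \<and> cong B u' v'"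
proof -
  obtain h h' where h: "hnf u h" "hnf v h'" "h = [] \<longleftrightarrow> h' = []" "simulated B h h'"
    using assms(1) by (auto simp: checked_def)
  show ?thesis
  proof (cases h)
    case Nil
    then have "mstep w a u'" using mstep_append_null h(1) assms(2) by blast
    then have "mstep (v @ w) a u'" using mstep_append_null h(2,3) Nil by blast
    then show ?thesis using cong_refl by blast
  next
    case (Cons x r)
    then obtain y s where h': "h' = y # s" using h(3) by (cases h') auto
    obtain u1 where u1: "u' = u1 @ w" "mstep u a u1"
      using mstep_append_head[of u x r w a u'] h(1) Cons assms(2) by blast
    then have "hstep h a u1" using h(1) hnf_det unfolding mstep_def by blast
    then obtain v1 where v1: "hstep h' a v1" "cong B u1 v1" using h(4) by (auto simp: simulated_def)
    then have "mstep v a v1" using h(2) by (auto simp: mstep_def)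
    then have "mstep (v @ w) a (v1 @ w)"
      using mstep_append_head[of v y s w a] h(2) h' by blast
    then show ?thesis using v1(2) u1(1) cong_append_right by blast
  qed
qed

text \<open>Validity is not assumed, since the middle word of a \<open>cong_trans\<close> step may
  contain numbers that code no closure. Hence the relation \<open>mstep\<close> is used in place of
  \<open>M.st\<close>, and the case of a letter without head normal form arises.\<close>

lemma cong_mstep:
  assumes "\<And>u v. (u, v) \<in> B \<Longrightarrow> checked B u v"
  shows "cong B w v \<Longrightarrow> (hnf w [] \<longleftrightarrow> hnf v []) \<and>
    (\<forall>a w'. mstep w a w' \<longrightarrow> (\<exists>v'. mstep v a v' \<and> cong B w' v')) \<and>
    (\<forall>a v'. mstep v a v' \<longrightarrow> (\<exists>w'. mstep w a w' \<and> cong B w' v'))"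
proof (induction rule: cong.induct)
  case cong_Nil
  then show ?case using cong_refl by blast
next
  case (cong_sym w v)
  then show ?case using cong.cong_sym by blast
next
  case (cong_trans u w v)
  show ?case
  proof (intro conjI allI impI)
    show "hnf u [] \<longleftrightarrow> hnf v []" using cong_trans.IH by blast
  next
    fix a u' assume "mstep u a u'"
    then obtain w' where "mstep w a w'" "cong B u' w'" using cong_trans.IH(1) by blast
    moreover from this obtain v' where "mstep v a v'" "cong B w' v'" using cong_trans.IH(2) by blast
    ultimately show "\<exists>v'. mstep v a v' \<and> cong B u' v'" using cong.cong_trans by blast
  next
    fix a v' assume "mstep v a v'"
    then obtain w' where "mstep w a w'" "cong B w' v'" using cong_trans.IH(2) by blast
    moreover from this obtain u' where "mstep u a u'" "cong B u' w'" using cong_trans.IH(1) by blast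
    ultimately show "\<exists>u'. mstep u a u' \<and> cong B u' v'" using cong.cong_trans by blast
  qed
next
  case (cong_Cons w v X)
  have n: "hnf (X # w) [] \<longleftrightarrow> hnf (X # v) []"
    using cong_Cons.IH hnf_append_Nil[of "[X]" w] hnf_append_Nil[of "[X]" v] by simp
  consider "hnf [X] []" | x r where "hnf [X] (x # r)" | "\<nexists>h. hnf [X] h"
    by (metis neq_Nil_conv)
  then show ?case
  proof cases
    case 1
    then have "mstep (X # w) a u \<longleftrightarrow> mstep w a u" "mstep (X # v) a u \<longleftrightarrow> mstep v a u" for a u
      using mstep_append_null[of "[X]"] by simp_all
    with n cong_Cons.IH show ?thesis by simp
  next
    case 2
    have st: "mstep (X # w) a z \<longleftrightarrow> (\<exists>u. z = u @ w \<and> mstep [X] a u)"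
      "mstep (X # v) a z \<longleftrightarrow> (\<exists>u. z = u @ v \<and> mstep [X] a u)" for a z
      using mstep_append_head[OF 2, of w a z] mstep_append_head[OF 2, of v a z]
      by (simp_all only: append_Cons append_Nil)
    show ?thesis unfolding st
    proof (intro conjI allI impI n)
      fix a w' assume "\<exists>u. w' = u @ w \<and> mstep [X] a u"
      then obtain u where "w' = u @ w" "mstep [X] a u" by blast
      then show "\<exists>v'. (\<exists>u. v' = u @ v \<and> mstep [X] a u) \<and> cong B w' v'"
        using cong_append[OF cong_Cons.hyps, of u] by (intro exI[of _ "u @ v"]) auto
    next
      fix a v' assume "\<exists>u. v' = u @ v \<and> mstep [X] a u"
      then obtain u where "v' = u @ v" "mstep [X] a u" by blast
      then show "\<exists>w'. (\<exists>u. w' = u @ w \<and> mstep [X] a u) \<and> cong B w' v'"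
        using cong_append[OF cong_Cons.hyps, of u] by (intro exI[of _ "u @ w"]) auto
    qed
  next
    case 3
    then have "\<not> mstep (X # w) a u" "\<not> mstep (X # v) a u" for a u
      using mstep_append_stuck[of "[X]"] by simp_all
    with n show ?thesis by simp
  qed
next
  case (cong_base u v w)
  have c: "checked B u v" using assms cong_base by blast
  then have "hnf u [] \<longleftrightarrow> hnf v []" unfolding checked_def using hnf_det by blast
  then have "hnf (u @ w) [] \<longleftrightarrow> hnf (v @ w) []" by (simp add: hnf_append_Nil)
  moreover have "\<exists>u'. mstep (u @ w) a u' \<and> cong B u' v'" if "mstep (v @ w) a v'" for a v'
    using mstep_mono_checked[OF checked_sym[OF c] that] cong_sym by blast
  ultimately show ?case using mstep_mono_checked[OF c] by blast
qed

text \<open>Only the two outer words have to be valid. Steps preserve this, so \<open>mstep\<close>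
  and \<open>M.st\<close> agree on all pairs of \<open>R\<close>, whatever words the congruence
  passes through.\<close>

lemma cong_eqv:
  assumes B: "\<And>u v. (u, v) \<in> B \<Longrightarrow> checked B u v"
    and "cong B (map cd cs) (map cd ds)" "set cs \<subseteq> valid" "set ds \<subseteq> valid"
  shows "M.eqv (map cd cs) (map cd ds)"
proof -
  define vw where "vw w \<longleftrightarrow> (\<exists>cs. w = map cd cs \<and> set cs \<subseteq> valid)" for w
  have vw_step: "vw w'" if "vw w" "mstep w a w'" for w a w'
  proof -
    obtain cs where cs: "w = map cd cs" "set cs \<subseteq> valid" using \<open>vw w\<close> by (auto simp: vw_def)
    obtain b cs' where "w' = map cd cs'" "\<forall>C. cclosed C \<longrightarrow> set cs \<subseteq> C \<longrightarrow> set cs' \<subseteq> C"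
      using mstep_closures[of cs a w'] \<open>mstep w a w'\<close> cs(1) by blast
    then show ?thesis using cclosed_valid cs(2) by (auto simp: vw_def)
  qed
  have st: "M.st w a = Some v \<longleftrightarrow> mstep w a v" if "vw w" for w a v
    using that st_iff by (auto simp: vw_def)
  define R where "R w v \<longleftrightarrow> cong B w v \<and> vw w \<and> vw v" for w v
  have sim: "\<exists>v'. M.st v a = Some v' \<and> R w' v'" if "R w v" "M.st w a = Some w'" for w v a w'
  proof -
    have wv: "cong B w v" "vw w" "vw v" using \<open>R w v\<close> by (auto simp: R_def)
    have w': "mstep w a w'" using st[OF wv(2)] that(2) by blast
    then obtain v' where "mstep v a v'" "cong B w' v'" using cong_mstep[OF B wv(1)] by blast
    then show ?thesis using st[OF wv(3)] vw_step[OF wv(2) w'] vw_step[OF wv(3)] unfolding R_def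
      by blast
  qed
  have sym: "R v w" if "R w v" for w v using that cong_sym unfolding R_def by blast
  show ?thesis
  proof (rule M.eqv_coinduct[where R=R])
    show "R (map cd cs) (map cd ds)" unfolding R_def vw_def using assms(2-4) by blast
  next
    fix w v assume R: "R w v"
    have "rel_option R (M.st w a) (M.st v a)" for a
    proof (cases "M.st w a")
      case None
      have "M.st v a = None"
      proof (rule ccontr)
        assume "M.st v a \<noteq> None"
        then obtain v' where "M.st v a = Some v'" by blast
        from sim[OF sym[OF R] this] None show False by simp
      qed
      with None show ?thesis by simp
    next
      case (Some w')
      from sim[OF R this] Some show ?thesis by auto
    qed
    moreover have "M.nullw w = M.nullw v"
      using R cong_mstep[OF B] unfolding R_def nullw_iff by blast
    ultimately show "M.nullw w = M.nullw v \<and> (\<forall>a. rel_option R (M.st w a) (M.st v a))" by blast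
  qed
qed

lemma hstep_st:
  assumes "set cs \<subseteq> valid" "hnf (map cd cs) h"
  shows "hstep h a w \<longleftrightarrow> M.st (map cd cs) a = Some w"
  using st_iff[OF assms(1)] assms(2) hnf_det unfolding mstep_def by blast

text \<open>The witness is \<open>M.base\<close> over the codes of \<open>C\<close>. Residuals of
  equivalent words over a closed alphabet are again equivalent words over it, hence congruent by
  finite generation; this is the check that each pair has to pass.\<close>

theorem certificate_exists:
  assumes C: "finite C" "cclosed C" "C \<subseteq> valid"
  shows "\<exists>B. finite B \<and> (\<forall>(u, v)\<in>B. checked B u v) \<and>
    (\<forall>cs ds. set cs \<subseteq> C \<longrightarrow> set ds \<subseteq> C \<longrightarrow> M.eqv (map cd cs) (map cd ds) \<longrightarrow>
      cong B (map cd cs) (map cd ds))"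
proof -
  let ?G = "cd ` C"
  have word: "\<exists>cs. w = map cd cs \<and> set cs \<subseteq> C" if "set w \<subseteq> ?G" for w
    using that by (induction w) (auto, metis insert_subset list.set(2) list.simps(9))
  have cl: "M.closed ?G" unfolding M.closed_def
  proof (intro ballI allI impI)
    fix X a v assume X: "X \<in> ?G" "mdl X a = Some v"
    then obtain c where c: "X = cd c" "c \<in> C" by blast
    then have "mstep (map cd [c]) a v" using X(2) mdl_iff[of c a v] C(3) by auto
    from mstep_closures[OF this] obtain cs where "v = map cd cs" "set cs \<subseteq> C"
      using C(2) c(2) by auto
    then show "set v \<subseteq> ?G" by auto
  qed
  obtain N where N: "\<And>w v. set w \<subseteq> ?G \<Longrightarrow> set v \<subseteq> ?G \<Longrightarrow> M.eqv w v \<Longrightarrow> cong (M.base ?G N) w v"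
    using M.eqv_finitely_generated[OF finite_imageI[OF C(1)] cl] by blast
  let ?B = "M.base ?G N"
  have sim: "simulated ?B h h'"
    if uv: "M.eqv u v" "set u \<subseteq> ?G" "set v \<subseteq> ?G" "hnf u h" "hnf v h'" for u v h h'
    unfolding simulated_def
  proof (intro allI impI)
    fix a w assume "hstep h a w"
    obtain cs ds where cs: "u = map cd cs" "set cs \<subseteq> valid" and ds: "v = map cd ds" "set ds \<subseteq> valid"
      using word[OF uv(2)] word[OF uv(3)] C(3) by blast
    have w: "M.st u a = Some w"
      using hstep_st[OF cs(2)] uv(4) cs(1) \<open>hstep h a w\<close> by blast
    with M.eqv_st[OF uv(1), of a] obtain w' where w': "M.st v a = Some w'" "M.eqv w w'"
      by (cases "M.st v a") auto
    then have "hstep h' a w'" using hstep_st[OF ds(2)] uv(5) ds(1) by blast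
    moreover have "cong ?B w w'"
      by (rule N[OF M.closed_st[OF cl uv(2) w] M.closed_st[OF cl uv(3) w'(1)] w'(2)])
    ultimately show "\<exists>w'. hstep h' a w' \<and> cong ?B w w'" by blast
  qed
  have "checked ?B u v" if "(u, v) \<in> ?B" for u v
  proof -
    have uv: "M.eqv u v" "set u \<subseteq> ?G" "set v \<subseteq> ?G" using that by (auto simp: M.base_def)
    obtain cs ds where "u = map cd cs" "set cs \<subseteq> valid" "v = map cd ds" "set ds \<subseteq> valid"
      using word[OF uv(2)] word[OF uv(3)] C(3) by blast
    then obtain h h' where h: "hnf u h" "hnf v h'" using hnf_exists by blast
    have "h = [] \<longleftrightarrow> h' = []"
      using M.eqv_nullw[OF uv(1)] h hnf_det unfolding nullw_iff by blast
    moreover have "simulated ?B h h'" "simulated ?B h' h"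
      using sim[OF uv h] sim[OF M.eqv_sym[OF uv(1)] uv(3,2) h(2,1)] by blast+
    ultimately show ?thesis unfolding checked_def using h by blast
  qed
  moreover have "finite ?B" using M.finite_base[OF finite_imageI[OF C(1)]] .
  moreover have "cong ?B (map cd cs) (map cd ds)"
    if "set cs \<subseteq> C" "set ds \<subseteq> C" "M.eqv (map cd cs) (map cd ds)" for cs ds
    by (rule N) (use that in auto)
  ultimately show ?thesis by (intro exI[of _ ?B]) auto
qed

lemma no_step_dead: "mdl dead a = None" "\<not> mnull dead"
proof -
  have d: "hnf [dead] [dead]"
    unfolding dead_def cd_def by (auto simp: simp del: One_nat_def intro!: hnf_head)
  have dc: "dead = \<langle>\<langle>3, 0\<rangle>, 0\<rangle>" by (simp add: dead_def cd_def)
  have "\<not> hstep [dead] a v" for a v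
  proof
    assume "hstep [dead] a v"
    then show False
    proof cases
      case (hstep_single c b \<rho>)
      then show ?thesis unfolding dc by auto
    next
      case (hstep_choice c l t bs \<rho>)
      from hstep_choice(1) have "list_encode bs = 0" unfolding dc by simp
      then have "bs = []" by (simp add: list_encode_eq_0)
      with hstep_choice(5) show ?thesis by simp
    qed
  qed
  then have "\<not> mstep [dead] a v" for a v unfolding mstep_def using d hnf_det by blast
  then show "mdl dead a = None" by (simp add: mdl_def)
  show "\<not> mnull dead" unfolding mnull_def using d hnf_det by blast
qed

text \<open>Behind \<open>dead\<close> no run ends in a null word, so observations can differ only
  in whether a run exists. This is the difference that derivations of tag 21 exhibit.\<close>

lemma not_eqv_run:
  assumes "\<not> M.eqv [X, dead] [Y, dead]"
  shows "\<exists>xs. (M.run [X, dead] xs = None) \<noteq> (M.run [Y, dead] xs = None)"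
proof -
  have dead: "M.run [dead] zs = Some z \<Longrightarrow> z = [dead]" for zs z
    by (cases zs) (auto simp: no_step_dead)
  have nn: "\<not> M.nullw z" if r: "M.run [X, dead] xs = Some z" for X xs z
  proof -
    have "M.run ([X] @ [dead]) xs = Some z" using r by simp
    from M.run_append_split[OF this] obtain u where "z = u @ [dead]"
      using dead by (metis append_Nil)
    then show ?thesis using no_step_dead(2) by simp
  qed
  obtain xs where "M.obs [X, dead] xs \<noteq> M.obs [Y, dead] xs"
    using assms by (auto simp: M.eqv_def)
  then show ?thesis
    using nn[of X xs] nn[of Y xs]
    by (intro exI[of _ xs]) (cases "M.run [X, dead] xs"; cases "M.run [Y, dead] xs"; auto simp: M.obs_def)
qed


section \<open>The decision procedure as a Horn program\<close>

abbreviation (input) "pcons x s \<equiv> PS (PP x s)"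
abbreviation (input) "pnil \<equiv> PC 0"
abbreviation (input) "ptag n p \<equiv> PP (PC n) p"
abbreviation (input) "pdead \<equiv> PP (PP (PC 3) (PC 0)) (PC 0)"

text \<open>A fact is a tagged tuple of numbers; \<open>holds_simps\<close> below says what each tag means.\<close>
definition prog_neq_nat :: "(pat \<times> pat list) list" where
  "prog_neq_nat = [
    (ptag 10 (PP (PC 0) (PS (PV 0))), []),
    (ptag 10 (PP (PS (PV 0)) (PC 0)), []),
    (ptag 10 (PP (PS (PV 0)) (PS (PV 1))), [ptag 10 (PP (PV 0) (PV 1))])]"

definition prog_lookup :: "(pat \<times> pat list) list" where
  "prog_lookup = [
    (ptag 11 (PP (PC 0) (PP (pcons (PV 0) (PV 1)) (PP (PV 0) (PV 1)))), []),
    (ptag 11 (PP (PS (PV 0)) (PP (pcons (PV 1) (PV 2)) (PV 3))), [ptag 11 (PP (PV 0) (PP (PV 2) (PV 3)))]),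
    (ptag 12 (PP (PV 0) (PP pnil (PV 0))), []),
    (ptag 12 (PP (PS (PV 0)) (PP (pcons (PV 1) (PV 2)) (PV 3))), [ptag 12 (PP (PV 0) (PP (PV 2) (PV 3)))])]"

definition prog_hnf :: "(pat \<times> pat list) list" where
  "prog_hnf = [
    (ptag 13 (PP pnil pnil), []),
    (ptag 13 (PP (pcons (PP (PP (PC 0) (PC 0)) (PV 0)) (PV 1)) (PV 2)), [ptag 13 (PP (PV 1) (PV 2))]),
    (ptag 13 (PP (pcons (PP (ptag 5 (PP (PV 0) (PV 1))) (PV 2)) (PV 3)) (PV 4)),
      [ptag 13 (PP (pcons (PP (PV 0) (PV 2)) (pcons (PP (PV 1) (PV 2)) (PV 3))) (PV 4))]),
    (ptag 13 (PP (pcons (PP (ptag 6 (PP (PV 0) (PV 1))) (PV 2)) (PV 3)) (PV 4)),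
      [ptag 13 (PP (pcons (PP (PV 1) (pcons (ptag 6 (PP (PV 0) (PV 1))) (PV 2))) (PV 3)) (PV 4))]),
    (ptag 13 (PP (pcons (PP (ptag 7 (PV 0)) (PV 1)) (PV 2)) (PV 3)),
      [ptag 11 (PP (PV 0) (PP (PV 1) (PV 4))), ptag 13 (PP (pcons (PV 4) (PV 2)) (PV 3))]),
    (ptag 13 (PP (pcons (PP (ptag 7 (PV 0)) (PV 1)) (PV 2)) (pcons (PP (ptag 7 (PV 3)) (PC 0)) (PV 2))),
      [ptag 12 (PP (PV 0) (PP (PV 1) (PV 3)))])]"

definition prog_head :: "nat \<Rightarrow> (pat \<times> pat list) list" where
  "prog_head c = [
    (ptag 13 (PP (pcons (PP (ptag c (PV 0)) (PV 1)) (PV 2)) (pcons (PP (ptag c (PV 0)) (PV 1)) (PV 2))), [])]"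

text \<open>Horn clauses have no negation, so the absence of a step (tag 15) gets clauses of its
  own, which rest on inequality of numbers (tag 10).\<close>

definition prog_single :: "nat \<Rightarrow> (pat \<times> pat list) list" where
  "prog_single c = [
    (ptag 14 (PP (pcons (PP (ptag c (PV 0)) (PV 1)) (PV 2)) (PP (ptag c (PV 0)) (PV 2))), []),
    (ptag 15 (PP (pcons (PP (ptag c (PV 0)) (PV 1)) (PV 2)) (ptag c (PV 3))), [ptag 10 (PP (PV 0) (PV 3))]),
    (ptag 19 (PP (PV 0) (PP (pcons (PP (ptag c (PV 1)) (PV 2)) (PV 3)) (PV 4))),
      [ptag 14 (PP (PV 4) (PP (ptag c (PV 1)) (PV 5))), ptag 18 (PP (PV 0) (PP (PV 3) (PV 5)))])]"

text \<open>The universal quantifiers in tags 15 and 19 become recursion over the branches: a choice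
  with its first branch removed is treated as a choice again.\<close>

definition prog_choice :: "nat \<Rightarrow> (pat \<times> pat list) list" where
  "prog_choice c = [
    (ptag 14 (PP (pcons (PP (ptag c (pcons (PP (PV 0) (PV 1)) (PV 2))) (PV 3)) (PV 4))
      (PP (ptag c (PV 0)) (pcons (PP (PV 1) (PV 3)) (PV 4)))), []),
    (ptag 14 (PP (pcons (PP (ptag c (pcons (PV 0) (PV 1))) (PV 2)) (PV 3)) (PP (PV 4) (PV 5))),
      [ptag 14 (PP (pcons (PP (ptag c (PV 1)) (PV 2)) (PV 3)) (PP (PV 4) (PV 5)))]),
    (ptag 15 (PP (pcons (PP (ptag c pnil) (PV 0)) (PV 1)) (PV 2)), []),
    (ptag 15 (PP (pcons (PP (ptag c (pcons (PP (PV 0) (PV 1)) (PV 2))) (PV 3)) (PV 4)) (PP (PV 5) (PV 6))),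
      [ptag 10 (PP (PV 0) (PV 6)),
       ptag 15 (PP (pcons (PP (ptag c (PV 2)) (PV 3)) (PV 4)) (PP (PV 5) (PV 6)))]),
    (ptag 19 (PP (PV 0) (PP (pcons (PP (ptag c pnil) (PV 1)) (PV 2)) (PV 3))), []),
    (ptag 19 (PP (PV 0) (PP (pcons (PP (ptag c (pcons (PP (PV 1) (PV 2)) (PV 3))) (PV 4)) (PV 5)) (PV 6))),
      [ptag 14 (PP (PV 6) (PP (ptag c (PV 1)) (PV 7))),
       ptag 18 (PP (PV 0) (PP (pcons (PP (PV 2) (PV 4)) (PV 5)) (PV 7))),
       ptag 19 (PP (PV 0) (PP (pcons (PP (ptag c (PV 3)) (PV 4)) (PV 5)) (PV 6)))])]"

definition prog_nil :: "(pat \<times> pat list) list" where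
  "prog_nil = [
    (ptag 15 (PP pnil (PV 0)), []),
    (ptag 15 (PP (pcons (PP (PP (PV 0) (PV 1)) (PV 2)) (PV 3)) (PP (PV 4) (PV 5))),
      [ptag 10 (PP (PV 0) (PV 4))]),
    (ptag 19 (PP (PV 0) (PP pnil (PV 1))), [])]"

definition prog_list :: "(pat \<times> pat list) list" where
  "prog_list = [
    (ptag 16 (PP (PV 0) (pcons (PV 0) (PV 1))), []),
    (ptag 16 (PP (PV 0) (pcons (PV 1) (PV 2))), [ptag 16 (PP (PV 0) (PV 2))]),
    (ptag 17 (PP pnil (PP (PV 0) (PV 0))), []),
    (ptag 17 (PP (pcons (PV 0) (PV 1)) (PP (PV 2) (pcons (PV 0) (PV 3)))),
      [ptag 17 (PP (PV 1) (PP (PV 2) (PV 3)))])]"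

definition prog_cong :: "(pat \<times> pat list) list" where
  "prog_cong = [
    (ptag 18 (PP (PV 0) (PP pnil pnil)), []),
    (ptag 18 (PP (PV 0) (PP (PV 1) (PV 2))), [ptag 18 (PP (PV 0) (PP (PV 2) (PV 1)))]),
    (ptag 18 (PP (PV 0) (PP (PV 1) (PV 2))),
      [ptag 18 (PP (PV 0) (PP (PV 1) (PV 3))), ptag 18 (PP (PV 0) (PP (PV 3) (PV 2)))]),
    (ptag 18 (PP (PV 0) (PP (pcons (PV 1) (PV 2)) (pcons (PV 1) (PV 3)))),
      [ptag 18 (PP (PV 0) (PP (PV 2) (PV 3)))]),
    (ptag 18 (PP (PV 0) (PP (PV 4) (PV 5))),
      [ptag 16 (PP (PP (PV 1) (PV 2)) (PV 0)), ptag 17 (PP (PV 1) (PP (PV 3) (PV 4))),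
       ptag 17 (PP (PV 2) (PP (PV 3) (PV 5)))])]"

text \<open>The first component is the whole set, which generates the congruence; the second is the
  part still to be checked. The two coincide when \<open>prog_answer\<close> starts the
  check.\<close>

definition prog_check :: "(pat \<times> pat list) list" where
  "prog_check = [
    (ptag 20 (PP (PV 0) pnil), []),
    (ptag 20 (PP (PV 0) (pcons (PP (PV 1) (PV 2)) (PV 3))),
      [ptag 13 (PP (PV 1) pnil), ptag 13 (PP (PV 2) pnil), ptag 20 (PP (PV 0) (PV 3))]),
    (ptag 20 (PP (PV 0) (pcons (PP (PV 1) (PV 2)) (PV 3))),
      [ptag 13 (PP (PV 1) (pcons (PV 4) (PV 5))), ptag 13 (PP (PV 2) (pcons (PV 6) (PV 7))),
       ptag 19 (PP (PV 0) (PP (pcons (PV 4) (PV 5)) (pcons (PV 6) (PV 7)))),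
       ptag 19 (PP (PV 0) (PP (pcons (PV 6) (PV 7)) (pcons (PV 4) (PV 5)))),
       ptag 20 (PP (PV 0) (PV 3))])]"

definition prog_differ :: "(pat \<times> pat list) list" where
  "prog_differ = [
    (ptag 21 (PP (PV 0) (PV 1)), [ptag 21 (PP (PV 1) (PV 0))]),
    (ptag 21 (PP (PV 0) (PV 1)),
      [ptag 13 (PP (PV 0) (PV 2)), ptag 13 (PP (PV 1) (PV 3)),
       ptag 14 (PP (PV 2) (PP (PV 4) (PV 5))), ptag 15 (PP (PV 3) (PV 4))]),
    (ptag 21 (PP (PV 0) (PV 1)),
      [ptag 13 (PP (PV 0) (PV 2)), ptag 13 (PP (PV 1) (PV 3)),
       ptag 14 (PP (PV 2) (PP (PV 4) (PV 5))), ptag 14 (PP (PV 3) (PP (PV 4) (PV 6))),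
       ptag 21 (PP (PV 5) (PV 6))])]"

definition prog_answer :: "(pat \<times> pat list) list" where
  "prog_answer = [
    (ptag 22 (PP (PV 0) (PP (PV 1) (PC 1))),
      [ptag 20 (PP (PV 2) (PV 2)),
       ptag 18 (PP (PV 2) (PP (pcons (PP (PV 0) (PC 0)) (pcons pdead pnil))
         (pcons (PP (PV 1) (PC 0)) (pcons pdead pnil))))]),
    (ptag 22 (PP (PV 0) (PP (PV 1) (PC 0))),
      [ptag 21 (PP (pcons (PP (PV 0) (PC 0)) (pcons pdead pnil))
         (pcons (PP (PV 1) (PC 0)) (pcons pdead pnil)))])]"

definition program :: "(pat \<times> pat list) list" where
  "program = prog_neq_nat @ prog_lookup @ prog_hnf @
    prog_head 1 @ prog_head 2 @ prog_head 3 @ prog_head 4 @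
    prog_single 1 @ prog_single 2 @ prog_single 7 @ prog_choice 3 @ prog_choice 4 @ prog_nil @
    prog_list @ prog_cong @ prog_check @ prog_differ @ prog_answer"

definition pairs :: "nat \<Rightarrow> (nat list \<times> nat list) set" where
  "pairs B = (\<lambda>p. (list_decode (fst (prod_decode p)), list_decode (snd (prod_decode p)))) ` set (list_decode B)"

text \<open>Clauses apply to arbitrary numbers, while \<open>M.st\<close> is tied to machine steps
  only on valid words. Making the claim vacuous elsewhere keeps it sound.\<close>

definition differ :: "nat list \<Rightarrow> nat list \<Rightarrow> bool" where
  "differ w v \<longleftrightarrow> (\<forall>cs ds. w = map cd cs \<longrightarrow> set cs \<subseteq> valid \<longrightarrow> v = map cd ds \<longrightarrow> set ds \<subseteq> valid \<longrightarrow>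
     \<not> M.eqv w v)"

text \<open>The intended model of the program. Soundness means that it is closed under every clause
  and so contains all derivable facts.\<close>

definition sem :: "nat \<Rightarrow> nat \<Rightarrow> nat \<Rightarrow> nat \<Rightarrow> nat \<Rightarrow> bool" where
  "sem k x y y1 y2 = (
    if k = 10 then x \<noteq> y
    else if k = 11 then x < length (list_decode y1) \<and>
      y2 = \<langle>list_decode y1 ! x, list_encode (drop (Suc x) (list_decode y1))\<rangle>
    else if k = 12 then length (list_decode y1) \<le> x \<and> y2 = x - length (list_decode y1)
    else if k = 13 then hnf (list_decode x) (list_decode y)
    else if k = 14 then hstep (list_decode x) y1 (list_decode y2)
    else if k = 15 then \<forall>w. \<not> hstep (list_decode x) y w
    else if k = 16 then x \<in> set (list_decode y)
    else if k = 17 then list_decode y2 = list_decode x @ list_decode y1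
    else if k = 18 then cong (pairs x) (list_decode y1) (list_decode y2)
    else if k = 19 then simulated (pairs x) (list_decode y1) (list_decode y2)
    else if k = 20 then \<forall>(u, v)\<in>pairs y. checked (pairs x) u v
    else if k = 21 then differ (list_decode x) (list_decode y)
    else if k = 22 then \<forall>T U. x = enc T \<longrightarrow> y1 = enc U \<longrightarrow> okt T \<longrightarrow> okt U \<longrightarrow>
      y2 = (if type_equiv T U then 1 else 0)
    else True)"

definition holds :: "nat \<Rightarrow> bool" where
  "holds n = (let x = snd (prod_decode n); y = snd (prod_decode x) in
    sem (fst (prod_decode n)) (fst (prod_decode x)) y (fst (prod_decode y)) (snd (prod_decode y)))"

lemma holds_simps [simp]:
  "holds \<langle>10, \<langle>i, j\<rangle>\<rangle> \<longleftrightarrow> i \<noteq> j"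
  "holds \<langle>11, \<langle>i, \<langle>r, x\<rangle>\<rangle>\<rangle> \<longleftrightarrow> i < length (list_decode r) \<and>
     x = \<langle>list_decode r ! i, list_encode (drop (Suc i) (list_decode r))\<rangle>"
  "holds \<langle>12, \<langle>i, \<langle>r, x\<rangle>\<rangle>\<rangle> \<longleftrightarrow> length (list_decode r) \<le> i \<and> x = i - length (list_decode r)"
  "holds \<langle>13, \<langle>u, h\<rangle>\<rangle> \<longleftrightarrow> hnf (list_decode u) (list_decode h)"
  "holds \<langle>14, \<langle>h, \<langle>a, w\<rangle>\<rangle>\<rangle> \<longleftrightarrow> hstep (list_decode h) a (list_decode w)"
  "holds \<langle>15, \<langle>h, a\<rangle>\<rangle> \<longleftrightarrow> (\<forall>w. \<not> hstep (list_decode h) a w)"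
  "holds \<langle>16, \<langle>x, b\<rangle>\<rangle> \<longleftrightarrow> x \<in> set (list_decode b)"
  "holds \<langle>17, \<langle>u, \<langle>v, w\<rangle>\<rangle>\<rangle> \<longleftrightarrow> list_decode w = list_decode u @ list_decode v"
  "holds \<langle>18, \<langle>b, \<langle>u, v\<rangle>\<rangle>\<rangle> \<longleftrightarrow> cong (pairs b) (list_decode u) (list_decode v)"
  "holds \<langle>19, \<langle>b, \<langle>u, v\<rangle>\<rangle>\<rangle> \<longleftrightarrow> simulated (pairs b) (list_decode u) (list_decode v)"
  "holds \<langle>20, \<langle>b, b'\<rangle>\<rangle> \<longleftrightarrow> (\<forall>(u, v)\<in>pairs b'. checked (pairs b) u v)"
  "holds \<langle>21, \<langle>u, v\<rangle>\<rangle> \<longleftrightarrow> differ (list_decode u) (list_decode v)"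
  "holds \<langle>22, \<langle>t, \<langle>u, b\<rangle>\<rangle>\<rangle> \<longleftrightarrow> (\<forall>T U. t = enc T \<longrightarrow> u = enc U \<longrightarrow> okt T \<longrightarrow> okt U \<longrightarrow>
      b = (if type_equiv T U then 1 else 0))"
  by (simp_all add: holds_def sem_def)

section \<open>Soundness: the intended model satisfies every clause\<close>

lemma hstep_single_iff: "c \<in> {1, 2, 7} \<Longrightarrow> hstep (\<langle>\<langle>c, b\<rangle>, \<rho>\<rangle> # s) a w \<longleftrightarrow> a = \<langle>c, b\<rangle> \<and> w = s"
  using hstep_single by (auto elim!: hstep_ConsE)

lemma hstep_choice_iff: "c \<in> {3, 4} \<Longrightarrow> hstep (\<langle>\<langle>c, bs\<rangle>, \<rho>\<rangle> # s) a w \<longleftrightarrow>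
    (\<exists>l t. \<langle>l, t\<rangle> \<in> set (list_decode bs) \<and> a = \<langle>c, l\<rangle> \<and> w = \<langle>t, \<rho>\<rangle> # s)"
proof
  assume "hstep (\<langle>\<langle>c, bs\<rangle>, \<rho>\<rangle> # s) a w" "c \<in> {3, 4}"
  then show "\<exists>l t. \<langle>l, t\<rangle> \<in> set (list_decode bs) \<and> a = \<langle>c, l\<rangle> \<and> w = \<langle>t, \<rho>\<rangle> # s"
    by (auto elim!: hstep_ConsE)
next
  assume "\<exists>l t. \<langle>l, t\<rangle> \<in> set (list_decode bs) \<and> a = \<langle>c, l\<rangle> \<and> w = \<langle>t, \<rho>\<rangle> # s" "c \<in> {3, 4}"
  then show "hstep (\<langle>\<langle>c, bs\<rangle>, \<rho>\<rangle> # s) a w"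
    using hstep_choice[of c _ _ "list_decode bs"] by auto
qed

lemma hstep_tag: "hstep (\<langle>\<langle>c, p\<rangle>, \<rho>\<rangle> # s) \<langle>d, n\<rangle> w \<Longrightarrow> c = d"
  by (auto elim!: hstep_ConsE)

lemma pairs_simps [simp]: "pairs 0 = {}"
  "pairs (Suc \<langle>\<langle>u, v\<rangle>, b\<rangle>) = insert (list_decode u, list_decode v) (pairs b)"
  by (simp_all add: pairs_def)

lemma differ_sym: "differ u v \<Longrightarrow> differ v u"
  unfolding differ_def using M.eqv_sym by blast

lemma differ_action:
  assumes "hnf u h" "hnf v h'" "hstep h a w" "\<forall>w. \<not> hstep h' a w"
  shows "differ u v"
  unfolding differ_def
proof (intro allI impI notI)
  fix cs ds assume cs: "u = map cd cs" "set cs \<subseteq> valid" "v = map cd ds" "set ds \<subseteq> valid" "M.eqv u v"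
  have "M.st u a = Some w" using hstep_st[OF cs(2)] assms(1,3) cs(1) by blast
  then obtain w' where "M.st v a = Some w'"
    using M.eqv_st[OF cs(5), of a] by (cases "M.st v a") auto
  then have "hstep h' a w'" using hstep_st[OF cs(4)] assms(2) cs(3) by blast
  with assms(4) show False by blast
qed

lemma differ_step:
  assumes "hnf u h" "hnf v h'" "hstep h a w" "hstep h' a w'" "differ w w'"
  shows "differ u v"
  unfolding differ_def
proof (intro allI impI notI)
  fix cs ds assume cs: "u = map cd cs" "set cs \<subseteq> valid" "v = map cd ds" "set ds \<subseteq> valid" "M.eqv u v"
  have st: "M.st u a = Some w" "M.st v a = Some w'"
    using hstep_st[OF cs(2)] hstep_st[OF cs(4)] assms(1-4) cs(1,3) by blast+
  then have e: "M.eqv w w'" using M.eqv_st[OF cs(5), of a] by simp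
  have m: "mstep (map cd cs) a w" "mstep (map cd ds) a w'"
    using assms(1-4) cs(1,3) unfolding mstep_def by blast+
  obtain cs' where w: "w = map cd cs'" "\<forall>C. cclosed C \<longrightarrow> set cs \<subseteq> C \<longrightarrow> set cs' \<subseteq> C"
    using mstep_closures[OF m(1)] by blast
  obtain ds' where w': "w' = map cd ds'" "\<forall>C. cclosed C \<longrightarrow> set ds \<subseteq> C \<longrightarrow> set ds' \<subseteq> C"
    using mstep_closures[OF m(2)] by blast
  have "set cs' \<subseteq> valid" "set ds' \<subseteq> valid" using w(2) w'(2) cclosed_valid cs(2,4) by simp_all
  with w(1) w'(1) assms(5) e show False unfolding differ_def by blast
qed

lemma sound_neq_nat:
  "(c, ps) \<in> set prog_neq_nat \<Longrightarrow> \<forall>p\<in>set ps. holds (pval \<sigma> p) \<Longrightarrow> holds (pval \<sigma> c)"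
  unfolding prog_neq_nat_def by auto

lemma sound_lookup:
  "(c, ps) \<in> set prog_lookup \<Longrightarrow> \<forall>p\<in>set ps. holds (pval \<sigma> p) \<Longrightarrow> holds (pval \<sigma> c)"
  unfolding prog_lookup_def by auto

lemma sound_hnf:
  "(c, ps) \<in> set prog_hnf \<Longrightarrow> \<forall>p\<in>set ps. holds (pval \<sigma> p) \<Longrightarrow> holds (pval \<sigma> c)"
  unfolding prog_hnf_def
  using hnf_bound[of _ "list_decode (\<sigma> 1)"] hnf_free[of "list_decode (\<sigma> 1)"]
  by (auto intro: hnf_Nil hnf_skip hnf_seq hnf_rec)

lemma sound_head:
  "(c, ps) \<in> set (prog_head k) \<Longrightarrow> k \<in> {1, 2, 3, 4} \<Longrightarrow> \<forall>p\<in>set ps. holds (pval \<sigma> p) \<Longrightarrow>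
    holds (pval \<sigma> c)"
  unfolding prog_head_def using hnf_head[of k] by auto

lemma sound_single:
  "(c, ps) \<in> set (prog_single k) \<Longrightarrow> k \<in> {1, 2, 7} \<Longrightarrow> \<forall>p\<in>set ps. holds (pval \<sigma> p) \<Longrightarrow>
    holds (pval \<sigma> c)"
  using hstep_single_iff[of k] unfolding prog_single_def by (auto simp: simulated_def)

lemma sound_choice:
  "(c, ps) \<in> set (prog_choice k) \<Longrightarrow> k \<in> {3, 4} \<Longrightarrow> \<forall>p\<in>set ps. holds (pval \<sigma> p) \<Longrightarrow>
    holds (pval \<sigma> c)"
  using hstep_choice_iff[of k] unfolding prog_choice_def by (auto simp: simulated_def)

lemma sound_nil:
  "(c, ps) \<in> set prog_nil \<Longrightarrow> \<forall>p\<in>set ps. holds (pval \<sigma> p) \<Longrightarrow> holds (pval \<sigma> c)"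
  unfolding prog_nil_def by (auto simp: simulated_def dest: hstep_tag elim: hstep_NilE)

lemma sound_list:
  "(c, ps) \<in> set prog_list \<Longrightarrow> \<forall>p\<in>set ps. holds (pval \<sigma> p) \<Longrightarrow> holds (pval \<sigma> c)"
  unfolding prog_list_def by auto

lemma pairsI: "\<langle>u, v\<rangle> \<in> set (list_decode b) \<Longrightarrow> (list_decode u, list_decode v) \<in> pairs b"
  unfolding pairs_def by force

lemma sound_cong:
  "(c, ps) \<in> set prog_cong \<Longrightarrow> \<forall>p\<in>set ps. holds (pval \<sigma> p) \<Longrightarrow> holds (pval \<sigma> c)"
  unfolding prog_cong_def
  by (simp, elim disjE; clarsimp)
    (rule cong_Nil, erule cong_sym, erule (1) cong_trans, erule cong_Cons, erule cong_base[OF pairsI])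

lemma sound_check:
  "(c, ps) \<in> set prog_check \<Longrightarrow> \<forall>p\<in>set ps. holds (pval \<sigma> p) \<Longrightarrow> holds (pval \<sigma> c)"
proof -
  have "checked B u v" if "hnf u []" "hnf v []" for B u v
    unfolding checked_def using that by (auto simp: simulated_def elim: hstep_NilE)
  moreover have "checked B u v"
    if "hnf u (x # r)" "hnf v (y # s)" "simulated B (x # r) (y # s)" "simulated B (y # s) (x # r)"
    for B u v x r y s
    unfolding checked_def using that by blast
  ultimately show "(c, ps) \<in> set prog_check \<Longrightarrow> \<forall>p\<in>set ps. holds (pval \<sigma> p) \<Longrightarrow> holds (pval \<sigma> c)"
    unfolding prog_check_def by auto
qed

lemma sound_differ:
  "(c, ps) \<in> set prog_differ \<Longrightarrow> \<forall>p\<in>set ps. holds (pval \<sigma> p) \<Longrightarrow> holds (pval \<sigma> c)"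
  unfolding prog_differ_def
  by (auto intro: differ_sym differ_action differ_step)

lemma sound_answer:
  "(c, ps) \<in> set prog_answer \<Longrightarrow> \<forall>p\<in>set ps. holds (pval \<sigma> p) \<Longrightarrow> holds (pval \<sigma> c)"
proof -
  define W :: "stype \<Rightarrow> clo list" where "W T = [(T, []), (IntCh [], [])]" for T
  have W: "map cd (W T) = [\<langle>enc T, 0\<rangle>, \<langle>\<langle>3, 0\<rangle>, 0\<rangle>]" "map cd (W T) = [cd (T, []), dead]" for T
    by (simp_all add: W_def cd_def dead_def)
  have v: "set (W T) \<subseteq> valid" if "okt T" for T
    using that by (simp add: W_def valid_def)
  have "type_equiv T U" if "okt T" "okt U" "\<forall>(u, v)\<in>pairs b. checked (pairs b) u v"
    "cong (pairs b) [\<langle>enc T, 0\<rangle>, \<langle>\<langle>3, 0\<rangle>, 0\<rangle>] [\<langle>enc U, 0\<rangle>, \<langle>\<langle>3, 0\<rangle>, 0\<rangle>]" for T U b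
    using cong_eqv[of "pairs b" "W T" "W U"] v that type_equiv_iff[OF that(1,2)] W by fastforce
  moreover have "\<not> type_equiv T U" if "okt T" "okt U"
    "differ [\<langle>enc T, 0\<rangle>, \<langle>\<langle>3, 0\<rangle>, 0\<rangle>] [\<langle>enc U, 0\<rangle>, \<langle>\<langle>3, 0\<rangle>, 0\<rangle>]" for T U
    using that(3) v[OF that(1)] v[OF that(2)] type_equiv_iff[OF that(1,2)] W unfolding differ_def
    by metis
  ultimately show "(c, ps) \<in> set prog_answer \<Longrightarrow> \<forall>p\<in>set ps. holds (pval \<sigma> p) \<Longrightarrow> holds (pval \<sigma> c)"
    unfolding prog_answer_def by auto
qed

theorem program_sound: "horn program n \<Longrightarrow> holds n"
proof (induction rule: horn.induct)
  case (1 c ps \<sigma>)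
  then have h: "\<forall>p\<in>set ps. holds (pval \<sigma> p)" by blast
  from 1(1) consider "(c, ps) \<in> set prog_neq_nat" | "(c, ps) \<in> set prog_lookup"
    | "(c, ps) \<in> set prog_hnf" | k where "(c, ps) \<in> set (prog_head k)" "k \<in> {1, 2, 3, 4}"
    | k where "(c, ps) \<in> set (prog_single k)" "k \<in> {1, 2, 7}"
    | k where "(c, ps) \<in> set (prog_choice k)" "k \<in> {3, 4}"
    | "(c, ps) \<in> set prog_nil" | "(c, ps) \<in> set prog_list" | "(c, ps) \<in> set prog_cong"
    | "(c, ps) \<in> set prog_check" | "(c, ps) \<in> set prog_differ" | "(c, ps) \<in> set prog_answer"
    unfolding program_def set_append Un_iff by blast
  then show ?case
  proof cases
    case 1
    show ?thesis by (rule sound_neq_nat[OF 1 h])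
  next
    case 2
    show ?thesis by (rule sound_lookup[OF 2 h])
  next
    case 3
    show ?thesis by (rule sound_hnf[OF 3 h])
  next
    case 4
    show ?thesis by (rule sound_head[OF 4 h])
  next
    case 5
    show ?thesis by (rule sound_single[OF 5 h])
  next
    case 6
    show ?thesis by (rule sound_choice[OF 6 h])
  next
    case 7
    show ?thesis by (rule sound_nil[OF 7 h])
  next
    case 8
    show ?thesis by (rule sound_list[OF 8 h])
  next
    case 9
    show ?thesis by (rule sound_cong[OF 9 h])
  next
    case 10
    show ?thesis by (rule sound_check[OF 10 h])
  next
    case 11
    show ?thesis by (rule sound_differ[OF 11 h])
  next
    case 12
    show ?thesis by (rule sound_answer[OF 12 h])
  qed
qed


section \<open>Completeness: derivations of the required facts\<close>

lemma hornI:
  assumes "set k \<subseteq> set program" "i < length k" "n = pval ((!) vs) (fst (k ! i))"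
    "\<forall>p\<in>set (snd (k ! i)). horn program (pval ((!) vs) p)"
  shows "horn program n"
  unfolding assms(3)
  by (rule horn.intros[OF _ assms(4)]) (use assms(1,2) nth_mem in force)

lemma program_subsets:
  "set prog_neq_nat \<subseteq> set program" "set prog_lookup \<subseteq> set program" "set prog_hnf \<subseteq> set program"
  "c \<in> {1, 2, 3, 4} \<Longrightarrow> set (prog_head c) \<subseteq> set program"
  "c \<in> {1, 2, 7} \<Longrightarrow> set (prog_single c) \<subseteq> set program"
  "c \<in> {3, 4} \<Longrightarrow> set (prog_choice c) \<subseteq> set program"
  "set prog_nil \<subseteq> set program" "set prog_list \<subseteq> set program" "set prog_cong \<subseteq> set program"
  "set prog_check \<subseteq> set program" "set prog_differ \<subseteq> set program" "set prog_answer \<subseteq> set program"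
  unfolding program_def by auto

text \<open>In applications of these rules \<open>i\<close> selects the clause within its list, and
  \<open>vs\<close> lists the values of the variables \<open>PV 0\<close>, \<open>PV 1\<close>, and
  so on.\<close>

lemmas neq_natI = hornI[OF program_subsets(1), unfolded prog_neq_nat_def]
lemmas lookupI = hornI[OF program_subsets(2), unfolded prog_lookup_def]
lemmas hnfI = hornI[OF program_subsets(3), unfolded prog_hnf_def]
lemmas headI = hornI[OF program_subsets(4), unfolded prog_head_def]
lemmas singleI = hornI[OF program_subsets(5), unfolded prog_single_def]
lemmas choiceI = hornI[OF program_subsets(6), unfolded prog_choice_def]
lemmas nilI = hornI[OF program_subsets(7), unfolded prog_nil_def]
lemmas listI = hornI[OF program_subsets(8), unfolded prog_list_def]
lemmas congI = hornI[OF program_subsets(9), unfolded prog_cong_def]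
lemmas checkI = hornI[OF program_subsets(10), unfolded prog_check_def]
lemmas differI = hornI[OF program_subsets(11), unfolded prog_differ_def]
lemmas answerI = hornI[OF program_subsets(12), unfolded prog_answer_def]

abbreviation "H k x \<equiv> horn program \<langle>k, x\<rangle>"

lemma H_neq_nat: "i \<noteq> j \<Longrightarrow> H 10 \<langle>i, j\<rangle>"
proof (induction i arbitrary: j)
  case 0
  then obtain j' where "j = Suc j'" by (cases j) auto
  then show ?case by (intro neq_natI[where i=0 and vs="[j']"]) simp_all
next
  case (Suc i)
  show ?case
  proof (cases j)
    case 0
    then show ?thesis by (intro neq_natI[where i=1 and vs="[i]"]) simp_all
  next
    case (Suc j')
    with Suc.prems Suc.IH[of j'] show ?thesis
      by (intro neq_natI[where i=2 and vs="[i, j']"]) simp_all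
  qed
qed

lemma H_bound: "i < length rs \<Longrightarrow>
    H 11 \<langle>i, \<langle>list_encode rs, \<langle>rs ! i, list_encode (drop (Suc i) rs)\<rangle>\<rangle>\<rangle>"
proof (induction rs arbitrary: i)
  case (Cons r rs)
  show ?case
  proof (cases i)
    case 0
    then show ?thesis by (intro lookupI[where i=0 and vs="[r, list_encode rs]"]) simp_all
  next
    case (Suc j)
    with Cons.prems Cons.IH[of j] show ?thesis
      by (intro lookupI[where i=1 and
          vs="[j, r, list_encode rs, \<langle>rs ! j, list_encode (drop (Suc j) rs)\<rangle>]"]) simp_all
  qed
qed simp

lemma H_free: "length rs \<le> i \<Longrightarrow> H 12 \<langle>i, \<langle>list_encode rs, i - length rs\<rangle>\<rangle>"
proof (induction rs arbitrary: i)
  case Nil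
  then show ?case by (intro lookupI[where i=2 and vs="[i]"]) simp_all
next
  case (Cons r rs)
  then obtain j where "i = Suc j" "length rs \<le> j" by (cases i) auto
  with Cons.IH[of j] show ?case
    by (intro lookupI[where i=3 and vs="[j, r, list_encode rs, j - length rs]"]) simp_all
qed

lemma H_hnf: "hnf w h \<Longrightarrow> H 13 \<langle>list_encode w, list_encode h\<rangle>"
proof (induction rule: hnf.induct)
  case hnf_Nil
  then show ?case by (intro hnfI[where i=0 and vs="[]"]) simp_all
next
  case (hnf_skip s h \<rho>)
  then show ?case by (intro hnfI[where i=1 and vs="[\<rho>, list_encode s, list_encode h]"]) simp_all
next
  case (hnf_head c p \<rho> s)
  then show ?case
    by (intro headI[where c=c and i=0 and vs="[p, \<rho>, list_encode s]"]) simp_all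
next
  case (hnf_seq t \<rho> u s h)
  then show ?case
    by (intro hnfI[where i=2 and vs="[t, u, \<rho>, list_encode s, list_encode h]"]) simp_all
next
  case (hnf_rec t m \<rho> s h)
  then show ?case
    by (intro hnfI[where i=3 and vs="[m, t, \<rho>, list_encode s, list_encode h]"]) simp_all
next
  case (hnf_bound i rs s h)
  then show ?case using H_bound[OF hnf_bound(1)]
    by (intro hnfI[where i=4 and vs="[i, list_encode rs, list_encode s, list_encode h,
        \<langle>rs ! i, list_encode (drop (Suc i) rs)\<rangle>]"]) simp_all
next
  case (hnf_free rs i s)
  then show ?case using H_free[OF hnf_free(1)]
    by (intro hnfI[where i=5 and vs="[i, list_encode rs, list_encode s, i - length rs]"]) simp_all
qed

text \<open>The clauses for tags 15 and 19 cover heads of these shapes only, so completeness for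
  them is confined to head normal forms.\<close>

lemma hnf_shape: "hnf w h \<Longrightarrow> h = [] \<or> (\<exists>c p \<rho> s. h = \<langle>\<langle>c, p\<rangle>, \<rho>\<rangle> # s \<and> (c \<in> {1, 2, 7} \<or> c \<in> {3, 4}))"
  by (induction rule: hnf.induct) auto

lemma H_hstep: "hstep h a w \<Longrightarrow> H 14 \<langle>list_encode h, \<langle>a, list_encode w\<rangle>\<rangle>"
proof (induction rule: hstep.induct)
  case (hstep_single c b \<rho> s)
  then show ?case by (intro singleI[where c=c and i=0 and vs="[b, \<rho>, list_encode s]"]) simp_all
next
  case (hstep_choice c l t bs \<rho> s)
  from hstep_choice(2) show ?case
  proof (induction bs)
    case (Cons x bs)
    show ?case
    proof (cases "x = \<langle>l, t\<rangle>")
      case True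
      then show ?thesis using hstep_choice(1)
        by (intro choiceI[where c=c and i=0 and vs="[l, t, list_encode bs, \<rho>, list_encode s]"]) simp_all
    next
      case False
      with Cons have "H 14 \<langle>list_encode (\<langle>\<langle>c, list_encode bs\<rangle>, \<rho>\<rangle> # s),
          \<langle>\<langle>c, l\<rangle>, list_encode (\<langle>t, \<rho>\<rangle> # s)\<rangle>\<rangle>" by simp
      then show ?thesis using hstep_choice(1)
        by (intro choiceI[where c=c and i=1 and vs="[x, list_encode bs, \<rho>, list_encode s,
            \<langle>c, l\<rangle>, list_encode (\<langle>t, \<rho>\<rangle> # s)]"]) simp_all
    qed
  qed simp
qed

lemma H_no_hstep:
  assumes "hnf v h" "\<And>w. \<not> hstep h a w"
  shows "H 15 \<langle>list_encode h, a\<rangle>"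
  using hnf_shape[OF assms(1)]
proof (elim disjE exE conjE)
  assume "h = []"
  then show ?thesis by (intro nilI[where i=0 and vs="[a]"]) simp_all
next
  fix c p \<rho> s
  assume h: "h = \<langle>\<langle>c, p\<rangle>, \<rho>\<rangle> # s" and c: "c \<in> {1, 2, 7}"
  obtain d n where a: "a = \<langle>d, n\<rangle>" by (metis prod_decode_inverse surj_pair)
  show ?thesis
  proof (cases "c = d")
    case True
    then have "p \<noteq> n" using assms(2) c by (auto simp: h a hstep_single_iff)
    then have "H 10 \<langle>p, n\<rangle>" by (rule H_neq_nat)
    then show ?thesis unfolding h a using True c
      by (intro singleI[where c=c and i=1 and vs="[p, \<rho>, list_encode s, n]"]) simp_all
  next
    case False
    then have "H 10 \<langle>c, d\<rangle>" by (rule H_neq_nat)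
    then show ?thesis unfolding h a
      by (intro nilI[where i=1 and vs="[c, p, \<rho>, list_encode s, d, n]"]) simp_all
  qed
next
  fix c p \<rho> s
  assume h: "h = \<langle>\<langle>c, p\<rangle>, \<rho>\<rangle> # s" and c: "c \<in> {3, 4}"
  obtain d n where a: "a = \<langle>d, n\<rangle>" by (metis prod_decode_inverse surj_pair)
  show ?thesis
  proof (cases "c = d")
    case True
    have "\<And>l t. \<langle>l, t\<rangle> \<in> set (list_decode p) \<Longrightarrow> l \<noteq> n"
      using assms(2) c True by (auto simp: h a hstep_choice_iff)
    then have "H 15 \<langle>list_encode (\<langle>\<langle>c, list_encode (list_decode p)\<rangle>, \<rho>\<rangle> # s), \<langle>d, n\<rangle>\<rangle>"
    proof (induction "list_decode p" arbitrary: p)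
      case Nil
      then show ?case using c
        by (intro choiceI[where c=c and i=2 and vs="[\<rho>, list_encode s, \<langle>d, n\<rangle>]"]) simp_all
    next
      case (Cons x bs)
      obtain l t where x: "x = \<langle>l, t\<rangle>" by (metis prod_decode_inverse surj_pair)
      have p: "list_decode p = x # bs" using Cons.hyps(2) by simp
      have "H 15 \<langle>list_encode (\<langle>\<langle>c, list_encode (list_decode (list_encode bs))\<rangle>, \<rho>\<rangle> # s), \<langle>d, n\<rangle>\<rangle>"
        by (rule Cons.hyps(1)) (use Cons.prems p in auto)
      moreover have "H 10 \<langle>l, n\<rangle>" by (rule H_neq_nat) (use Cons.prems[of l t] p x in auto)
      ultimately show ?case unfolding p x using c
        by (intro choiceI[where c=c and i=3 and
            vs="[l, t, list_encode bs, \<rho>, list_encode s, d, n]"]) simp_all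
    qed
    then show ?thesis by (simp add: h a)
  next
    case False
    then have "H 10 \<langle>c, d\<rangle>" by (rule H_neq_nat)
    then show ?thesis unfolding h a
      by (intro nilI[where i=1 and vs="[c, p, \<rho>, list_encode s, d, n]"]) simp_all
  qed
qed

lemma H_mem: "x \<in> set bs \<Longrightarrow> H 16 \<langle>x, list_encode bs\<rangle>"
proof (induction bs)
  case (Cons y bs)
  show ?case
  proof (cases "x = y")
    case True
    then show ?thesis by (intro listI[where i=0 and vs="[x, list_encode bs]"]) simp_all
  next
    case False
    with Cons show ?thesis by (intro listI[where i=1 and vs="[x, y, list_encode bs]"]) simp_all
  qed
qed simp

lemma H_append: "H 17 \<langle>list_encode u, \<langle>list_encode v, list_encode (u @ v)\<rangle>\<rangle>"
proof (induction u)
  case Nil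
  then show ?case by (intro listI[where i=2 and vs="[list_encode v]"]) simp_all
next
  case (Cons x u)
  then show ?case
    by (intro listI[where i=3 and vs="[x, list_encode u, list_encode v, list_encode (u @ v)]"]) simp_all
qed

lemma H_cong: "cong (pairs b) w v \<Longrightarrow> H 18 \<langle>b, \<langle>list_encode w, list_encode v\<rangle>\<rangle>"
proof (induction rule: cong.induct)
  case cong_Nil
  then show ?case by (intro congI[where i=0 and vs="[b]"]) simp_all
next
  case (cong_sym w v)
  then show ?case by (intro congI[where i=1 and vs="[b, list_encode v, list_encode w]"]) simp_all
next
  case (cong_trans u w v)
  then show ?case
    by (intro congI[where i=2 and vs="[b, list_encode u, list_encode v, list_encode w]"]) simp_all
next
  case (cong_Cons w v x)
  then show ?case
    by (intro congI[where i=3 and vs="[b, x, list_encode w, list_encode v]"]) simp_all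
next
  case (cong_base u v w)
  then obtain p where p: "p \<in> set (list_decode b)"
    "u = list_decode (fst (prod_decode p))" "v = list_decode (snd (prod_decode p))"
    by (auto simp: pairs_def)
  then have "H 16 \<langle>\<langle>list_encode u, list_encode v\<rangle>, b\<rangle>"
    using H_mem[OF p(1)] by simp
  with H_append[of u w] H_append[of v w] show ?case
    by (intro congI[where i=4 and vs="[b, list_encode u, list_encode v, list_encode w,
        list_encode (u @ w), list_encode (v @ w)]"]) simp_all
qed

lemma H_simulated:
  assumes "hnf v h" "simulated (pairs b) h h'"
  shows "H 19 \<langle>b, \<langle>list_encode h, list_encode h'\<rangle>\<rangle>"
  using hnf_shape[OF assms(1)]
proof (elim disjE exE conjE)
  assume "h = []"
  then show ?thesis by (intro nilI[where i=2 and vs="[b, list_encode h']"]) simp_all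
next
  fix c p \<rho> s
  assume h: "h = \<langle>\<langle>c, p\<rangle>, \<rho>\<rangle> # s" and c: "c \<in> {1, 2, 7}"
  have "hstep h \<langle>c, p\<rangle> s" unfolding h by (rule hstep_single[OF c])
  then obtain w where "hstep h' \<langle>c, p\<rangle> w" "cong (pairs b) s w"
    using assms(2) by (auto simp: simulated_def)
  from H_hstep[OF this(1)] H_cong[OF this(2)] c show ?thesis unfolding h
    by (intro singleI[where c=c and i=2 and
        vs="[b, p, \<rho>, list_encode s, list_encode h', list_encode w]"]) simp_all
next
  fix c p \<rho> s
  assume h: "h = \<langle>\<langle>c, p\<rangle>, \<rho>\<rangle> # s" and c: "c \<in> {3, 4}"
  have "\<And>l t. \<langle>l, t\<rangle> \<in> set (list_decode p) \<Longrightarrow>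
      \<exists>w. hstep h' \<langle>c, l\<rangle> w \<and> cong (pairs b) (\<langle>t, \<rho>\<rangle> # s) w"
    using assms(2) hstep_choice_iff[OF c, of p \<rho> s] unfolding simulated_def h by blast
  then have "H 19 \<langle>b, \<langle>list_encode (\<langle>\<langle>c, list_encode (list_decode p)\<rangle>, \<rho>\<rangle> # s), list_encode h'\<rangle>\<rangle>"
  proof (induction "list_decode p" arbitrary: p)
    case Nil
    then show ?case using c
      by (intro choiceI[where c=c and i=4 and vs="[b, \<rho>, list_encode s, list_encode h']"]) simp_all
  next
    case (Cons x bs)
    obtain l t where x: "x = \<langle>l, t\<rangle>" by (metis prod_decode_inverse surj_pair)
    have p: "list_decode p = x # bs" using Cons.hyps(2) by simp
    have IH: "H 19 \<langle>b, \<langle>list_encode (\<langle>\<langle>c, list_encode (list_decode (list_encode bs))\<rangle>, \<rho>\<rangle> # s),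
        list_encode h'\<rangle>\<rangle>"
      by (rule Cons.hyps(1)) (use Cons.prems p in auto)
    have "\<langle>l, t\<rangle> \<in> set (list_decode p)" using p x by simp
    from Cons.prems[OF this] obtain w where
      "hstep h' \<langle>c, l\<rangle> w" "cong (pairs b) (\<langle>t, \<rho>\<rangle> # s) w" by blast
    from H_hstep[OF this(1)] H_cong[OF this(2)] IH show ?case unfolding p x using c
      by (intro choiceI[where c=c and i=5 and vs="[b, l, t, list_encode bs, \<rho>, list_encode s,
          list_encode h', list_encode w]"]) simp_all
  qed
  then show ?thesis by (simp add: h)
qed

lemma H_check: "\<forall>(u, v)\<in>pairs b'. checked (pairs b) u v \<Longrightarrow> H 20 \<langle>b, b'\<rangle>"
proof (induction "list_decode b'" arbitrary: b')
  case Nil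
  then have "b' = 0" by (metis list_decode_inverse list_encode.simps(1))
  then show ?case by (intro checkI[where i=0 and vs="[b]"]) simp_all
next
  case (Cons x bs)
  obtain u v where x: "x = \<langle>list_encode u, list_encode v\<rangle>"
    by (metis prod_decode_inverse surj_pair list_decode_inverse)
  have b': "b' = Suc \<langle>\<langle>list_encode u, list_encode v\<rangle>, list_encode bs\<rangle>"
    using Cons.hyps(2) x by (metis list_decode_inverse list_encode.simps(2))
  have IH: "H 20 \<langle>b, list_encode bs\<rangle>"
    by (rule Cons.hyps(1)) (use Cons.prems b' in auto)
  have "checked (pairs b) u v" using Cons.prems b' by simp
  then obtain h h' where h: "hnf u h" "hnf v h'" "h = [] \<longleftrightarrow> h' = []" "simulated (pairs b) h h'"
    "simulated (pairs b) h' h" by (auto simp: checked_def)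
  show ?case
  proof (cases h)
    case Nil
    with h(3) have "h' = []" by simp
    with Nil H_hnf[OF h(1)] H_hnf[OF h(2)] IH show ?thesis unfolding b'
      by (intro checkI[where i=1 and vs="[b, list_encode u, list_encode v, list_encode bs]"]) simp_all
  next
    case (Cons y r)
    with h(3) obtain z s where h': "h' = z # s" by (cases h') auto
    from H_hnf[OF h(1)] H_hnf[OF h(2)] H_simulated[OF h(1,4)] H_simulated[OF h(2,5)] IH
    show ?thesis unfolding b' Cons h'
      by (intro checkI[where i=2 and vs="[b, list_encode u, list_encode v, list_encode bs,
          y, list_encode r, z, list_encode s]"]) simp_all
  qed
qed

text \<open>Follows the run up to the first action that exactly one of the words can perform. The
  auxiliary fact \<open>one\<close> fixes which word moves; the symmetry clause of tag 21 gives the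
  other case.\<close>

lemma H_differ:
  "set cs \<subseteq> valid \<Longrightarrow> set ds \<subseteq> valid \<Longrightarrow>
    (M.run (map cd cs) xs = None) \<noteq> (M.run (map cd ds) xs = None) \<Longrightarrow>
    H 21 \<langle>list_encode (map cd cs), list_encode (map cd ds)\<rangle>"
proof (induction xs arbitrary: cs ds)
  case (Cons a xs)
  have one: "H 21 \<langle>list_encode (map cd cs), list_encode (map cd ds)\<rangle>"
    if v: "set cs \<subseteq> valid" "set ds \<subseteq> valid"
      and s: "M.st (map cd cs) a = Some w" "M.st (map cd ds) a = None" for cs ds w
  proof -
    obtain h h' where h: "hnf (map cd cs) h" "hnf (map cd ds) h'" using hnf_exists v by blast
    have "hstep h a w" "\<And>w. \<not> hstep h' a w"
      using s hstep_st[OF v(1) h(1)] hstep_st[OF v(2) h(2)] by auto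
    from H_hstep[OF this(1)] H_no_hstep[OF h(2) this(2)] H_hnf[OF h(1)] H_hnf[OF h(2)]
    show ?thesis
      by (intro differI[where i=1 and vs="[list_encode (map cd cs), list_encode (map cd ds),
          list_encode h, list_encode h', a, list_encode w]"]) simp_all
  qed
  show ?case
  proof (cases "M.st (map cd cs) a")
    case None
    with Cons.prems(3) obtain w where "M.st (map cd ds) a = Some w"
      by (cases "M.st (map cd ds) a") auto
    from one[OF Cons.prems(2,1) this None] show ?thesis
      by (intro differI[where i=0 and vs="[list_encode (map cd cs), list_encode (map cd ds)]"]) simp_all
  next
    case w: (Some w)
    show ?thesis
    proof (cases "M.st (map cd ds) a")
      case None
      from one[OF Cons.prems(1,2) w None] show ?thesis .
    next
      case w': (Some w')
      have m: "mstep (map cd cs) a w" "mstep (map cd ds) a w'"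
        using w w' st_iff Cons.prems(1,2) by blast+
      obtain cs' where c: "w = map cd cs'" "\<forall>C. cclosed C \<longrightarrow> set cs \<subseteq> C \<longrightarrow> set cs' \<subseteq> C"
        using mstep_closures[OF m(1)] by blast
      obtain ds' where d: "w' = map cd ds'" "\<forall>C. cclosed C \<longrightarrow> set ds \<subseteq> C \<longrightarrow> set ds' \<subseteq> C"
        using mstep_closures[OF m(2)] by blast
      have "set cs' \<subseteq> valid" "set ds' \<subseteq> valid"
        using c(2) d(2) cclosed_valid Cons.prems(1,2) by simp_all
      then have IH: "H 21 \<langle>list_encode w, list_encode w'\<rangle>"
        unfolding c(1) d(1) by (rule Cons.IH) (use Cons.prems(3) w w' c(1) d(1) in simp)
      obtain h h' where h: "hnf (map cd cs) h" "hnf (map cd ds) h'"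
        using hnf_exists Cons.prems(1,2) by blast
      have "hstep h a w" "hstep h' a w'"
        using w w' hstep_st[OF Cons.prems(1) h(1)] hstep_st[OF Cons.prems(2) h(2)] by auto
      from H_hstep[OF this(1)] H_hstep[OF this(2)] H_hnf[OF h(1)] H_hnf[OF h(2)] IH
      show ?thesis
        by (intro differI[where i=2 and vs="[list_encode (map cd cs), list_encode (map cd ds),
            list_encode h, list_encode h', a, list_encode w, list_encode w']"]) simp_all
    qed
  qed
qed simp

lemma H_answer_yes:
  assumes "okt T" "okt U" "type_equiv T U"
  shows "H 22 \<langle>enc T, \<langle>enc U, 1\<rangle>\<rangle>"
proof -
  \<comment> \<open>Both words end in the dead choice, so its closure belongs to the alphabet
    too.\<close>
  let ?C = "cl T [] \<union> (cl U [] \<union> cl (IntCh []) [])"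
  define W :: "stype \<Rightarrow> clo list" where "W T = [(T, []), (IntCh [], [])]" for T
  have W: "map cd (W T) = [\<langle>enc T, 0\<rangle>, \<langle>\<langle>3, 0\<rangle>, 0\<rangle>]" "map cd (W T) = [cd (T, []), dead]" for T
    by (simp_all add: W_def cd_def dead_def)
  have "(T, []) \<in> valid" "(U, []) \<in> valid" using assms(1,2) by (simp_all add: valid_def)
  then have "cl T [] \<subseteq> valid" "cl U [] \<subseteq> valid" "cl (IntCh []) [] \<subseteq> valid"
    using dead_valid by (simp_all only: cl_subset[OF cclosed_valid])
  then have C: "finite ?C" "cclosed ?C" "?C \<subseteq> valid"
    by (simp_all only: finite_Un finite_cl cclosed_Un cclosed_cl Un_subset_iff)
  obtain B where B: "finite B" "\<forall>(u, v)\<in>B. checked B u v"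
    "\<And>cs ds. set cs \<subseteq> ?C \<Longrightarrow> set ds \<subseteq> ?C \<Longrightarrow> M.eqv (map cd cs) (map cd ds) \<Longrightarrow>
      cong B (map cd cs) (map cd ds)"
    using certificate_exists[OF C] by blast
  from finite_list[OF finite_imageI[OF B(1), of "\<lambda>p. \<langle>list_encode (fst p), list_encode (snd p)\<rangle>"]]
  obtain bs where bs: "set bs = (\<lambda>p. \<langle>list_encode (fst p), list_encode (snd p)\<rangle>) ` B" ..
  define b where "b = list_encode bs"
  have b: "pairs b = B"
    by (simp add: pairs_def b_def list_encode_inverse bs image_image)
  have "cong B (map cd (W T)) (map cd (W U))"
    using assms type_equiv_iff[OF assms(1,2)] cl_refl[of T "[]"] cl_refl[of U "[]"]
    by (intro B(3)) (auto simp: W_def dead_def)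
  then have "cong (pairs b) [\<langle>enc T, 0\<rangle>, \<langle>\<langle>3, 0\<rangle>, 0\<rangle>] [\<langle>enc U, 0\<rangle>, \<langle>\<langle>3, 0\<rangle>, 0\<rangle>]"
    unfolding b W .
  from H_cong[OF this] H_check[of b b] B(2) b show ?thesis
    by (intro answerI[where i=0 and vs="[enc T, enc U, b]"]) simp_all
qed

lemma H_answer_no:
  assumes "okt T" "okt U" "\<not> type_equiv T U"
  shows "H 22 \<langle>enc T, \<langle>enc U, 0\<rangle>\<rangle>"
proof -
  define W :: "stype \<Rightarrow> clo list" where "W T = [(T, []), (IntCh [], [])]" for T
  have W: "map cd (W T) = [\<langle>enc T, 0\<rangle>, \<langle>\<langle>3, 0\<rangle>, 0\<rangle>]" "map cd (W T) = [cd (T, []), dead]" for T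
    by (simp_all add: W_def cd_def dead_def)
  have "\<not> M.eqv [cd (T, []), dead] [cd (U, []), dead]" using type_equiv_iff assms by blast
  then obtain xs where "(M.run [cd (T, []), dead] xs = None) \<noteq> (M.run [cd (U, []), dead] xs = None)"
    using not_eqv_run by blast
  moreover have "set (W T) \<subseteq> valid" "set (W U) \<subseteq> valid"
    using assms(1,2) by (auto simp: W_def valid_def)
  ultimately have "H 21 \<langle>list_encode (map cd (W T)), list_encode (map cd (W U))\<rangle>"
    using H_differ[of "W T" "W U" xs] W(2) by simp
  then show ?thesis unfolding W(1)
    by (intro answerI[where i=1 and vs="[enc T, enc U]"]) simp_all
qed

theorem mainTheorem7:
  shows "\<exists>f :: recf. \<forall>\<Delta> m T U. kinding \<Delta> T m \<longrightarrow> kinding \<Delta> U m \<longrightarrow>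
           eval f [enc T, enc U] (if type_equiv T U then 1 else 0)"
proof -
  obtain f where f: "\<forall>x y b. H 22 \<langle>x, \<langle>y, b\<rangle>\<rangle> \<longrightarrow> (\<forall>b'. H 22 \<langle>x, \<langle>y, b'\<rangle>\<rangle> \<longrightarrow> b' = b) \<longrightarrow>
      eval f [x, y] b"
    using horn_decision[of program 22] by blast
  have "eval f [enc T, enc U] (if type_equiv T U then 1 else 0)"
    if "kinding \<Delta> T m" "kinding \<Delta> U m" for \<Delta> m T U
  proof -
    have ok: "okt T" "okt U" using that kinding_okt by blast+
    have "H 22 \<langle>enc T, \<langle>enc U, if type_equiv T U then 1 else 0\<rangle>\<rangle>"
      using H_answer_yes[OF ok] H_answer_no[OF ok] by simp
    \<comment> \<open>Soundness supplies the uniqueness that \<open>horn_decision\<close> asks for: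
      every derivable answer is the true one.\<close>
    moreover have "b = (if type_equiv T U then 1 else 0)" if "H 22 \<langle>enc T, \<langle>enc U, b\<rangle>\<rangle>" for b
      using program_sound[OF that] ok unfolding holds_simps by blast
    ultimately show ?thesis using f by blast
  qed
  then show ?thesis by blast
qed

end
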